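(* Let $k\in\mathbb{N}$ ($k\ge1$) and $\beta\in(0,1)$ with $2k\beta\notin\mathbb{N}$. The solution to the initial-value problem $$\begin{cases}\dfrac{\partial}{\partial t}v_{2k}^\beta(x,t)=\dfrac{\partial^{2k\beta}}{\partial|x|^{2k\beta}}v_{2k}^\beta(x,t),\qquad x\in\mathbb{R},\ t>0,\\[2mm] v_{2k}^\beta(x,0)=\delta(x),\end{cases}$$ can be written (for $x\neq0$) as $$v_{2k}^\beta(x,t)=\frac{1}{\pi x}\mathbb{E}\left[\sin\left(x\,G^{2k}\!\left(\frac{1}{H^\beta(t)}\right)\right)\right]=\frac{1}{\pi x}\mathbb{E}\left[\sin\left(x\,G^{2k\beta}\!\left(\frac1t\right)\right)\right]$$ and coincides with the law of the pseudoprocess $V^{2k\beta}(t)=U^{2k}(H^\beta(t))$, $t>0$. Here $U^{2k}$ is the pseudoprocess of order $2k$ governed by $\partial_t u_{2k}=(-1)^{k+1}\partial_x^{2k}u_{2k}$, $H^\beta$ is a stable subordinator of order $\beta$ independent of $U^{2k}$, and, for $\gamma>0$ and $t>0$, $G^\gamma(t)$ is a random variable with density $$g^\gamma(x,t)=\gamma\,\frac{x^{\gamma-1}}{t}\,e^{-x^\gamma/t},\qquad x>0;$$ in the first representation $G^{2k}(1/s)$ is taken independent of $H^\beta(t)$ and evaluated at the random parameter $s=H^\beta(t)$.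
   Context: The Riesz fractional derivative of order $\gamma>0$, $m-1<\gamma<m$, $m\in\mathbb{N}$, is $$\frac{\partial^\gamma}{\partial|x|^\gamma}u(x)=-\frac{1}{2\cos\frac{\pi\gamma}{2}}\left[\frac{{}^+\partial^\gamma}{\partial x^\gamma}+\frac{{}^-\partial^\gamma}{\partial x^\gamma}\right]u(x),$$ with the Weyl fractional derivatives $$\frac{{}^+\partial^\gamma}{\partial x^\gamma}u(x)=\frac{1}{\Gamma(m-\gamma)}\frac{d^m}{dx^m}\int_{-\infty}^x\frac{u(y)}{(x-y)^{\gamma+1-m}}dy,\qquad \frac{{}^-\partial^\gamma}{\partial x^\gamma}u(x)=\frac{(-1)^m}{\Gamma(m-\gamma)}\frac{d^m}{dx^m}\int_x^{\infty}\frac{u(y)}{(y-x)^{\gamma+1-m}}dy.$$ With $\widehat u(\xi)=\int_{\mathbb{R}}e^{i\xi x}u(x)\,dx$, the Weyl derivatives have Fourier symbols $(\mp i\xi)^\gamma=|\xi|^\gamma e^{\mp\frac{i\pi\gamma}{2}\mathrm{sign}(\xi)}$ respectively, so the Riesz derivative has symbol $-|\xi|^\gamma$. The initial-value problem is understood through the $x$-Fourier transform: its solution is the function $v(\cdot,t)$ whose Fourier transform solves the transformed equation in $t$ with initial value $1$ at $t=0$ for every $\xi$. The pseudoprocess $U^{2k}$ has at time $s$ the signed density $u_{2k}(x,s)$ with $\int_{\mathbb{R}}e^{i\xi x}u_{2k}(x,s)\,dx=e^{-s\xi^{2k}}$. The subordinator $H^\beta(t)$ has density $h_\beta(s,t)$,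 $s\ge0$, with $\int_0^\infty e^{-\mu s}h_\beta(s,t)\,ds=e^{-t\mu^\beta}$, $\mu\ge0$. The law of $U^{2k}(H^\beta(t))$ is the signed density $\int_0^\infty u_{2k}(x,s)h_\beta(s,t)\,ds$. *)

theory Defs
  imports "HOL-Probability.Probability"
begin

section \<open>Fourier transform and Fourier symbols\<close>

definition fourier :: "(real \<Rightarrow> real) \<Rightarrow> real \<Rightarrow> complex" where
  "fourier f \<xi> = (CLINT x|lborel. iexp (\<xi> * x) * complex_of_real (f x))"

definition schwartz :: "(real \<Rightarrow> real) \<Rightarrow> bool" where
  "schwartz f \<longleftrightarrow>
     (\<forall>n x. (deriv ^^ n) f differentiable (at x)) \<and>
     (\<forall>n j. bounded (range (\<lambda>x. x ^ j * (deriv ^^ n) f x)))"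

text \<open>The Gaussian is a Schwartz function whose transform has no zeros, so an operator has at most
  one symbol.\<close>

definition has_fourier_symbol ::
    "((real \<Rightarrow> real) \<Rightarrow> real \<Rightarrow> real) \<Rightarrow> (real \<Rightarrow> complex) \<Rightarrow> bool" where
  "has_fourier_symbol A \<sigma> \<longleftrightarrow>
     (\<forall>f. schwartz f \<longrightarrow>
        integrable lborel (A f) \<and> (\<forall>\<xi>. fourier (A f) \<xi> = \<sigma> \<xi> * fourier f \<xi>))"

text \<open>\<open>fourier_solution A v\<close>: \<open>v\<close> solves \<open>\<partial>v/\<partial>t = A v\<close>, \<open>v(x,0) = \<delta>(x)\<close>, understood through the
  Fourier transform in \<open>x\<close>. The initial value, the transform \<open>1\<close> of \<open>\<delta>\<close>, is taken as a
  limit as \<open>t\<close> decreases to \<open>0\<close>, since \<open>v(\<cdot>,0)\<close> is not a function.\<close>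

definition fourier_solution ::
    "((real \<Rightarrow> real) \<Rightarrow> real \<Rightarrow> real) \<Rightarrow> (real \<Rightarrow> real \<Rightarrow> real) \<Rightarrow> bool" where
  "fourier_solution A v \<longleftrightarrow>
     (\<forall>t>0. integrable lborel (\<lambda>x. v x t)) \<and>
     (\<exists>\<sigma>. has_fourier_symbol A \<sigma> \<and>
        (\<forall>\<xi>. (\<forall>t>0. ((\<lambda>r. fourier (\<lambda>x. v x r) \<xi>) has_vector_derivative
                        \<sigma> \<xi> * fourier (\<lambda>x. v x t) \<xi>) (at t)) \<and>
              ((\<lambda>r. fourier (\<lambda>x. v x r) \<xi>) \<longlongrightarrow> 1) (at_right 0)))"

section \<open>Weyl and Riesz fractional derivatives\<close>

text \<open>For non-integer \<open>\<gamma> > 0\<close>, the integer \<open>m\<close> with \<open>m - 1 < \<gamma> < m\<close> is \<open>\<lceil>\<gamma>\<rceil>\<close>.\<close>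

definition weyl_plus :: "real \<Rightarrow> (real \<Rightarrow> real) \<Rightarrow> real \<Rightarrow> real" where
  "weyl_plus \<gamma> f x = (let m = nat \<lceil>\<gamma>\<rceil> in
     1 / Gamma (real m - \<gamma>) *
     (deriv ^^ m) (\<lambda>x. LBINT y:{..x}. f y / (x - y) powr (\<gamma> + 1 - real m)) x)"

definition weyl_minus :: "real \<Rightarrow> (real \<Rightarrow> real) \<Rightarrow> real \<Rightarrow> real" where
  "weyl_minus \<gamma> f x = (let m = nat \<lceil>\<gamma>\<rceil> in
     (-1) ^ m / Gamma (real m - \<gamma>) *
     (deriv ^^ m) (\<lambda>x. LBINT y:{x..}. f y / (y - x) powr (\<gamma> + 1 - real m)) x)"

definition riesz :: "real \<Rightarrow> (real \<Rightarrow> real) \<Rightarrow> real \<Rightarrow> real" where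
  "riesz \<gamma> f x = - 1 / (2 * cos (pi * \<gamma> / 2)) * (weyl_plus \<gamma> f x + weyl_minus \<gamma> f x)"

section \<open>Pseudoprocess, stable subordinator and the variables $G^\gamma$\<close>

text \<open>\<open>u x s\<close> is the signed density of $U^{2k}(s)$. The regularity that the governing equation
  demands selects the smooth version of the density that the transform determines almost
  everywhere.\<close>

definition pseudoprocess_density :: "nat \<Rightarrow> (real \<Rightarrow> real \<Rightarrow> real) \<Rightarrow> bool" where
  "pseudoprocess_density k u \<longleftrightarrow>
     (\<forall>s>0. integrable lborel (\<lambda>x. u x s) \<and>
       (\<forall>\<xi>. fourier (\<lambda>x. u x s) \<xi> = complex_of_real (exp (- s * \<xi> ^ (2 * k)))) \<and>
       (\<forall>x. (\<forall>j<2 * k. (deriv ^^ j) (\<lambda>y. u y s) differentiable (at x)) \<and>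
            ((\<lambda>r. u x r) has_real_derivative
               (-1) ^ (k + 1) * (deriv ^^ (2 * k)) (\<lambda>y. u y s) x) (at s)))"

definition stable_subordinator :: "'a measure \<Rightarrow> real \<Rightarrow> (real \<Rightarrow> 'a \<Rightarrow> real) \<Rightarrow> bool" where
  "stable_subordinator M \<beta> H \<longleftrightarrow>
     (\<forall>t\<ge>0. H t \<in> borel_measurable M) \<and>
     (AE \<omega> in M. H 0 \<omega> = 0) \<and>
     (AE \<omega> in M. mono_on {0..} (\<lambda>t. H t \<omega>) \<and>
                  (\<forall>t\<ge>0. continuous (at_right t) (\<lambda>t. H t \<omega>))) \<and>
     (\<forall>ts :: nat \<Rightarrow> real. mono ts \<and> 0 \<le> ts 0 \<longrightarrow>
        prob_space.indep_vars M (\<lambda>_. borel) (\<lambda>i \<omega>. H (ts (Suc i)) \<omega> - H (ts i) \<omega>) UNIV) \<and>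
     (\<forall>s\<ge>0. \<forall>t\<ge>0. distr M borel (\<lambda>\<omega>. H (s + t) \<omega> - H s \<omega>) = distr M borel (H t)) \<and>
     (\<forall>t\<ge>0. \<forall>\<mu>\<ge>0. (\<integral>\<omega>. exp (- \<mu> * H t \<omega>) \<partial>M) = exp (- t * \<mu> powr \<beta>))"

definition has_halfline_density :: "'a measure \<Rightarrow> ('a \<Rightarrow> real) \<Rightarrow> (real \<Rightarrow> real) \<Rightarrow> bool" where
  "has_halfline_density M X f \<longleftrightarrow>
     (\<forall>s\<ge>0. 0 \<le> f s) \<and> distributed M lborel X (\<lambda>s. ennreal (f s * indicator {0..} s))"

definition g_density :: "real \<Rightarrow> real \<Rightarrow> real \<Rightarrow> real" where
  "g_density \<gamma> x t =
     (if 0 < x then \<gamma> * (x powr (\<gamma> - 1) / t) * exp (- (x powr \<gamma>) / t) else 0)"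

text \<open>Independence of a family \<open>(Y \<tau>)\<close> and a random variable \<open>X\<close>, in the form that allows evaluating
  the family at a random parameter that is a function of \<open>X\<close>. Joint measurability with respect to a
  \<open>\<sigma>\<close>-algebra \<open>F\<close> independent of \<open>X\<close> is needed: if \<open>Y\<close> were only jointly measurable with respect to
  \<open>M\<close>, changing \<open>Y \<tau>\<close> on the event \<open>X = 1/\<tau>\<close>, which is null when \<open>X\<close> has a density, would keep all
  marginal laws and independences but alter \<open>Y (1/X)\<close>. Values \<open>Y \<tau>\<close> with \<open>\<tau> \<le> 0\<close> are
  irrelevant.\<close>

definition independent_family :: "'a measure \<Rightarrow> (real \<Rightarrow> 'a \<Rightarrow> real) \<Rightarrow> ('a \<Rightarrow> real) \<Rightarrow> bool" where
  "independent_family M Y X \<longleftrightarrow>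
     (\<exists>F. subalgebra M F \<and>
          (\<lambda>(\<tau>, \<omega>). Y \<tau> \<omega>) \<in> borel_measurable (borel \<Otimes>\<^sub>M F) \<and>
          prob_space.indep_set M (sets F) {X -` A \<inter> space M | A. A \<in> sets borel})"

text \<open>The signed density of $U^{2k}(H^\beta(t))$, for \<open>u\<close> the density of $U^{2k}$ and \<open>h\<close> that of
  $H^\beta$.\<close>

definition subordinated_density ::
    "(real \<Rightarrow> real \<Rightarrow> real) \<Rightarrow> (real \<Rightarrow> real \<Rightarrow> real) \<Rightarrow> real \<Rightarrow> real \<Rightarrow> real" where
  "subordinated_density u h x t = (LBINT s:{0..}. u x s * h s t)"

end

(* On Schwartz functions the Riesz derivative of order gamma is an absolutely convergent integral of
   differences of a derivative of f. Its symbol reduces to the integral of (1 - e^{-sz}) z^{-p-1}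
   over z > 0, which equals s^p Gamma(1-p)/p for real s > 0 by scaling, for Re s > 0 by analytic
   continuation, and on the imaginary axis by continuity. Hence the symbol is -|xi|^gamma, and every
   solution has the Fourier transform e^{-t |xi|^gamma}, which determines it almost everywhere.
   Fourier inversion gives u(x,s) as the cosine integral of e^{-s xi^{2k}}; integrating it against
   the law of H(t) gives the cosine integral of e^{-t |xi|^{2k beta}}. An integration by parts in xi
   turns either cosine integral into the expectation of a sine of a G-variable. *)

theory Submission
  imports Defs "HOL-Complex_Analysis.Complex_Analysis"
begin

section \<open>Integration tools\<close>

text \<open>The kernel z^{-p} of a Weyl integral, p = \<gamma> + 1 - m in (0,1), is not integrable
  at infinity, so Fubini cannot be applied to the Weyl integral itself. Of the m derivatives, m - 1
  merely produce powers of -i \<xi>; the last one is spent on an integration by parts that leaves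
  increments g(x) - g(x - \<sigma> z) against z^{-p-1}, which converges absolutely at both ends. For
  k > 1 the density of the pseudoprocess changes sign, so L^1 estimates replace probabilistic ones:
  scaling makes its L^1 norm independent of s, which is what Fubini against the law of H(t)
  requires, and uniqueness of transforms is reduced to nonnegative functions. A solution is
  determined only almost everywhere, whereas the sine representations are asserted at every x
  \<noteq> 0. They are therefore derived from explicit cosine integrals, with u identified pointwise
  by continuity. That a cosine integral is integrable in x is not read off its formula: for order 2k
  it is inherited from u, for order 2k\<beta> from subordination.\<close>

lemma has_field_derivative_integral_dominated:
  fixes f f' :: "'b::{real_normed_field,banach,second_countable_topology} \<Rightarrow> 'a \<Rightarrow> 'b"
    and w :: "'a \<Rightarrow> real"
  assumes \<delta>: "\<delta> > 0"
    and int: "\<And>s. s \<in> ball s0 \<delta> \<Longrightarrow> integrable M (f s)"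
    and meas: "f' s0 \<in> borel_measurable M"
    and der: "\<And>s z. s \<in> ball s0 \<delta> \<Longrightarrow> z \<in> space M \<Longrightarrow>
                ((\<lambda>s. f s z) has_field_derivative f' s z) (at s)"
    and bound: "\<And>s z. s \<in> ball s0 \<delta> \<Longrightarrow> z \<in> space M \<Longrightarrow> norm (f' s z) \<le> w z"
    and w: "integrable M w"
  shows "((\<lambda>s. \<integral>z. f s z \<partial>M) has_field_derivative (\<integral>z. f' s0 z \<partial>M)) (at s0)"
proof -
  let ?B = "ball s0 \<delta>"
  have s0: "s0 \<in> ?B" using \<delta> by simp
  have "((\<lambda>s. ((\<integral>z. f s z \<partial>M) - (\<integral>z. f s0 z \<partial>M)) / (s - s0)) \<longlongrightarrow> (\<integral>z. f' s0 z \<partial>M))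
          (at s0 within ?B)"
    unfolding tendsto_at_iff_sequentially comp_def
  proof (intro allI impI)
    fix X assume X: "\<forall>i::nat. X i \<in> ?B - {s0}" and lim: "X \<longlonglongrightarrow> s0"
    have eq: "((\<integral>z. f (X i) z \<partial>M) - (\<integral>z. f s0 z \<partial>M)) / (X i - s0)
        = (\<integral>z. (f (X i) z - f s0 z) / (X i - s0) \<partial>M)" for i
    proof -
      have "integrable M (f (X i))" using X int by blast
      then show ?thesis using int[OF s0] by simp
    qed
    have "(\<lambda>i. \<integral>z. (f (X i) z - f s0 z) / (X i - s0) \<partial>M) \<longlonglongrightarrow> (\<integral>z. f' s0 z \<partial>M)"
    proof (rule integral_dominated_convergence[where w=w])
      show "(\<lambda>z. (f (X i) z - f s0 z) / (X i - s0)) \<in> borel_measurable M" for i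
        using X int[of "X i"] int[OF s0]
        by (intro borel_measurable_divide borel_measurable_diff borel_measurable_integrable
              borel_measurable_const) blast+
      show "AE z in M. (\<lambda>i. (f (X i) z - f s0 z) / (X i - s0)) \<longlonglongrightarrow> f' s0 z"
      proof (rule AE_I2)
        fix z assume z: "z \<in> space M"
        have "((\<lambda>s. (f s z - f s0 z) / (s - s0)) \<longlongrightarrow> f' s0 z) (at s0)"
          using der[OF s0 z] by (simp add: has_field_derivative_iff)
        then show "(\<lambda>i. (f (X i) z - f s0 z) / (X i - s0)) \<longlonglongrightarrow> f' s0 z"
          using X lim unfolding tendsto_at_iff_sequentially comp_def by blast
      qed
      show "AE z in M. norm ((f (X i) z - f s0 z) / (X i - s0)) \<le> w z" for i
      proof (rule AE_I2)
        fix z assume z: "z \<in> space M"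
        \<comment> \<open>The ball is convex, so a bound on the derivative bounds every difference
          quotient. Working over a general field serves both the complex parameter s and the real
          point x below.\<close>
        have "norm (f (X i) z - f s0 z) \<le> w z * norm (X i - s0)"
        proof (rule field_differentiable_bound[of ?B])
          show "((\<lambda>s. f s z) has_field_derivative f' s z) (at s within ?B)" if "s \<in> ?B" for s
            by (rule has_field_derivative_at_within[OF der[OF that z]])
          show "norm (f' s z) \<le> w z" if "s \<in> ?B" for s
            by (rule bound[OF that z])
          show "X i \<in> ?B" using X by blast
        qed (use s0 in auto)
        then show "norm ((f (X i) z - f s0 z) / (X i - s0)) \<le> w z"
          using X by (simp add: norm_divide pos_divide_le_eq)
      qed
    qed (use meas w in auto)
    then show "(\<lambda>i. ((\<integral>z. f (X i) z \<partial>M) - (\<integral>z. f s0 z \<partial>M)) / (X i - s0))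
        \<longlonglongrightarrow> (\<integral>z. f' s0 z \<partial>M)" by (simp add: eq)
  qed
  then show ?thesis
    by (simp only: has_field_derivative_iff at_within_open[OF s0 open_ball])
qed

text \<open>Integrations by parts on the half-line are done by applying this to a product: the
  boundary terms appear as the two limits, so singular powers at 0 are allowed.\<close>

lemma integral_FTC_halfline:
  fixes F f :: "real \<Rightarrow> 'a::euclidean_space"
  assumes "\<And>x. x > 0 \<Longrightarrow> (F has_vector_derivative f x) (at x)"
    and "\<And>x. x > 0 \<Longrightarrow> isCont f x"
    and "set_integrable lborel {0<..} f"
    and "(F \<longlongrightarrow> A) (at_right 0)" and "(F \<longlongrightarrow> B) at_top"
  shows "(LINT x:{0<..}|lborel. f x) = B - A"
proof -
  have "einterval 0 \<infinity> = {0<..}" by (auto simp: einterval_def)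
  then have "(LBINT x=0..\<infinity>. f x) = B - A"
    using assms by (intro interval_integral_FTC_integrable[where F=F])
      (auto simp: zero_ereal_def ereal_tendsto_simps)
  then show ?thesis by (simp add: interval_lebesgue_integral_0_infty)
qed

lemma set_integrable_FTC_halfline_nonneg:
  fixes F f :: "real \<Rightarrow> real"
  assumes "\<And>x. x > 0 \<Longrightarrow> DERIV F x :> f x"
    and "\<And>x. x > 0 \<Longrightarrow> isCont f x"
    and "\<And>x. x > 0 \<Longrightarrow> 0 \<le> f x"
    and "(F \<longlongrightarrow> A) (at_right 0)" and "(F \<longlongrightarrow> B) at_top"
  shows "set_integrable lborel {0<..} f"
proof -
  have "einterval 0 \<infinity> = {0<..}" by (auto simp: einterval_def)
  moreover have "set_integrable lborel (einterval 0 \<infinity>) f"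
    using assms by (intro interval_integral_FTC_nonneg(1)[where F=F and A=A and B=B])
      (auto simp: zero_ereal_def ereal_tendsto_simps)
  ultimately show ?thesis by simp
qed

section \<open>Powers and rational functions that serve as majorants\<close>

lemma set_integrable_powr_unit:
  assumes "q > -1"
  shows "set_integrable lborel {0<..<1::real} (\<lambda>z. z powr q)"
proof -
  have "einterval 0 1 = {0<..<1}" by (auto simp: einterval_def)
  moreover have "((\<lambda>z::real. z powr (q + 1) / (q + 1)) \<longlongrightarrow> 0 powr (q + 1) / (q + 1)) (at_right 0)"
    using assms by (intro tendsto_intros) (auto simp: eventually_at_right_less eventually_at_filter)
  moreover have "((\<lambda>z::real. z powr (q + 1) / (q + 1)) \<longlongrightarrow> 1 powr (q + 1) / (q + 1)) (at_left 1)"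
    using assms by (intro tendsto_intros) auto
  ultimately have "set_integrable lborel (einterval 0 1) (\<lambda>z. z powr q)"
    using assms
    by (intro interval_integral_FTC_nonneg(1)[where F="\<lambda>z. z powr (q + 1) / (q + 1)"
          and A="0 powr (q + 1) / (q + 1)" and B="1 powr (q + 1) / (q + 1)"])
      (auto simp: zero_ereal_def one_ereal_def ereal_tendsto_simps powr_diff
        intro!: derivative_eq_intros continuous_intros)
  then show ?thesis using \<open>einterval 0 1 = {0<..<1}\<close> by simp
qed

lemma set_integrable_powr_tail:
  assumes "q < -1"
  shows "set_integrable lborel {1::real<..} (\<lambda>z. z powr q)"
proof -
  have "einterval 1 \<infinity> = {1<..}" by (auto simp: einterval_def)
  moreover have "((\<lambda>z::real. z powr (q + 1) / (q + 1)) \<longlongrightarrow> 1 powr (q + 1) / (q + 1)) (at_right 1)"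
    using assms by (intro tendsto_intros) auto
  moreover have "((\<lambda>z::real. z powr (q + 1) / (q + 1)) \<longlongrightarrow> 0 / (q + 1)) at_top"
    using assms by (intro tendsto_intros tendsto_neg_powr filterlim_ident) auto
  ultimately have "set_integrable lborel (einterval 1 \<infinity>) (\<lambda>z. z powr q)"
    using assms
    by (intro interval_integral_FTC_nonneg(1)[where F="\<lambda>z. z powr (q + 1) / (q + 1)"
          and A="1 powr (q + 1) / (q + 1)" and B="0 / (q + 1)"])
      (auto simp: one_ereal_def ereal_tendsto_simps powr_diff
        intro!: derivative_eq_intros continuous_intros)
  then show ?thesis using \<open>einterval 1 \<infinity> = {1<..}\<close> by simp
qed

text \<open>The common majorant for 1 - e^{-sz} and for increments of Schwartz functions. It behaves
  like z^{-p} near 0 and like z^{-p-1} at infinity, and both ends converge exactly because 0 < p <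
  1.\<close>

lemma set_integrable_min_powr:
  assumes "0 < p" "p < 1"
  shows "set_integrable lborel {0::real<..} (\<lambda>z. min 1 z * z powr (-p-1))"
proof -
  have 1: "set_integrable lborel {0<..<1::real} (\<lambda>z. z powr (-p))"
    using assms by (intro set_integrable_powr_unit) auto
  have 2: "set_integrable lborel {1::real<..} (\<lambda>z. z powr (-p-1))"
    using assms by (intro set_integrable_powr_tail) auto
  have "integrable lborel (\<lambda>z. indicator {0<..<1::real} z *\<^sub>R z powr (-p)
          + indicator {1<..} z *\<^sub>R z powr (-p-1))"
    using 1 2 unfolding set_integrable_def by simp
  then have "integrable lborel (\<lambda>z::real. indicator {0<..} z *\<^sub>R (min 1 z * z powr (-p-1)))"
  proof (rule Bochner_Integration.integrable_bound)
    have "AE z::real in lborel. z \<noteq> 1"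
      by (rule AE_lborel_singleton)
    then show "AE z::real in lborel. norm (indicator {0<..} z *\<^sub>R (min 1 z * z powr (-p-1)))
       \<le> norm (indicator {0<..<1::real} z *\<^sub>R z powr (-p) + indicator {1<..} z *\<^sub>R z powr (-p-1))"
    proof eventually_elim
      fix z :: real assume "z \<noteq> 1"
      have "z * z powr (-p-1) = z powr (-p)" if "z > 0"
        using that by (simp add: powr_diff)
      then show "norm (indicator {0<..} z *\<^sub>R (min 1 z * z powr (-p-1)))
       \<le> norm (indicator {0<..<1::real} z *\<^sub>R z powr (-p) + indicator {1<..} z *\<^sub>R z powr (-p-1))"
        using \<open>z \<noteq> 1\<close> by (auto simp: indicator_def abs_mult)
    qed
  qed simp
  then show ?thesis unfolding set_integrable_def .
qed

lemma integrable_inverse_one_plus_square: "integrable lborel (\<lambda>x::real. 1 / (1 + x\<^sup>2))"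
proof -
  have pos: "1 + x\<^sup>2 > (0::real)" for x by (simp add: add_pos_nonneg)
  have "einterval (-\<infinity>) \<infinity> = UNIV" by (auto simp: einterval_def)
  moreover have "set_integrable lborel (einterval (-\<infinity>) \<infinity>) (\<lambda>x::real. 1 / (1 + x\<^sup>2))"
  proof (rule interval_integral_FTC_nonneg(1)[where F=arctan and A="-(pi/2)" and B="pi/2"])
    show "DERIV arctan x :> 1 / (1 + x\<^sup>2)" for x
      using DERIV_arctan[of x] by (simp add: inverse_eq_divide)
    show "isCont (\<lambda>x::real. 1 / (1 + x\<^sup>2)) x" for x
      using pos[of x] by (intro continuous_intros) simp
    show "AE x::real in lborel. - \<infinity> < ereal x \<longrightarrow> ereal x < \<infinity> \<longrightarrow> 0 \<le> 1 / (1 + x\<^sup>2)"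
      by (intro AE_I2 impI divide_nonneg_pos pos) simp
    show "((arctan \<circ> real_of_ereal) \<longlongrightarrow> - (pi / 2)) (at_right (- \<infinity>))"
      by (simp add: ereal_tendsto_simps tendsto_arctan_at_bot)
    show "((arctan \<circ> real_of_ereal) \<longlongrightarrow> pi / 2) (at_left \<infinity>)"
      by (simp add: ereal_tendsto_simps tendsto_arctan_at_top)
  qed simp
  ultimately have "set_integrable lborel UNIV (\<lambda>x::real. 1 / (1 + x\<^sup>2))" by metis
  then show ?thesis unfolding set_integrable_def by simp
qed

section \<open>The integral $\int_0^\infty (1 - e^{-sz}) z^{-p-1}\,dz$\<close>

text \<open>The closed left half-plane is convex and the derivative of \<open>exp\<close> has norm
  at most 1 on it. The boundary matters: the Fourier symbol is read off on the imaginary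
  axis.\<close>

lemma norm_exp_diff_le:
  fixes u v :: complex
  assumes "Re u \<le> 0" "Re v \<le> 0"
  shows "norm (exp u - exp v) \<le> norm (u - v)"
proof -
  have "norm (exp u - exp v) \<le> 1 * norm (u - v)"
  proof (rule field_differentiable_bound[of "{w. Re w \<le> 0}"])
    show "convex {w. Re w \<le> 0}" by (rule convex_halfspace_Re_le)
    show "(exp has_field_derivative exp w) (at w within {w. Re w \<le> 0})" for w :: complex
      by (rule has_field_derivative_at_within[OF DERIV_exp])
    show "norm (exp w) \<le> 1" if "w \<in> {w. Re w \<le> 0}" for w
      using that by simp
  qed (use assms in auto)
  then show ?thesis by simp
qed

lemma norm_one_minus_exp_le:
  assumes "0 \<le> Re s" "0 \<le> z"
  shows "norm (1 - exp (- s * complex_of_real z)) \<le> (2 + norm s) * min 1 z"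
proof -
  have 1: "norm (1 - exp (- s * complex_of_real z)) \<le> norm s * z"
    using norm_exp_diff_le[of 0 "- s * complex_of_real z"] assms by (simp add: norm_mult)
  have "norm (1 - exp (- s * complex_of_real z)) \<le> norm (1::complex) + norm (exp (- s * complex_of_real z))"
    by (rule norm_triangle_ineq4)
  also have "\<dots> \<le> 2" using assms by simp
  finally have 2: "norm (1 - exp (- s * complex_of_real z)) \<le> 2" .
  show ?thesis
  proof (cases "z \<le> 1")
    case True
    with 1 assms show ?thesis by (simp add: min_def distrib_right)
  next
    case False
    with 2 show ?thesis by (simp add: min_def) (smt (verit) norm_ge_zero)
  qed
qed

text \<open>Up to the factor p / Gamma(1-p), the Laplace exponent of the p-stable subordinator in
  Levy-Khintchine form. On the imaginary axis it is the multiplier of the difference form of the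
  Weyl derivative.\<close>

definition levy_exponent :: "real \<Rightarrow> complex \<Rightarrow> complex" where
  "levy_exponent p s =
     (CLINT z:{0<..}|lborel. (1 - exp (- s * complex_of_real z)) * complex_of_real (z powr (-p-1)))"

context
  fixes p :: real
  assumes p: "0 < p" "p < 1"
begin

lemma set_integrable_levy_exponent:
  assumes "0 \<le> Re s"
  shows "set_integrable lborel {0<..}
           (\<lambda>z. (1 - exp (- s * complex_of_real z)) * complex_of_real (z powr (-p-1)))"
  unfolding set_integrable_def
proof (rule Bochner_Integration.integrable_bound)
  show "integrable lborel (\<lambda>z. (2 + norm s) * (indicator {0<..} z *\<^sub>R (min 1 z * z powr (-p-1))))"
    using set_integrable_min_powr[OF p] unfolding set_integrable_def by simp
  show "AE z in lborel. norm (indicator {0<..} z *\<^sub>R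
      ((1 - exp (- s * complex_of_real z)) * complex_of_real (z powr (-p-1))))
      \<le> norm ((2 + norm s) * (indicator {0<..} z *\<^sub>R (min 1 z * z powr (-p-1))))"
  proof (rule AE_I2)
    fix z :: real
    show "norm (indicator {0<..} z *\<^sub>R
      ((1 - exp (- s * complex_of_real z)) * complex_of_real (z powr (-p-1))))
      \<le> norm ((2 + norm s) * (indicator {0<..} z *\<^sub>R (min 1 z * z powr (-p-1))))"
      using norm_one_minus_exp_le[OF assms, of z]
      by (cases "z > 0") (auto simp: norm_mult abs_mult mult.assoc[symmetric] intro!: mult_right_mono)
  qed
qed simp

text \<open>Differentiating under the integral produces z e^{-sz} z^{-p-1}, which is integrable at
  infinity only through the decay of e^{-sz}. Hence the open half-plane, and the choice \<delta> =
  Re s0 / 2, which keeps Re s at least \<delta> on the ball.\<close>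

lemma levy_exponent_holomorphic: "levy_exponent p holomorphic_on {s. 0 < Re s}"
proof -
  have "\<exists>D. (levy_exponent p has_field_derivative D) (at s0)" if s0: "0 < Re s0" for s0
  proof -
    define \<delta> where "\<delta> = Re s0 / 2"
    have \<delta>: "\<delta> > 0" using s0 by (simp add: \<delta>_def)
    have Re: "Re s \<ge> \<delta>" if "s \<in> ball s0 \<delta>" for s
      using that abs_Re_le_cmod[of "s0 - s"] by (auto simp: dist_norm \<delta>_def)
    define f where "f s z = indicator {0<..} z *\<^sub>R
      ((1 - exp (- s * complex_of_real z)) * complex_of_real (z powr (-p-1)))" for s z
    define f' where "f' s z = indicator {0<..} z *\<^sub>R
      (complex_of_real z * exp (- s * complex_of_real z) * complex_of_real (z powr (-p-1)))" for s z
    have "((\<lambda>s. \<integral>z. f s z \<partial>lborel) has_field_derivative (\<integral>z. f' s0 z \<partial>lborel)) (at s0)"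
    proof (rule has_field_derivative_integral_dominated[OF \<delta>,
        where w="\<lambda>z. (1 + 1 / \<delta>) * (indicator {0<..} z *\<^sub>R (min 1 z * z powr (-p-1)))"])
      show "integrable lborel (f s)" if "s \<in> ball s0 \<delta>" for s
        using set_integrable_levy_exponent[of s] Re[OF that] \<delta>
        unfolding set_integrable_def f_def by simp
      show "f' s0 \<in> borel_measurable lborel" unfolding f'_def by measurable
      show "integrable lborel (\<lambda>z. (1 + 1 / \<delta>) * (indicator {0<..} z *\<^sub>R (min 1 z * z powr (-p-1))))"
        using set_integrable_min_powr[OF p] unfolding set_integrable_def by simp
      show "((\<lambda>s. f s z) has_field_derivative f' s z) (at s)" for s z
        unfolding f_def f'_def scaleR_conv_of_real by (auto intro!: derivative_eq_intros)
      show "norm (f' s z) \<le> (1 + 1 / \<delta>) * (indicator {0<..} z *\<^sub>R (min 1 z * z powr (-p-1)))"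
        if s: "s \<in> ball s0 \<delta>" for s and z :: real
      proof (cases "z > 0")
        case True
        have e: "exp (- Re s * z) \<le> exp (- \<delta> * z)" using Re[OF s] True by simp
        \<comment> \<open>The bounds 1/\<delta> (for large z) and z (for small z) on z
          e^{-\<delta>z} together give a multiple of \<open>min 1 z\<close>, hence the same majorant
          as before.\<close>
        have "\<delta> * z \<le> exp (\<delta> * z)" using exp_ge_add_one_self[of "\<delta> * z"] by linarith
        then have "z * exp (- \<delta> * z) \<le> 1 / \<delta>"
          using \<delta> by (simp add: exp_minus field_simps)
        moreover have "z * exp (- \<delta> * z) \<le> z" using True \<delta> by simp
        ultimately have "z * exp (- \<delta> * z) \<le> (1 + 1 / \<delta>) * min 1 z"
          using \<delta> True by (auto simp: min_def distrib_right intro: add_increasing2)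
        with e True have "z * exp (- Re s * z) \<le> (1 + 1 / \<delta>) * min 1 z"
          by (meson mult_left_mono order_trans less_imp_le)
        then have "z * exp (- Re s * z) * z powr (-p-1) \<le> (1 + 1 / \<delta>) * min 1 z * z powr (-p-1)"
          by (rule mult_right_mono) simp
        then show ?thesis using True by (simp add: f'_def norm_mult mult.assoc)
      qed (simp add: f'_def)
    qed
    then show ?thesis
      unfolding levy_exponent_def[abs_def] set_lebesgue_integral_def f_def by blast
  qed
  then show ?thesis
    by (auto simp: holomorphic_on_def field_differentiable_def intro: has_field_derivative_at_within)
qed

text \<open>Substituting z/s gives the Jacobian 1/s, and the kernel contributes s^{p+1}.\<close>

lemma levy_exponent_scale:
  assumes "s > 0"
  shows "levy_exponent p (of_real s) = of_real (s powr p) * levy_exponent p 1"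
proof -
  have "levy_exponent p (of_real s) = (CLINT z|lborel. indicator {0<..} z *\<^sub>R
      ((1 - exp (- of_real s * complex_of_real z)) * complex_of_real (z powr (-p-1))))"
    by (simp add: levy_exponent_def set_lebesgue_integral_def)
  also have "\<dots> = \<bar>1 / s\<bar> *\<^sub>R (CLINT z|lborel. indicator {0<..} (0 + 1 / s * z) *\<^sub>R
      ((1 - exp (- of_real s * complex_of_real (0 + 1 / s * z)))
        * complex_of_real ((0 + 1 / s * z) powr (-p-1))))"
    using assms by (intro lborel_integral_real_affine) simp
  also have "(CLINT z|lborel. indicator {0<..} (0 + 1 / s * z) *\<^sub>R
      ((1 - exp (- of_real s * complex_of_real (0 + 1 / s * z)))
        * complex_of_real ((0 + 1 / s * z) powr (-p-1)))) =
     (CLINT z|lborel. of_real (s powr (p + 1)) * (indicator {0<..} z *\<^sub>R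
      ((1 - exp (- 1 * complex_of_real z)) * complex_of_real (z powr (-p-1)))))"
  proof (rule Bochner_Integration.integral_cong)
    fix z :: real
    have "(z / s) powr (-p-1) = s powr (p + 1) * z powr (-p-1)" if "z > 0"
    proof -
      have "(z / s) powr (-p-1) = z powr (-p-1) / s powr (-(p+1))"
        using that assms by (subst powr_divide) simp_all
      then show ?thesis by (simp only: powr_minus) (simp add: field_simps)
    qed
    then show "indicator {0<..} (0 + 1 / s * z) *\<^sub>R
      ((1 - exp (- of_real s * complex_of_real (0 + 1 / s * z)))
        * complex_of_real ((0 + 1 / s * z) powr (-p-1))) =
      of_real (s powr (p + 1)) * (indicator {0<..} z *\<^sub>R
      ((1 - exp (- 1 * complex_of_real z)) * complex_of_real (z powr (-p-1))))"
      using assms by (cases "z > 0") (auto simp: indicator_def zero_less_divide_iff)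
  qed simp
  also have "\<dots> = of_real (s powr (p + 1)) * levy_exponent p 1"
    by (simp only: integral_mult_right_zero levy_exponent_def set_lebesgue_integral_def)
  also have "\<bar>1 / s\<bar> *\<^sub>R \<dots> = of_real (s powr p) * levy_exponent p 1"
    using assms by (simp add: scaleR_conv_of_real powr_add)
  finally show ?thesis .
qed

lemma one_minus_exp_of_real:
  "1 - exp (- 1 * complex_of_real z) = complex_of_real (1 - exp (- z))"
  using exp_of_real[of "- z", where 'a=complex] by simp

text \<open>Integration by parts trades the kernel z^{-p-1} for z^{-p}/p and differentiates 1 -
  e^{-z} to e^{-z}, which leaves the Gamma integral at 1 - p.\<close>

lemma levy_exponent_one: "levy_exponent p 1 = of_real (Gamma (1 - p) / p)"
proof -
  have e: "integrable lborel (\<lambda>z. indicator {0<..} z *\<^sub>R (exp (- z) * z powr (-p)))" (is ?I)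
    and G: "(LINT z:{0<..}|lborel. exp (- z) * z powr (-p)) = Gamma (1 - p)" (is ?G)
  proof -
    have "has_bochner_integral lborel (\<lambda>z. indicator {0..} z * z powr (1 - p - 1) / exp z) (Gamma (1 - p))"
      using p Gamma_conv_nn_integral_real[of "1 - p"]
      by (intro has_bochner_integral_nn_integral) auto
    moreover have "(\<lambda>z. indicator {0..} z * z powr (1 - p - 1) / exp z)
        = (\<lambda>z. indicator {0<..} z *\<^sub>R (exp (- z) * z powr (-p)))"
      by (auto simp: fun_eq_iff indicator_def exp_minus field_simps)
    ultimately show ?I ?G
      by (auto simp: has_bochner_integral_iff set_lebesgue_integral_def)
  qed
  have d: "integrable lborel (\<lambda>z. indicator {0<..} z *\<^sub>R ((1 - exp (- z)) * z powr (-p-1)))"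
  proof (rule Bochner_Integration.integrable_bound)
    show "integrable lborel (\<lambda>z. 3 * (indicator {0<..} z *\<^sub>R (min 1 z * z powr (-p-1))))"
      using set_integrable_min_powr[OF p] unfolding set_integrable_def by simp
    show "AE z in lborel. norm (indicator {0<..} z *\<^sub>R ((1 - exp (- z)) * z powr (-p-1)))
      \<le> norm (3 * (indicator {0<..} z *\<^sub>R (min 1 z * z powr (-p-1))))"
    proof (rule AE_I2)
      fix z :: real
      have "\<bar>1 - exp (- z)\<bar> \<le> 3 * min 1 z" if "z > 0"
        using norm_one_minus_exp_le[of 1 z] that
        by (simp only: one_minus_exp_of_real norm_of_real) simp
      then show "norm (indicator {0<..} z *\<^sub>R ((1 - exp (- z)) * z powr (-p-1)))
        \<le> norm (3 * (indicator {0<..} z *\<^sub>R (min 1 z * z powr (-p-1))))"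
        by (cases "z > 0") (auto simp: abs_mult mult.assoc[symmetric] intro!: mult_right_mono)
    qed
  qed simp
  \<comment> \<open>The derivative of \<open>?F\<close> is the difference of the two integrands. The
    boundary terms vanish, being at most z^{1-p}/p near 0 and z^{-p}/p at infinity.\<close>
  let ?F = "\<lambda>z. - ((1 - exp (- z)) * z powr (-p)) / p"
  have l0: "(?F \<longlongrightarrow> 0) (at_right 0)"
  proof (rule Lim_null_comparison)
    show "\<forall>\<^sub>F z in at_right 0. norm (?F z) \<le> z powr (1 - p) / p"
      unfolding eventually_at_filter
    proof (intro always_eventually allI impI)
      fix z :: real assume "z \<noteq> 0" "z \<in> {0<..}"
      then have z: "z > 0" by simp
      have "1 - exp (- z) \<le> z" using exp_ge_add_one_self[of "-z"] by linarith
      then have "(1 - exp (- z)) * z powr (-p) \<le> z * z powr (-p)"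
        by (rule mult_right_mono) simp
      also have "z * z powr (-p) = z powr (1 - p)" using z by (simp add: powr_diff powr_minus_divide)
      finally show "norm (?F z) \<le> z powr (1 - p) / p"
        using z p by (simp add: abs_mult divide_right_mono)
    qed
    have "((\<lambda>z::real. z powr (1 - p) / p) \<longlongrightarrow> 0 powr (1 - p) / p) (at_right 0)"
      using p by (intro tendsto_intros) (auto simp: eventually_at_filter)
    then show "((\<lambda>z::real. z powr (1 - p) / p) \<longlongrightarrow> 0) (at_right 0)" by simp
  qed
  have l1: "(?F \<longlongrightarrow> 0) at_top"
  proof (rule Lim_null_comparison)
    show "\<forall>\<^sub>F z in at_top. norm (?F z) \<le> z powr (-p) / p"
      using eventually_gt_at_top[of 0]
    proof eventually_elim
      case (elim z)
      have "(1 - exp (- z)) * z powr (-p) \<le> 1 * z powr (-p)"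
        by (rule mult_right_mono) simp_all
      then show ?case using elim p by (simp add: abs_mult divide_right_mono)
    qed
    have "((\<lambda>z::real. z powr (-p) / p) \<longlongrightarrow> 0 / p) at_top"
      using p by (intro tendsto_intros tendsto_neg_powr filterlim_ident) auto
    then show "((\<lambda>z::real. z powr (-p) / p) \<longlongrightarrow> 0) at_top" by simp
  qed
  have "(LINT z:{0<..}|lborel. (1 - exp (- z)) * z powr (-p-1) - exp (- z) * z powr (-p) / p) = 0 - 0"
  proof (rule integral_FTC_halfline[OF _ _ _ l0 l1])
    fix z :: real assume "z > 0"
    then have "DERIV ?F z :> (1 - exp (- z)) * z powr (-p-1) - exp (- z) * z powr (-p) / p"
      using p by (auto intro!: derivative_eq_intros simp: field_simps powr_diff)
    then show "(?F has_vector_derivative (1 - exp (- z)) * z powr (-p-1) - exp (- z) * z powr (-p) / p) (at z)"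
      by (simp add: has_real_derivative_iff_has_vector_derivative)
    show "isCont (\<lambda>z. (1 - exp (- z)) * z powr (-p-1) - exp (- z) * z powr (-p) / p) z"
      using \<open>z > 0\<close> p by (intro continuous_intros) auto
  next
    have "integrable lborel (\<lambda>z. indicator {0<..} z *\<^sub>R ((1 - exp (- z)) * z powr (-p-1))
        - indicator {0<..} z *\<^sub>R (exp (- z) * z powr (-p)) / p)"
      using d e by simp
    then show "set_integrable lborel {0<..} (\<lambda>z. (1 - exp (- z)) * z powr (-p-1) - exp (- z) * z powr (-p) / p)"
      unfolding set_integrable_def by (simp add: right_diff_distrib)
  qed
  moreover have "(LINT z:{0<..}|lborel. (1 - exp (- z)) * z powr (-p-1) - exp (- z) * z powr (-p) / p)
      = (LINT z:{0<..}|lborel. (1 - exp (- z)) * z powr (-p-1)) - Gamma (1 - p) / p"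
    using d e by (simp add: set_integral_diff set_integrable_def G)
  ultimately have "(LINT z:{0<..}|lborel. (1 - exp (- z)) * z powr (-p-1)) = Gamma (1 - p) / p"
    by simp
  then have "of_real (Gamma (1 - p) / p)
      = (CLINT z:{0<..}|lborel. complex_of_real ((1 - exp (- z)) * z powr (-p-1)))"
    by (simp only: set_integral_complex_of_real)
  also have "\<dots> = levy_exponent p 1"
    by (simp only: levy_exponent_def one_minus_exp_of_real of_real_mult)
  finally show ?thesis ..
qed

text \<open>The principal power is holomorphic here because its branch cut lies in the left
  half-plane. The two sides agree on the positive axis by scaling, and this axis accumulates at the
  interior point 1.\<close>

lemma levy_exponent_right_half_plane:
  assumes "0 < Re s"
  shows "levy_exponent p s = s powr of_real p * of_real (Gamma (1 - p) / p)"
proof -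
  let ?S = "{s. 0 < Re s}" and ?U = "complex_of_real ` {0<..}"
  have "levy_exponent p s - s powr of_real p * of_real (Gamma (1 - p) / p) = 0"
  proof (rule analytic_continuation[of "\<lambda>s. levy_exponent p s - s powr of_real p * of_real (Gamma (1 - p) / p)"
        ?S ?U 1])
    show "(\<lambda>s. levy_exponent p s - s powr of_real p * of_real (Gamma (1 - p) / p)) holomorphic_on ?S"
      by (intro holomorphic_intros levy_exponent_holomorphic) (simp_all add: complex_nonpos_Reals_iff)
    show "open ?S" by (rule open_halfspace_Re_gt)
    show "connected ?S" by (intro convex_connected convex_halfspace_Re_gt)
    show "1 islimpt ?U"
      unfolding islimpt_sequential
    proof (intro exI conjI allI)
      let ?X = "\<lambda>n. complex_of_real (1 + 1 / real (Suc n))"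
      show "?X n \<in> ?U - {1}" for n
      proof -
        have "1 + 1 / real (Suc n) \<in> {0<..}" "1 + 1 / real (Suc n) \<noteq> 1"
          by (simp_all add: add_pos_nonneg)
        then show ?thesis by (metis Diff_iff image_eqI of_real_eq_1_iff singletonD)
      qed
      have "(\<lambda>n. 1 + 1 / real (Suc n)) \<longlonglongrightarrow> 1 + 0"
        by (intro tendsto_intros LIMSEQ_Suc[OF lim_1_over_n])
      then show "?X \<longlonglongrightarrow> 1"
        using tendsto_of_real[of "\<lambda>n. 1 + 1 / real (Suc n)" 1 sequentially, where 'a=complex]
        by (simp only: add_0_right of_real_1)
    qed
    show "levy_exponent p z - z powr of_real p * of_real (Gamma (1 - p) / p) = 0" if U: "z \<in> ?U" for z
    proof -
      obtain r where z: "z = of_real r" and "r \<in> {0<..}" using U by blast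
      then have r: "r > 0" by simp
      show ?thesis
        by (simp only: z levy_exponent_scale[OF r] levy_exponent_one powr_of_real[OF less_imp_le[OF r]] diff_self)
    qed
  qed (use assms in auto)
  then show ?thesis by simp
qed

text \<open>Approach s from inside by s + 1/(n+1), whose norm is at most |s| + 1; this turns the
  constant 2 + |s| into 3 + |s|. Since s \<noteq> 0, it is off the branch cut and the power is
  continuous there.\<close>

lemma levy_exponent_eq:
  assumes "0 \<le> Re s" "s \<noteq> 0"
  shows "levy_exponent p s = s powr of_real p * of_real (Gamma (1 - p) / p)"
proof -
  let ?X = "\<lambda>n. s + complex_of_real (1 / real (Suc n))"
  have Re: "0 < Re (?X n)" for n using assms by (simp add: add_nonneg_pos)
  have X: "?X \<longlonglongrightarrow> s"
    using tendsto_add[OF tendsto_const tendsto_of_real[OF LIMSEQ_Suc[OF lim_1_over_n]], of s] by simp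
  have sn: "s \<notin> \<real>\<^sub>\<le>\<^sub>0"
    using assms by (auto simp: complex_nonpos_Reals_iff complex_eq_iff)
  have "(\<lambda>n. ?X n powr of_real p * of_real (Gamma (1 - p) / p)) \<longlonglongrightarrow> s powr of_real p * of_real (Gamma (1 - p) / p)"
    using X sn by (intro tendsto_intros) auto
  then have 1: "(\<lambda>n. levy_exponent p (?X n)) \<longlonglongrightarrow> s powr of_real p * of_real (Gamma (1 - p) / p)"
    by (simp only: levy_exponent_right_half_plane[OF Re])
  have 2: "(\<lambda>n. levy_exponent p (?X n)) \<longlonglongrightarrow> levy_exponent p s"
    unfolding levy_exponent_def set_lebesgue_integral_def
  proof (rule integral_dominated_convergence[where
      w="\<lambda>z. (3 + norm s) * (indicator {0<..} z *\<^sub>R (min 1 z * z powr (-p-1)))"])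
    show "integrable lborel (\<lambda>z. (3 + norm s) * (indicator {0<..} z *\<^sub>R (min 1 z * z powr (-p-1))))"
      using set_integrable_min_powr[OF p] unfolding set_integrable_def by simp
    show "AE z in lborel. (\<lambda>n. indicator {0<..} z *\<^sub>R
        ((1 - exp (- ?X n * complex_of_real z)) * complex_of_real (z powr (- p - 1))))
        \<longlonglongrightarrow> indicator {0<..} z *\<^sub>R
        ((1 - exp (- s * complex_of_real z)) * complex_of_real (z powr (- p - 1)))"
      using X by (intro AE_I2 tendsto_intros)
    show "AE z in lborel. norm (indicator {0<..} z *\<^sub>R
        ((1 - exp (- ?X n * complex_of_real z)) * complex_of_real (z powr (- p - 1))))
        \<le> (3 + norm s) * (indicator {0<..} z *\<^sub>R (min 1 z * z powr (-p-1)))" for n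
    proof (rule AE_I2)
      fix z :: real
      have "norm (?X n) \<le> norm s + 1"
        by (rule order_trans[OF norm_triangle_ineq]) (simp add: norm_divide del: of_nat_Suc)
      then have "norm (1 - exp (- ?X n * complex_of_real z)) \<le> (3 + norm s) * min 1 z" if "z > 0"
        using norm_one_minus_exp_le[of "?X n" z] Re[of n] that
        by (intro order_trans[OF norm_one_minus_exp_le mult_right_mono]) auto
      then show "norm (indicator {0<..} z *\<^sub>R
        ((1 - exp (- ?X n * complex_of_real z)) * complex_of_real (z powr (- p - 1))))
        \<le> (3 + norm s) * (indicator {0<..} z *\<^sub>R (min 1 z * z powr (-p-1)))"
        by (cases "z > 0") (auto simp: norm_mult mult.assoc[symmetric] intro!: mult_right_mono)
    qed
  qed simp_all
  show ?thesis by (rule LIMSEQ_unique[OF 2 1])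
qed

end

section \<open>Schwartz functions and their Fourier transforms\<close>

lemma schwartz_deriv: "schwartz f \<Longrightarrow> schwartz (deriv f)"
  unfolding schwartz_def by (metis comp_apply funpow_Suc_right)

lemma schwartz_funpow_deriv: "schwartz f \<Longrightarrow> schwartz ((deriv ^^ n) f)"
  by (induction n) (auto intro: schwartz_deriv)

lemma schwartz_has_derivative: "schwartz f \<Longrightarrow> (f has_real_derivative deriv f x) (at x)"
  unfolding schwartz_def by (metis DERIV_deriv_iff_real_differentiable funpow_0)

lemma schwartz_isCont: "schwartz f \<Longrightarrow> isCont f x"
  by (rule DERIV_isCont[OF schwartz_has_derivative])

lemma schwartz_measurable [measurable_dest]: "schwartz f \<Longrightarrow> f \<in> borel_measurable borel"
  by (intro borel_measurable_continuous_onI continuous_at_imp_continuous_on) (simp add: schwartz_isCont)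

text \<open>The weights x^0 and x^2 suffice. This is the only form in which the decay of Schwartz
  functions is used: it is integrable, and stable under bounded shifts up to a constant.\<close>

lemma schwartz_bound:
  assumes "schwartz f"
  obtains C where "C \<ge> 0" "\<And>x. \<bar>f x\<bar> \<le> C / (1 + x\<^sup>2)"
proof -
  have "bounded (range (\<lambda>x. x ^ j * f x))" for j
    using assms unfolding schwartz_def by (metis funpow_0)
  from this[of 0] this[of 2] obtain A B where A: "\<And>x. \<bar>f x\<bar> \<le> A" and B: "\<And>x. \<bar>x\<^sup>2 * f x\<bar> \<le> B"
    unfolding bounded_iff by auto
  show thesis
  proof
    show "A + B \<ge> 0" using A[of 0] B[of 0] by linarith
    fix x :: real
    have "\<bar>f x\<bar> * (1 + x\<^sup>2) = \<bar>f x\<bar> + \<bar>x\<^sup>2 * f x\<bar>" by (simp add: abs_mult algebra_simps)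
    also have "\<dots> \<le> A + B" using A B by (intro add_mono)
    finally show "\<bar>f x\<bar> \<le> (A + B) / (1 + x\<^sup>2)"
      by (subst pos_le_divide_eq) (auto simp: add_pos_nonneg)
  qed
qed

lemma schwartz_integrable: "schwartz f \<Longrightarrow> integrable lborel f"
proof -
  assume f: "schwartz f"
  then obtain C where C: "C \<ge> 0" "\<And>x. \<bar>f x\<bar> \<le> C / (1 + x\<^sup>2)" by (rule schwartz_bound) blast
  have "integrable lborel (\<lambda>x::real. C * (1 / (1 + x\<^sup>2)))"
    by (rule integrable_mult_right) (rule integrable_inverse_one_plus_square)
  then show ?thesis
    by (rule Bochner_Integration.integrable_bound) (use f C in auto)
qed

lemma integrable_fourier_integrand:
  "integrable lborel f \<Longrightarrow> integrable lborel (\<lambda>x. iexp (\<xi> * x) * complex_of_real (f x))"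
  by (rule Bochner_Integration.integrable_bound[of _ f]) (auto simp: norm_mult)

lemma fourier_add:
  "integrable lborel f \<Longrightarrow> integrable lborel g \<Longrightarrow>
     fourier (\<lambda>x. f x + g x) \<xi> = fourier f \<xi> + fourier g \<xi>"
  using Bochner_Integration.integral_add[OF integrable_fourier_integrand[of f \<xi>] integrable_fourier_integrand[of g \<xi>]]
  by (simp add: fourier_def distrib_left)

lemma fourier_cmult: "fourier (\<lambda>x. c * f x) \<xi> = of_real c * fourier f \<xi>"
  unfolding fourier_def by (subst integral_mult_right_zero[symmetric]) (simp add: mult_ac)

lemma fourier_shift: "fourier (\<lambda>x. f (x - c)) \<xi> = iexp (\<xi> * c) * fourier f \<xi>"
proof -
  have "fourier (\<lambda>x. f (x - c)) \<xi>
      = \<bar>1\<bar> *\<^sub>R (CLINT x|lborel. iexp (\<xi> * (c + 1 * x)) * complex_of_real (f (c + 1 * x - c)))"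
    unfolding fourier_def by (rule lborel_integral_real_affine) simp
  also have "\<dots> = (CLINT x|lborel. iexp (\<xi> * c) * (iexp (\<xi> * x) * complex_of_real (f x)))"
    by (simp add: ring_distribs exp_add mult.assoc)
  finally show ?thesis by (simp add: fourier_def)
qed

lemma inverse_one_plus_square_tendsto_0:
  "((\<lambda>x::real. C / (1 + x\<^sup>2)) \<longlongrightarrow> 0) at_top" "((\<lambda>x::real. C / (1 + x\<^sup>2)) \<longlongrightarrow> 0) at_bot"
  by real_asymp+

text \<open>The derivative of e^{i\<xi>x} f(x) integrates to 0 because f vanishes at both ends. The
  transform has +i\<xi>x in the exponent, hence the factor -i\<xi>.\<close>

lemma fourier_deriv:
  assumes f: "schwartz f"
  shows "fourier (deriv f) \<xi> = - \<i> * \<xi> * fourier f \<xi>"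
proof -
  obtain C where C: "\<And>x. \<bar>f x\<bar> \<le> C / (1 + x\<^sup>2)" using f by (rule schwartz_bound) blast
  let ?F = "\<lambda>x. iexp (\<xi> * x) * complex_of_real (f x)"
  let ?F' = "\<lambda>x. iexp (\<xi> * x) * complex_of_real (deriv f x)
      + (\<i> * \<xi>) * (iexp (\<xi> * x) * complex_of_real (f x))"
  have int: "integrable lborel ?F'"
    using integrable_fourier_integrand[OF schwartz_integrable[OF f], of \<xi>]
      integrable_fourier_integrand[OF schwartz_integrable[OF schwartz_deriv[OF f]], of \<xi>]
    by (intro Bochner_Integration.integrable_add integrable_mult_right)
  have e: "einterval (-\<infinity>) \<infinity> = UNIV" by (auto simp: einterval_def)
  have "(LBINT x=-\<infinity>..\<infinity>. ?F' x) = 0 - 0"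
  proof (rule interval_integral_FTC_integrable[where F="?F"])
    fix x :: real
    have a: "((\<lambda>x. complex_of_real (f x)) has_vector_derivative complex_of_real (deriv f x)) (at x)"
      by (rule has_vector_derivative_of_real) (use schwartz_has_derivative[OF f] in \<open>simp add: has_real_derivative_iff_has_vector_derivative\<close>)
    have "((\<lambda>z. exp (\<i> * (\<xi> * z))) has_field_derivative \<i> * \<xi> * exp (\<i> * (\<xi> * of_real x)))
        (at (complex_of_real x))"
      by (auto intro!: derivative_eq_intros)
    then have b: "((\<lambda>x. iexp (\<xi> * x)) has_vector_derivative (\<i> * \<xi> * iexp (\<xi> * x))) (at x)"
      using has_vector_derivative_real_field by fastforce
    show "(?F has_vector_derivative ?F' x) (at x)"
      using has_vector_derivative_mult[OF b a] by (simp only: mult.assoc)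
    show "isCont ?F' x"
      using schwartz_isCont[OF f, of x] schwartz_isCont[OF schwartz_deriv[OF f], of x]
      by (intro continuous_intros) auto
  next
    show "set_integrable lborel (einterval (-\<infinity>) \<infinity>) ?F'"
      using int unfolding e set_integrable_def by simp
    have "(?F \<longlongrightarrow> 0) at_bot"
      by (rule Lim_null_comparison[OF _ inverse_one_plus_square_tendsto_0(2)[of C]])
        (use C in \<open>simp add: norm_mult\<close>)
    then show "((?F \<circ> real_of_ereal) \<longlongrightarrow> 0) (at_right (-\<infinity>))"
      by (simp only: ereal_tendsto_simps)
    have "(?F \<longlongrightarrow> 0) at_top"
      by (rule Lim_null_comparison[OF _ inverse_one_plus_square_tendsto_0(1)[of C]])
        (use C in \<open>simp add: norm_mult\<close>)
    then show "((?F \<circ> real_of_ereal) \<longlongrightarrow> 0) (at_left \<infinity>)"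
      by (simp only: ereal_tendsto_simps)
  qed simp
  then have "(CLINT x|lborel. ?F' x) = 0"
    by (simp add: interval_lebesgue_integral_def e set_lebesgue_integral_def)
  moreover have "(CLINT x|lborel. ?F' x) = fourier (deriv f) \<xi> + (\<i> * \<xi>) * fourier f \<xi>"
    using integrable_fourier_integrand[OF schwartz_integrable[OF f], of \<xi>]
      integrable_fourier_integrand[OF schwartz_integrable[OF schwartz_deriv[OF f]], of \<xi>]
    unfolding fourier_def
    by (subst Bochner_Integration.integral_add) (simp_all only: integral_mult_right_zero integrable_mult_right)
  ultimately show ?thesis by (simp add: eq_neg_iff_add_eq_0)
qed

lemma fourier_funpow_deriv:
  assumes "schwartz f"
  shows "fourier ((deriv ^^ n) f) \<xi> = (- \<i> * \<xi>) ^ n * fourier f \<xi>"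
  using assms by (induction n) (simp_all add: fourier_deriv schwartz_funpow_deriv)

text \<open>With d = y - x and d^2 at most 1, x^2 \<le> 2 y^2 + 2 d^2 gives 1 + x^2 \<le> 3 (1 +
  y^2). A shift of the argument by at most 1 thus costs a factor 3, so a majorant at one point works
  on a unit ball.\<close>

lemma inverse_one_plus_square_shift:
  fixes x y :: real
  assumes "\<bar>y - x\<bar> \<le> 1"
  shows "1 / (1 + y\<^sup>2) \<le> 3 / (1 + x\<^sup>2)"
proof -
  define d where "d = y - x"
  have d: "d\<^sup>2 \<le> 1" using assms by (simp add: d_def abs_square_le_1)
  have "0 \<le> (y + d)\<^sup>2" by simp
  then have "x\<^sup>2 \<le> 2 * y\<^sup>2 + 2 * d\<^sup>2" by (simp add: d_def power2_eq_square algebra_simps)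
  moreover have "1 + X \<le> 3 * (1 + Y)" if "D \<le> 1" "X \<le> 2 * Y + 2 * D" "0 \<le> Y" for X Y D :: real
    using that by (simp add: distrib_left)
  ultimately have "1 + x\<^sup>2 \<le> 3 * (1 + y\<^sup>2)" using d by (meson zero_le_power2)
  moreover have "0 < 1 + x\<^sup>2" "0 < 1 + y\<^sup>2" by (simp_all add: add_pos_nonneg)
  ultimately show ?thesis by (simp add: pos_divide_le_eq pos_le_divide_eq)
qed

text \<open>Mean value inequality between x - h and x, where the bound on \<open>deriv g\<close> at
  any point is within a factor 3 of the one at x; hence 3 * B. The summand A only lets one constant
  serve both estimates.\<close>

lemma schwartz_increment_bounds:
  assumes g: "schwartz g"
  obtains C where "C \<ge> 0" "\<And>x h. \<bar>h\<bar> \<le> 1 \<Longrightarrow> \<bar>g x - g (x - h)\<bar> \<le> C * \<bar>h\<bar> * (1 / (1 + x\<^sup>2))"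
    "\<And>x. \<bar>g x\<bar> \<le> C * (1 / (1 + x\<^sup>2))"
proof -
  obtain A where A: "A \<ge> 0" "\<And>x. \<bar>g x\<bar> \<le> A / (1 + x\<^sup>2)" using g by (rule schwartz_bound) blast
  obtain B where B: "B \<ge> 0" "\<And>x. \<bar>deriv g x\<bar> \<le> B / (1 + x\<^sup>2)"
    using schwartz_deriv[OF g] by (rule schwartz_bound) blast
  have pos: "0 < 1 + x\<^sup>2" for x :: real by (simp add: add_pos_nonneg)
  show thesis
  proof
    show "A + 3 * B \<ge> 0" using A B by simp
    show "\<bar>g x\<bar> \<le> (A + 3 * B) * (1 / (1 + x\<^sup>2))" for x
      using A(2)[of x] B(1) pos[of x] by (auto intro!: order_trans[OF A(2)] divide_right_mono)
    show "\<bar>g x - g (x - h)\<bar> \<le> (A + 3 * B) * \<bar>h\<bar> * (1 / (1 + x\<^sup>2))" if h: "\<bar>h\<bar> \<le> 1" for x h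
    proof -
      have "norm (g x - g (x - h)) \<le> (3 * B / (1 + x\<^sup>2)) * norm (x - (x - h))"
      proof (rule field_differentiable_bound[of "cball x \<bar>h\<bar>" g "deriv g"])
        show "(g has_field_derivative deriv g z) (at z within cball x \<bar>h\<bar>)" for z
          by (rule has_field_derivative_at_within[OF schwartz_has_derivative[OF g]])
        show "norm (deriv g z) \<le> 3 * B / (1 + x\<^sup>2)" if "z \<in> cball x \<bar>h\<bar>" for z
        proof -
          have "\<bar>z - x\<bar> \<le> 1" using that h by (simp add: dist_real_def abs_minus_commute)
          then have "B * (1 / (1 + z\<^sup>2)) \<le> B * (3 / (1 + x\<^sup>2))"
            by (intro mult_left_mono inverse_one_plus_square_shift B)
          then show ?thesis using B(2)[of z] by (simp add: mult.commute)
        qed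
      qed (simp_all add: dist_real_def)
      also have "\<dots> = 3 * B * \<bar>h\<bar> * (1 / (1 + x\<^sup>2))" by simp
      also have "\<dots> \<le> (A + 3 * B) * \<bar>h\<bar> * (1 / (1 + x\<^sup>2))"
        using A(1) pos[of x] by (intro mult_right_mono) auto
      finally show ?thesis by simp
    qed
  qed
qed

section \<open>Weyl integrals of Schwartz functions\<close>

text \<open>The cases \<open>\<sigma> = 1\<close> and \<open>\<sigma> = -1\<close> are the left and the right Weyl integral. One integration by parts
  turns the derivative of the Weyl integral into the difference form, whose kernel is absolutely
  integrable, so that Fubini applies to its Fourier transform.\<close>

definition weyl_integral :: "real \<Rightarrow> real \<Rightarrow> (real \<Rightarrow> real) \<Rightarrow> real \<Rightarrow> real" where
  "weyl_integral \<sigma> p f x = (LINT z:{0<..}|lborel. f (x - \<sigma> * z) * z powr (-p))"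

text \<open>Up to the factor p / Gamma(1-p), the Marchaud form of the fractional derivative of order
  p.\<close>

definition weyl_difference :: "real \<Rightarrow> real \<Rightarrow> (real \<Rightarrow> real) \<Rightarrow> real \<Rightarrow> real" where
  "weyl_difference \<sigma> p g x = (LINT z:{0<..}|lborel. (g x - g (x - \<sigma> * z)) * z powr (-p-1))"

lemma weyl_plus_eq:
  "weyl_plus \<gamma> f x = (let m = nat \<lceil>\<gamma>\<rceil> in
     1 / Gamma (real m - \<gamma>) * (deriv ^^ m) (weyl_integral 1 (\<gamma> + 1 - real m) f) x)"
proof -
  have "(LBINT y:{..x}. f y / (x - y) powr q) = weyl_integral 1 q f x" for q x
  proof -
    have "(LBINT y:{..x}. f y / (x - y) powr q) = \<bar>-1\<bar> *\<^sub>R (LBINT z. indicator {..x} (x + -1 * z) *\<^sub>R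
        (f (x + -1 * z) / (x - (x + -1 * z)) powr q))"
      unfolding set_lebesgue_integral_def by (rule lborel_integral_real_affine) simp
    \<comment> \<open>The substitution yields the closed half-line. At z = 0 its integrand is a
      division by \<open>0 powr q\<close>, which is 0, so the equality with the open half-line holds
      pointwise.\<close>
    also have "\<dots> = (LBINT z. indicator {0<..} z *\<^sub>R (f (x - 1 * z) * z powr (-q)))"
      by (auto intro!: Bochner_Integration.integral_cong simp: indicator_def powr_minus_divide)
    finally show ?thesis by (simp add: weyl_integral_def set_lebesgue_integral_def)
  qed
  then show ?thesis by (simp add: weyl_plus_def Let_def)
qed

lemma weyl_minus_eq:
  "weyl_minus \<gamma> f x = (let m = nat \<lceil>\<gamma>\<rceil> in
     (-1) ^ m / Gamma (real m - \<gamma>) * (deriv ^^ m) (weyl_integral (-1) (\<gamma> + 1 - real m) f) x)"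
proof -
  have "(LBINT y:{x..}. f y / (y - x) powr q) = weyl_integral (-1) q f x" for q x
  proof -
    have "(LBINT y:{x..}. f y / (y - x) powr q) = \<bar>1\<bar> *\<^sub>R (LBINT z. indicator {x..} (x + 1 * z) *\<^sub>R
        (f (x + 1 * z) / (x + 1 * z - x) powr q))"
      unfolding set_lebesgue_integral_def by (rule lborel_integral_real_affine) simp
    also have "\<dots> = (LBINT z. indicator {0<..} z *\<^sub>R (f (x - (-1) * z) * z powr (-q)))"
      by (auto intro!: Bochner_Integration.integral_cong simp: indicator_def powr_minus_divide)
    finally show ?thesis by (simp add: weyl_integral_def set_lebesgue_integral_def)
  qed
  then show ?thesis by (simp add: weyl_minus_def Let_def)
qed

context
  fixes p \<sigma> :: real
  assumes p: "0 < p" "p < 1" and \<sigma>: "\<sigma> = 1 \<or> \<sigma> = -1"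
begin

text \<open>On (0,1) the rational factor is at most 1 and z^{-p} is integrable; from 1 on z^{-p} is
  at most 1 and the rational factor is integrable. The sum of the two is a majorant.\<close>

lemma integrable_powr_inverse_square:
  "integrable lborel (\<lambda>z. indicator {0<..} z * (1 / (1 + (x - \<sigma> * z)\<^sup>2) * z powr (-p)))"
proof -
  have pos: "0 < 1 + y\<^sup>2" for y :: real by (simp add: add_pos_nonneg)
  have 1: "integrable lborel (\<lambda>z::real. indicator {0<..<1} z *\<^sub>R z powr (-p))"
    using set_integrable_powr_unit[of "-p"] p unfolding set_integrable_def by simp
  have 2: "integrable lborel (\<lambda>z. 1 / (1 + (x + (- \<sigma>) * z)\<^sup>2))"
    using \<sigma> by (intro lborel_integrable_real_affine integrable_inverse_one_plus_square) auto
  show ?thesis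
  proof (rule Bochner_Integration.integrable_bound[OF Bochner_Integration.integrable_add[OF 1 2]])
    show "AE z in lborel. norm (indicator {0<..} z * (1 / (1 + (x - \<sigma> * z)\<^sup>2) * z powr (-p)))
       \<le> norm (indicator {0<..<1} z *\<^sub>R z powr (-p) + 1 / (1 + (x + (- \<sigma>) * z)\<^sup>2))"
    proof (rule AE_I2)
      fix z :: real
      have le1: "1 / (1 + (x - \<sigma> * z)\<^sup>2) \<le> 1" using pos[of "x - \<sigma> * z"] by simp
      have nn: "0 \<le> 1 / (1 + (x - \<sigma> * z)\<^sup>2)" using pos[of "x - \<sigma> * z"] by simp
      have "z powr (-p) \<le> 1" if "z \<ge> 1"
        using that p powr_mono[of "-p" 0 z] by simp
      then have "indicator {0<..} z * (1 / (1 + (x - \<sigma> * z)\<^sup>2) * z powr (-p))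
        \<le> indicator {0<..<1} z *\<^sub>R z powr (-p) + 1 / (1 + (x - \<sigma> * z)\<^sup>2)"
        using le1 nn mult_right_mono[OF le1, of "z powr (-p)"] mult_left_mono[OF _ nn, of "z powr (-p)" 1]
        by (cases "z > 0"; cases "z < 1") (auto simp: add_increasing2)
      then show "norm (indicator {0<..} z * (1 / (1 + (x - \<sigma> * z)\<^sup>2) * z powr (-p)))
       \<le> norm (indicator {0<..<1} z *\<^sub>R z powr (-p) + 1 / (1 + (x + (- \<sigma>) * z)\<^sup>2))"
        using nn by simp
    qed
  qed simp
qed

lemma integrable_weyl_integrand:
  assumes f: "schwartz f"
  shows "integrable lborel (\<lambda>z. indicator {0<..} z *\<^sub>R (f (x - \<sigma> * z) * z powr (-p)))"
proof -
  have [measurable]: "f \<in> borel_measurable borel" using f by (rule schwartz_measurable)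
  obtain C where C: "C \<ge> 0" "\<And>x. \<bar>f x\<bar> \<le> C / (1 + x\<^sup>2)" using f by (rule schwartz_bound) blast
  show ?thesis
  proof (rule Bochner_Integration.integrable_bound[OF integrable_mult_right[OF integrable_powr_inverse_square[of x], of C]])
    show "AE z in lborel. norm (indicator {0<..} z *\<^sub>R (f (x - \<sigma> * z) * z powr (-p)))
      \<le> norm (C * (indicator {0<..} z * (1 / (1 + (x - \<sigma> * z)\<^sup>2) * z powr (-p))))"
    proof (rule AE_I2)
      fix z :: real
      have "\<bar>f (x - \<sigma> * z)\<bar> * z powr (-p) \<le> C / (1 + (x - \<sigma> * z)\<^sup>2) * z powr (-p)"
        by (rule mult_right_mono[OF C(2)]) simp
      then show "norm (indicator {0<..} z *\<^sub>R (f (x - \<sigma> * z) * z powr (-p)))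
        \<le> norm (C * (indicator {0<..} z * (1 / (1 + (x - \<sigma> * z)\<^sup>2) * z powr (-p))))"
        using C(1) by (simp add: abs_mult indicator_def)
    qed
  qed measurable
qed

text \<open>Placing the singularity at z = 0, independently of x, makes the derivative fall on f
  instead of the kernel. Radius 1 for the ball is what the shift bound with factor 3 needs.\<close>

lemma weyl_integral_has_derivative:
  assumes f: "schwartz f"
  shows "(weyl_integral \<sigma> p f has_real_derivative weyl_integral \<sigma> p (deriv f) x) (at x)"
proof -
  have [measurable]: "deriv f \<in> borel_measurable borel" by (intro schwartz_measurable schwartz_deriv f)
  obtain C where C: "C \<ge> 0" "\<And>x. \<bar>deriv f x\<bar> \<le> C / (1 + x\<^sup>2)"
    using schwartz_deriv[OF f] by (rule schwartz_bound) blast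
  let ?f = "\<lambda>x z. indicator {0<..} z *\<^sub>R (f (x - \<sigma> * z) * z powr (-p))"
  let ?f' = "\<lambda>x z. indicator {0<..} z *\<^sub>R (deriv f (x - \<sigma> * z) * z powr (-p))"
  have "((\<lambda>x. \<integral>z. ?f x z \<partial>lborel) has_field_derivative (\<integral>z. ?f' x z \<partial>lborel)) (at x)"
  proof (rule has_field_derivative_integral_dominated[where \<delta>=1 and
      w="\<lambda>z. 3 * C * (indicator {0<..} z * (1 / (1 + (x - \<sigma> * z)\<^sup>2) * z powr (-p)))"])
    show "integrable lborel (?f s)" for s by (rule integrable_weyl_integrand[OF f])
    show "?f' x \<in> borel_measurable lborel" by measurable
    show "integrable lborel (\<lambda>z. 3 * C * (indicator {0<..} z * (1 / (1 + (x - \<sigma> * z)\<^sup>2) * z powr (-p))))"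
      by (rule integrable_mult_right[OF integrable_powr_inverse_square])
    show "((\<lambda>s. ?f s z) has_field_derivative ?f' s z) (at s)" for s z
    proof -
      have "((\<lambda>s. f (s - \<sigma> * z)) has_field_derivative deriv f (s - \<sigma> * z) * (1 - 0)) (at s)"
        by (rule DERIV_chain2[OF schwartz_has_derivative[OF f]]) (auto intro!: derivative_eq_intros)
      then have "((\<lambda>s. indicator {0<..} z * (f (s - \<sigma> * z) * z powr (-p)))
          has_field_derivative indicator {0<..} z * (deriv f (s - \<sigma> * z) * (1 - 0) * z powr (-p))) (at s)"
        by (intro DERIV_cmult DERIV_cmult_right)
      then show ?thesis by simp
    qed
    show "norm (?f' s z) \<le> 3 * C * (indicator {0<..} z * (1 / (1 + (x - \<sigma> * z)\<^sup>2) * z powr (-p)))"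
      if s: "s \<in> ball x 1" for s z
    proof -
      have "1 / (1 + (s - \<sigma> * z)\<^sup>2) \<le> 3 / (1 + (x - \<sigma> * z)\<^sup>2)"
        using s by (intro inverse_one_plus_square_shift) (simp add: dist_real_def)
      then have "C * (1 / (1 + (s - \<sigma> * z)\<^sup>2)) \<le> C * (3 / (1 + (x - \<sigma> * z)\<^sup>2))"
        by (rule mult_left_mono[OF _ C(1)])
      then have "\<bar>deriv f (s - \<sigma> * z)\<bar> \<le> 3 * C * (1 / (1 + (x - \<sigma> * z)\<^sup>2))"
        using C(2)[of "s - \<sigma> * z"] by (simp add: mult.commute)
      then have "\<bar>deriv f (s - \<sigma> * z)\<bar> * z powr (-p) \<le> 3 * C * (1 / (1 + (x - \<sigma> * z)\<^sup>2)) * z powr (-p)"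
        by (rule mult_right_mono) simp
      then show ?thesis by (simp add: abs_mult indicator_def)
    qed
  qed simp
  then show ?thesis
    unfolding weyl_integral_def[abs_def] set_lebesgue_integral_def .
qed

lemma funpow_deriv_weyl_integral:
  "schwartz f \<Longrightarrow> (deriv ^^ n) (weyl_integral \<sigma> p f) = weyl_integral \<sigma> p ((deriv ^^ n) f)"
proof (induction n)
  case (Suc n)
  then have "deriv (weyl_integral \<sigma> p ((deriv ^^ n) f)) = weyl_integral \<sigma> p (deriv ((deriv ^^ n) f))"
    by (intro ext DERIV_imp_deriv weyl_integral_has_derivative schwartz_funpow_deriv)
  with Suc show ?case by simp
qed simp

text \<open>Increments are of order \<open>min 1 z\<close> both uniformly and in the L^1 norm over
  x. The uniform bound makes the difference integral converge at a point, the L^1 bound is the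
  Fubini hypothesis for its transform.\<close>

lemma schwartz_increment_mean:
  assumes g: "schwartz g"
  obtains K where "K \<ge> 0" "\<And>x z. 0 < z \<Longrightarrow> \<bar>g x - g (x - \<sigma> * z)\<bar> \<le> K * min 1 z"
    "\<And>z. 0 < z \<Longrightarrow> (LBINT x. \<bar>g x - g (x - \<sigma> * z)\<bar>) \<le> K * min 1 z"
proof -
  have [measurable]: "g \<in> borel_measurable borel" using g by (rule schwartz_measurable)
  obtain C where C: "C \<ge> 0" "\<And>x h. \<bar>h\<bar> \<le> 1 \<Longrightarrow> \<bar>g x - g (x - h)\<bar> \<le> C * \<bar>h\<bar> * (1 / (1 + x\<^sup>2))"
    "\<And>x. \<bar>g x\<bar> \<le> C * (1 / (1 + x\<^sup>2))"
    using g by (rule schwartz_increment_bounds) blast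
  define N where "N = (LBINT x::real. 1 / (1 + x\<^sup>2))"
  have pos: "0 < 1 + y\<^sup>2" for y :: real by (simp add: add_pos_nonneg)
  then have le1: "C * (1 / (1 + y\<^sup>2)) \<le> C" for y :: real
    using mult_left_mono[of "1 / (1 + y\<^sup>2)" 1 C] C(1) by simp
  have N: "N \<ge> 0" unfolding N_def using pos by (intro integral_nonneg_AE AE_I2) (simp add: less_imp_le)
  have sz: "\<bar>\<sigma> * z\<bar> = z" if "z > 0" for z using \<sigma> that by auto
  have i0: "integrable lborel (\<lambda>x. C * (1 / (1 + x\<^sup>2)))"
    by (rule integrable_mult_right[OF integrable_inverse_one_plus_square])
  have i1: "integrable lborel (\<lambda>x. C * (1 / (1 + (x - h)\<^sup>2)))" for h
    using lborel_integrable_real_affine[OF i0, of 1 "-h"] by simp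
  have N1: "(LBINT x. C * (1 / (1 + (x - h)\<^sup>2))) = C * N" for h
  proof -
    have "(LBINT x. C * (1 / (1 + (x - h)\<^sup>2))) = (LBINT x. C * (1 / (1 + x\<^sup>2)))"
      using lborel_integral_real_affine[of 1 "\<lambda>x. C * (1 / (1 + x\<^sup>2))" "-h"] by simp
    also have "\<dots> = C * N" by (simp only: integral_mult_right_zero N_def)
    finally show ?thesis .
  qed
  show thesis
  proof
    \<comment> \<open>One constant for four cases: the pointwise bounds are C z for z \<le> 1 and 2
      C beyond, the L^1 bounds C N z and 2 C N.\<close>
    show "2 * C + 2 * C * N \<ge> 0" using C N by simp
  next
    fix x z :: real assume z: "z > 0"
    show "\<bar>g x - g (x - \<sigma> * z)\<bar> \<le> (2 * C + 2 * C * N) * min 1 z"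
    proof (cases "z \<le> 1")
      case True
      then have "\<bar>g x - g (x - \<sigma> * z)\<bar> \<le> (C * (1 / (1 + x\<^sup>2))) * z"
        using C(2)[of "\<sigma> * z" x] sz[OF z] by (simp add: mult_ac)
      also have "\<dots> \<le> C * z" using le1[of x] z by (intro mult_right_mono) auto
      also have "\<dots> \<le> (2 * C + 2 * C * N) * z" using z C N by (intro mult_right_mono) auto
      finally show ?thesis using True by simp
    next
      case False
      have "\<bar>g x - g (x - \<sigma> * z)\<bar> \<le> 2 * C"
        using C(3)[of x] C(3)[of "x - \<sigma> * z"] le1[of x] le1[of "x - \<sigma> * z"] by linarith
      also have "\<dots> \<le> 2 * C + 2 * C * N" using C N by simp
      finally show ?thesis using False by simp
    qed
  next
    fix z :: real assume z: "z > 0"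
    show "(LBINT x. \<bar>g x - g (x - \<sigma> * z)\<bar>) \<le> (2 * C + 2 * C * N) * min 1 z"
    proof (cases "z \<le> 1")
      case True
      have "(LBINT x. \<bar>g x - g (x - \<sigma> * z)\<bar>) \<le> (LBINT x. z * (C * (1 / (1 + x\<^sup>2))))"
      proof (rule integral_mono')
        show "integrable lborel (\<lambda>x. z * (C * (1 / (1 + x\<^sup>2))))"
          by (rule integrable_mult_right[OF i0])
        show "\<bar>g x - g (x - \<sigma> * z)\<bar> \<le> z * (C * (1 / (1 + x\<^sup>2)))" for x
          using C(2)[of "\<sigma> * z" x] sz[OF z] True by (simp add: mult_ac)
        show "0 \<le> z * (C * (1 / (1 + x\<^sup>2)))" for x
          using C(1) z pos[of x] by (intro mult_nonneg_nonneg) (auto simp: less_imp_le)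
      qed
      also have "\<dots> = z * (C * N)" by (simp only: integral_mult_right_zero N_def)
      also have "\<dots> \<le> (2 * C + 2 * C * N) * z" using z C(1) N by (simp add: algebra_simps)
      finally show ?thesis using True by simp
    next
      case False
      have "(LBINT x. \<bar>g x - g (x - \<sigma> * z)\<bar>)
          \<le> (LBINT x. C * (1 / (1 + (x - 0)\<^sup>2)) + C * (1 / (1 + (x - \<sigma> * z)\<^sup>2)))"
      proof (rule integral_mono'[OF Bochner_Integration.integrable_add[OF i1 i1]])
        show "\<bar>g x - g (x - \<sigma> * z)\<bar>
            \<le> C * (1 / (1 + (x - 0)\<^sup>2)) + C * (1 / (1 + (x - \<sigma> * z)\<^sup>2))" for x
          using C(3)[of x] C(3)[of "x - \<sigma> * z"] by simp
        show "0 \<le> C * (1 / (1 + (x - 0)\<^sup>2)) + C * (1 / (1 + (x - \<sigma> * z)\<^sup>2))" for x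
          using C(3)[of x] C(3)[of "x - \<sigma> * z"] by simp
      qed
      also have "\<dots> = C * N + C * N"
        by (subst Bochner_Integration.integral_add[OF i1 i1]) (simp only: N1)
      also have "\<dots> \<le> 2 * C + 2 * C * N" using C by simp
      finally show ?thesis using False by simp
    qed
  qed
qed

text \<open>A primitive in z of g'(x - \<sigma> z) is \<sigma> (g(x) - g(x - \<sigma> z)). The
  constant g(x) is chosen so that the primitive vanishes at z = 0 to first order, which beats
  z^{-p}; at infinity it stays bounded while z^{-p} tends to 0.\<close>

lemma weyl_integral_deriv_eq_difference:
  assumes g: "schwartz g"
  shows "weyl_integral \<sigma> p (deriv g) x = \<sigma> * p * weyl_difference \<sigma> p g x"
proof -
  have [measurable]: "g \<in> borel_measurable borel" using g by (rule schwartz_measurable)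
  obtain K where K: "K \<ge> 0" "\<And>x z. 0 < z \<Longrightarrow> \<bar>g x - g (x - \<sigma> * z)\<bar> \<le> K * min 1 z"
    using g by (rule schwartz_increment_mean) blast
  have \<sigma>\<sigma>: "\<sigma> * \<sigma> = 1" using \<sigma> by auto
  let ?F = "\<lambda>z. \<sigma> * ((g x - g (x - \<sigma> * z)) * z powr (-p))"
  let ?A = "\<lambda>z. deriv g (x - \<sigma> * z) * z powr (-p)"
  let ?B = "\<lambda>z. (g x - g (x - \<sigma> * z)) * z powr (-p-1)"
  have A: "set_integrable lborel {0<..} ?A"
    using integrable_weyl_integrand[OF schwartz_deriv[OF g]] unfolding set_integrable_def .
  have B: "set_integrable lborel {0<..} ?B"
    unfolding set_integrable_def
  proof (rule Bochner_Integration.integrable_bound)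
    show "integrable lborel (\<lambda>z. K * (indicator {0<..} z *\<^sub>R (min 1 z * z powr (-p-1))))"
      using set_integrable_min_powr[OF p] unfolding set_integrable_def by simp
    show "AE z in lborel. norm (indicator {0<..} z *\<^sub>R ?B z)
        \<le> norm (K * (indicator {0<..} z *\<^sub>R (min 1 z * z powr (-p-1))))"
    proof (rule AE_I2)
      fix z :: real
      show "norm (indicator {0<..} z *\<^sub>R ?B z)
        \<le> norm (K * (indicator {0<..} z *\<^sub>R (min 1 z * z powr (-p-1))))"
        using K(1) mult_right_mono[OF K(2), of z "z powr (-p-1)"]
        by (cases "z > 0") (auto simp: abs_mult)
    qed
  qed measurable
  have F: "norm (?F z) \<le> K * (min 1 z * z powr (-p))" if "z > 0" for z
    using mult_right_mono[OF K(2)[OF that], of "z powr (-p)" x] \<sigma> by (auto simp: abs_mult mult.assoc)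
  have l0: "(?F \<longlongrightarrow> 0) (at_right 0)"
  proof (rule Lim_null_comparison)
    show "\<forall>\<^sub>F z in at_right 0. norm (?F z) \<le> K * z powr (1 - p)"
      unfolding eventually_at_filter
    proof (intro always_eventually allI impI)
      fix z :: real assume "z \<noteq> 0" "z \<in> {0<..}"
      then have z: "z > 0" by simp
      have "min 1 z * z powr (-p) \<le> z * z powr (-p)" by (rule mult_right_mono) auto
      also have "\<dots> = z powr (1 - p)" using z by (simp add: powr_diff powr_minus_divide)
      finally show "norm (?F z) \<le> K * z powr (1 - p)"
        using F[OF z] K(1) by (meson mult_left_mono order_trans)
    qed
    have "((\<lambda>z::real. K * z powr (1 - p)) \<longlongrightarrow> K * 0 powr (1 - p)) (at_right 0)"
      using p by (intro tendsto_intros) (auto simp: eventually_at_filter)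
    then show "((\<lambda>z::real. K * z powr (1 - p)) \<longlongrightarrow> 0) (at_right 0)" by simp
  qed
  have l1: "(?F \<longlongrightarrow> 0) at_top"
  proof (rule Lim_null_comparison)
    show "\<forall>\<^sub>F z in at_top. norm (?F z) \<le> K * z powr (-p)"
      using eventually_gt_at_top[of 0]
    proof eventually_elim
      case (elim z)
      have "min 1 z * z powr (-p) \<le> 1 * z powr (-p)" by (rule mult_right_mono) auto
      then show ?case using F[OF elim] K(1) by (metis mult_1 mult_left_mono order_trans)
    qed
    have "((\<lambda>z::real. K * z powr (-p)) \<longlongrightarrow> K * 0) at_top"
      using p by (intro tendsto_intros tendsto_neg_powr filterlim_ident) auto
    then show "((\<lambda>z::real. K * z powr (-p)) \<longlongrightarrow> 0) at_top" by simp
  qed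
  have "(LINT z:{0<..}|lborel. ?A z - \<sigma> * p * ?B z) = 0 - 0"
  proof (rule integral_FTC_halfline[OF _ _ _ l0 l1])
    fix z :: real assume z: "z > 0"
    have d: "DERIV (\<lambda>z. g (x - \<sigma> * z)) z :> deriv g (x - \<sigma> * z) * (- \<sigma>)"
      by (rule DERIV_chain2[OF schwartz_has_derivative[OF g]]) (auto intro!: derivative_eq_intros)
    have e: "DERIV (\<lambda>z. z powr (-p)) z :> - p * z powr (-p-1)"
      using z by (auto intro!: derivative_eq_intros)
    have "DERIV ?F z :> \<sigma> * ((0 - deriv g (x - \<sigma> * z) * (- \<sigma>)) * z powr (-p)
        + (- p * z powr (-p-1)) * (g x - g (x - \<sigma> * z)))"
      by (intro DERIV_cmult DERIV_mult DERIV_diff DERIV_const d e)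
    also have "\<sigma> * ((0 - deriv g (x - \<sigma> * z) * (- \<sigma>)) * z powr (-p)
        + (- p * z powr (-p-1)) * (g x - g (x - \<sigma> * z)))
        = (\<sigma> * \<sigma>) * ?A z - \<sigma> * p * ?B z"
      by (simp add: algebra_simps)
    finally show "(?F has_vector_derivative ?A z - \<sigma> * p * ?B z) (at z)"
      by (simp add: \<sigma>\<sigma> has_real_derivative_iff_has_vector_derivative)
    have "isCont (\<lambda>z. deriv g (x - \<sigma> * z)) z" "isCont (\<lambda>z. g (x - \<sigma> * z)) z"
      by (rule isCont_o2[OF _ schwartz_isCont]; use g in \<open>auto intro!: continuous_intros schwartz_deriv\<close>)+
    then show "isCont (\<lambda>z. ?A z - \<sigma> * p * ?B z) z"
      using z by (intro continuous_intros) auto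
  next
    show "set_integrable lborel {0<..} (\<lambda>z. ?A z - \<sigma> * p * ?B z)"
      using A B by (intro set_integral_diff set_integrable_mult_right)
  qed
  moreover have "(LINT z:{0<..}|lborel. ?A z - \<sigma> * p * ?B z)
      = weyl_integral \<sigma> p (deriv g) x - \<sigma> * p * weyl_difference \<sigma> p g x"
    using A B by (subst set_integral_diff)
      (auto simp: weyl_integral_def weyl_difference_def simp del: mult.assoc)
  ultimately show ?thesis by simp
qed

text \<open>A translation by \<sigma> z multiplies the transform by e^{i\<xi>\<sigma>z}, so each
  increment contributes the factor 1 - e^{-sz} with s = -i\<sigma>\<xi>. Integrating over z yields
  \<open>levy_exponent\<close> at that s.\<close>

lemma fourier_weyl_difference:
  assumes g: "schwartz g"
  shows "integrable lborel (weyl_difference \<sigma> p g)"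
    and "fourier (weyl_difference \<sigma> p g) \<xi> = levy_exponent p (- \<i> * \<sigma> * \<xi>) * fourier g \<xi>"
proof -
  have [measurable]: "g \<in> borel_measurable borel" using g by (rule schwartz_measurable)
  note gi = schwartz_integrable[OF g]
  have gi': "integrable lborel (\<lambda>x. g (x - h))" for h
    using lborel_integrable_real_affine[OF gi, of 1 "-h"] by simp
  obtain K where K: "K \<ge> 0" "\<And>z. 0 < z \<Longrightarrow> (LBINT x. \<bar>g x - g (x - \<sigma> * z)\<bar>) \<le> K * min 1 z"
    using g by (rule schwartz_increment_mean) blast
  define \<psi> where "\<psi> z x = indicator {0<..} z *\<^sub>R ((g x - g (x - \<sigma> * z)) * z powr (-p-1))" for z x :: real
  have [measurable]: "case_prod \<psi> \<in> borel_measurable (lborel \<Otimes>\<^sub>M lborel)"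
    unfolding \<psi>_def by measurable
  have \<psi>: "integrable (lborel \<Otimes>\<^sub>M lborel) (case_prod \<psi>)"
  proof (rule lborel_pair.Fubini_integrable)
    show "AE z in lborel. integrable lborel (\<lambda>x. case_prod \<psi> (z, x))"
      using gi gi' by (auto simp: \<psi>_def)
    show "integrable lborel (\<lambda>z. LBINT x. norm (case_prod \<psi> (z, x)))"
    proof (rule Bochner_Integration.integrable_bound)
      show "integrable lborel (\<lambda>z. K * (indicator {0<..} z *\<^sub>R (min 1 z * z powr (-p-1))))"
        using set_integrable_min_powr[OF p] unfolding set_integrable_def by simp
      show "AE z in lborel. norm (LBINT x. norm (case_prod \<psi> (z, x)))
          \<le> norm (K * (indicator {0<..} z *\<^sub>R (min 1 z * z powr (-p-1))))"
      proof (rule AE_I2)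
        fix z :: real
        have e: "(LBINT x. norm (case_prod \<psi> (z, x)))
            = indicator {0<..} z * (LBINT x. \<bar>g x - g (x - \<sigma> * z)\<bar>) * z powr (-p-1)"
          by (simp add: \<psi>_def abs_mult)
        show "norm (LBINT x. norm (case_prod \<psi> (z, x)))
          \<le> norm (K * (indicator {0<..} z *\<^sub>R (min 1 z * z powr (-p-1))))"
          unfolding e using K(1) mult_right_mono[OF K(2), of z "z powr (-p-1)"]
          by (cases "z > 0") (auto simp: abs_mult)
      qed
    qed measurable
  qed measurable
  have W: "weyl_difference \<sigma> p g x = (LBINT z. \<psi> z x)" for x
    by (simp add: weyl_difference_def set_lebesgue_integral_def \<psi>_def)
  show "integrable lborel (weyl_difference \<sigma> p g)"
    using lborel_pair.integrable_snd[OF \<psi>] by (simp add: W[abs_def])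
  have \<psi>c: "integrable (lborel \<Otimes>\<^sub>M lborel) (\<lambda>(z, x). iexp (\<xi> * x) * complex_of_real (\<psi> z x))"
    by (rule Bochner_Integration.integrable_bound[OF \<psi>]) (auto simp: norm_mult)
  have "fourier (weyl_difference \<sigma> p g) \<xi>
      = (CLBINT x. CLBINT z. iexp (\<xi> * x) * complex_of_real (\<psi> z x))"
    by (simp add: fourier_def W)
  also have "\<dots> = (CLBINT z. CLBINT x. iexp (\<xi> * x) * complex_of_real (\<psi> z x))"
    by (rule lborel_pair.Fubini_integral[OF \<psi>c])
  also have "\<dots> = (CLBINT z. (indicator {0<..} z *\<^sub>R
      ((1 - exp (- (- \<i> * \<sigma> * \<xi>) * complex_of_real z)) * complex_of_real (z powr (-p-1)))) * fourier g \<xi>)"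
  proof (rule Bochner_Integration.integral_cong)
    fix z :: real
    have "(CLBINT x. iexp (\<xi> * x) * complex_of_real (\<psi> z x))
        = fourier (\<lambda>x. (indicator {0<..} z * z powr (-p-1)) * (g x + (-1) * g (x - \<sigma> * z))) \<xi>"
      by (simp add: fourier_def \<psi>_def mult_ac)
    also have "\<dots> = of_real (indicator {0<..} z * z powr (-p-1)) *
        (fourier g \<xi> + of_real (-1) * (iexp (\<xi> * (\<sigma> * z)) * fourier g \<xi>))"
      unfolding fourier_cmult using gi gi' by (subst fourier_add) (simp_all only: fourier_cmult fourier_shift integrable_mult_right)
    finally show "(CLBINT x. iexp (\<xi> * x) * complex_of_real (\<psi> z x)) = (indicator {0<..} z *\<^sub>R
      ((1 - exp (- (- \<i> * \<sigma> * \<xi>) * complex_of_real z)) * complex_of_real (z powr (-p-1)))) * fourier g \<xi>"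
      by (simp add: scaleR_conv_of_real algebra_simps)
  qed simp
  also have "\<dots> = levy_exponent p (- \<i> * \<sigma> * \<xi>) * fourier g \<xi>"
    by (simp only: integral_mult_left_zero levy_exponent_def set_lebesgue_integral_def)
  finally show "fourier (weyl_difference \<sigma> p g) \<xi> = levy_exponent p (- \<i> * \<sigma> * \<xi>) * fourier g \<xi>" .
qed

end

section \<open>The symbol of the Riesz derivative and uniqueness\<close>

text \<open>\<sigma> = 1 and \<sigma> = -1 are the two Weyl derivatives. The sign \<sigma>^m of the
  definition and the \<sigma> from the integration by parts give \<sigma>^{m-1}, which completes
  (-i\<xi>)^{m-1} to (-i\<sigma>\<xi>)^{m-1}. The remaining power p comes from
  \<open>levy_exponent\<close>, and its constant Gamma(1-p)/p cancels against the
  normalization.\<close>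

lemma fourier_weyl:
  fixes \<gamma> \<sigma> :: real
  assumes \<gamma>: "\<gamma> > 0" "\<gamma> \<notin> \<nat>" and f: "schwartz f" and \<sigma>: "\<sigma> = 1 \<or> \<sigma> = -1"
  defines "m \<equiv> nat \<lceil>\<gamma>\<rceil>"
  defines "W \<equiv> \<lambda>x. \<sigma> ^ m / Gamma (real m - \<gamma>) * (deriv ^^ m) (weyl_integral \<sigma> (\<gamma> + 1 - real m) f) x"
  shows "integrable lborel W" and "fourier W \<xi> = (- \<i> * \<sigma> * \<xi>) powr \<gamma> * fourier f \<xi>"
proof -
  define p where "p = \<gamma> + 1 - real m"
  define g where "g = (deriv ^^ (m - 1)) f"
  have m: "m \<ge> 1" using \<gamma> unfolding m_def by linarith
  have "real m - 1 < \<gamma>" using \<gamma> unfolding m_def by linarith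
  \<comment> \<open>Non-integrality of \<gamma> gives the strict bound p < 1.\<close>
  moreover have "\<gamma> \<noteq> real m" using \<gamma> by auto
  moreover have "\<gamma> \<le> real m" unfolding m_def by linarith
  ultimately have p: "0 < p" "p < 1" unfolding p_def by linarith+
  have g: "schwartz g" unfolding g_def by (rule schwartz_funpow_deriv[OF f])
  have mp: "real m - \<gamma> = 1 - p" by (simp add: p_def)
  have "(deriv ^^ m) f = deriv g"
    using m by (cases m) (simp_all add: g_def)
  then have W: "W = (\<lambda>x. (\<sigma> ^ m * \<sigma> * p / Gamma (1 - p)) * weyl_difference \<sigma> p g x)"
    unfolding W_def p_def[symmetric] funpow_deriv_weyl_integral[OF p \<sigma> f] mp
    by (simp add: weyl_integral_deriv_eq_difference[OF p \<sigma> g] mult.assoc)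
  show "integrable lborel W"
    unfolding W by (intro integrable_mult_right fourier_weyl_difference[OF p \<sigma> g])
  have G: "Gamma (1 - p) \<noteq> 0" 
    using p by (intro less_imp_neq[THEN not_sym] Gamma_real_pos) simp
  have \<sigma>\<sigma>: "\<sigma> ^ m * \<sigma> = \<sigma> ^ (m - 1)"
  proof -
    have "\<sigma> ^ m = \<sigma> ^ (m - 1) * \<sigma>" using m by (cases m) auto
    moreover have "\<sigma> * \<sigma> = 1" using \<sigma> by auto
    ultimately show ?thesis by (simp add: mult.assoc)
  qed
  let ?s = "- \<i> * \<sigma> * \<xi>"
  have L: "levy_exponent p ?s = ?s powr p * of_real (Gamma (1 - p) / p)"
  proof (cases "\<xi> = 0")
    case True
    then show ?thesis by (simp add: levy_exponent_def set_lebesgue_integral_def)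
  next
    case False
    then show ?thesis using \<sigma> by (intro levy_exponent_eq[OF p]) auto
  qed
  have "\<gamma> = real (m - 1) + p" using m by (simp add: p_def)
  then have "?s powr \<gamma> = ?s powr (of_nat (m - 1)) * ?s powr p"
    by (simp add: powr_add)
  \<comment> \<open>For m = 1 and \<xi> = 0 the first factors differ, \<open>0 powr 0\<close> being
    0 and \<open>0 ^ 0\<close> being 1, but then \<open>?s powr p\<close> is 0.\<close>
  also have "\<dots> = ?s ^ (m - 1) * ?s powr p"
  proof (cases "\<xi> = 0")
    case False
    then show ?thesis using \<sigma> by (subst powr_nat') auto
  qed simp
  finally have P: "?s powr \<gamma> = (of_real \<sigma>) ^ (m - 1) * (- \<i> * \<xi>) ^ (m - 1) * ?s powr p"
    by (simp add: power_mult_distrib[symmetric] mult_ac)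
  have "fourier W \<xi> = of_real (\<sigma> ^ (m - 1) * p / Gamma (1 - p)) *
      (?s powr p * of_real (Gamma (1 - p) / p) * ((- \<i> * \<xi>) ^ (m - 1) * fourier f \<xi>))"
    unfolding W fourier_cmult fourier_weyl_difference(2)[OF p \<sigma> g] L \<sigma>\<sigma>
    by (simp only: g_def fourier_funpow_deriv[OF f])
  also have "\<dots> = ((of_real \<sigma>) ^ (m - 1) * (- \<i> * \<xi>) ^ (m - 1) * ?s powr p) * fourier f \<xi>"
    using p G by (simp add: field_simps)
  finally show "fourier W \<xi> = ?s powr \<gamma> * fourier f \<xi>" unfolding P .
qed

text \<open>The principal arguments of -i and i are -pi/2 and pi/2, so the two powers are conjugate
  with real part |x|^\<gamma> cos(pi \<gamma>/2); the sign of x only exchanges them. This is the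
  origin of the cosine in the Riesz normalization.\<close>

lemma powr_imaginary_sum:
  fixes x \<gamma> :: real
  assumes "\<gamma> > 0"
  shows "(- \<i> * x) powr \<gamma> + (\<i> * x) powr \<gamma> = of_real (2 * cos (pi * \<gamma> / 2) * \<bar>x\<bar> powr \<gamma>)"
proof (cases "x = 0")
  case False
  define r where "r = \<bar>x\<bar>"
  have r: "r > 0" using False by (simp add: r_def)
  have "(- \<i> * x) powr \<gamma> + (\<i> * x) powr \<gamma> = (of_real r * (- \<i>)) powr \<gamma> + (of_real r * \<i>) powr \<gamma>"
    by (cases "x > 0") (simp_all add: r_def mult_ac add.commute)
  also have "\<dots> = exp (\<gamma> * (of_real (ln r) + Ln (- \<i>))) + exp (\<gamma> * (of_real (ln r) + Ln \<i>))"
  proof -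
    have "Ln (of_real r * (- \<i>)) = of_real (ln r) + Ln (- \<i>)"
      using Ln_times_of_real[OF r, of "- \<i>"] Ln_of_real[OF r] by (metis complex_i_not_zero neg_equal_0_iff_equal)
    moreover have "Ln (of_real r * \<i>) = of_real (ln r) + Ln \<i>"
      using Ln_times_of_real[OF r, of "\<i>"] Ln_of_real[OF r] by (metis complex_i_not_zero)
    moreover have "of_real r * (- \<i>) \<noteq> 0" "of_real r * \<i> \<noteq> 0" using r by simp_all
    ultimately show ?thesis by (simp only: powr_def if_False)
  qed
  also have "\<dots> = of_real (exp (\<gamma> * ln r)) * (exp (- (\<i> * of_real (pi * \<gamma> / 2))) + exp (\<i> * of_real (pi * \<gamma> / 2)))"
    unfolding exp_of_real[symmetric] distrib_left exp_add[symmetric] by (simp add: algebra_simps)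
  also have "exp (- (\<i> * of_real (pi * \<gamma> / 2))) + exp (\<i> * of_real (pi * \<gamma> / 2)) = 2 * cos (of_real (pi * \<gamma> / 2))"
    by (simp add: cos_exp_eq)
  finally show ?thesis using r False by (simp add: powr_def r_def cos_of_real[symmetric] del: cos_of_real)
qed (use assms in simp)

lemma has_fourier_symbol_riesz:
  assumes \<gamma>: "\<gamma> > 0" "\<gamma> \<notin> \<nat>"
  shows "has_fourier_symbol (riesz \<gamma>) (\<lambda>\<xi>. - of_real (\<bar>\<xi>\<bar> powr \<gamma>))"
  unfolding has_fourier_symbol_def
proof (intro allI impI conjI)
  fix f assume f: "schwartz f"
  define m where "m = nat \<lceil>\<gamma>\<rceil>"
  have plus: "weyl_plus \<gamma> f = (\<lambda>x. 1 ^ m / Gamma (real m - \<gamma>) * (deriv ^^ m) (weyl_integral 1 (\<gamma> + 1 - real m) f) x)"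
    by (simp add: weyl_plus_eq m_def Let_def fun_eq_iff)
  have minus: "weyl_minus \<gamma> f = (\<lambda>x. (-1) ^ m / Gamma (real m - \<gamma>) * (deriv ^^ m) (weyl_integral (-1) (\<gamma> + 1 - real m) f) x)"
    by (simp add: weyl_minus_eq m_def Let_def fun_eq_iff)
  note P = fourier_weyl[OF \<gamma> f, of 1, folded m_def, folded plus, simplified]
  note N = fourier_weyl[OF \<gamma> f, of "-1", folded m_def, folded minus, simplified]
  have R: "riesz \<gamma> f = (\<lambda>x. (- 1 / (2 * cos (pi * \<gamma> / 2))) * (weyl_plus \<gamma> f x + weyl_minus \<gamma> f x))"
    by (simp add: riesz_def fun_eq_iff)
  show "integrable lborel (riesz \<gamma> f)"
    unfolding R by (intro integrable_mult_right Bochner_Integration.integrable_add P N)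
  \<comment> \<open>Otherwise the division in \<open>riesz\<close> would return 0. The cosine
    vanishes only if \<gamma> is an integer.\<close>
  have c: "cos (pi * \<gamma> / 2) \<noteq> 0"
  proof
    assume "cos (pi * \<gamma> / 2) = 0"
    then obtain i :: int where "pi * \<gamma> / 2 = of_int i * (pi / 2)" using cos_zero_iff_int by blast
    then have "\<gamma> = of_int i" by simp
    with \<gamma> show False by (metis Ints_of_int Nats_altdef2 less_imp_le mem_Collect_eq)
  qed
  fix \<xi>
  have "fourier (riesz \<gamma> f) \<xi> = of_real (- 1 / (2 * cos (pi * \<gamma> / 2))) *
      (((- \<i> * \<xi>) powr \<gamma> + (\<i> * \<xi>) powr \<gamma>) * fourier f \<xi>)"
    unfolding R fourier_cmult by (subst fourier_add[OF P(1) N(1)]) (simp add: P(2) N(2) distrib_right)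
  also have "\<dots> = - of_real (\<bar>\<xi>\<bar> powr \<gamma>) * fourier f \<xi>"
    unfolding powr_imaginary_sum[OF \<gamma>(1)] using c by simp
  finally show "fourier (riesz \<gamma> f) \<xi> = - of_real (\<bar>\<xi>\<bar> powr \<gamma>) * fourier f \<xi>" .
qed

section \<open>The Gaussian as a test function\<close>

lemma power_le_fact_exp:
  fixes y :: real
  assumes "y \<ge> 0"
  shows "y ^ n \<le> fact n * exp y"
proof -
  have "(\<Sum>k\<in>{n}. y ^ k /\<^sub>R fact k) \<le> (\<Sum>k. y ^ k /\<^sub>R fact k)"
    using assms by (intro sum_le_suminf summable_exp_generic) auto
  then show ?thesis by (simp add: exp_def field_simps)
qed

text \<open>Leaving j arbitrary lets the induction absorb the factor x that \<open>pCons\<close>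
  puts on the rest of the polynomial. The monomial bound combines |x^j| \<le> 1 + x^{2j} with one
  term of the exponential series at x^2/2, whence 1 + 2^j j!.\<close>

lemma bounded_power_poly_gaussian:
  fixes q :: "real poly"
  shows "bounded (range (\<lambda>x. x ^ j * (poly q x * exp (- x\<^sup>2 / 2))))"
proof (induction q arbitrary: j rule: pCons_induct)
  case (pCons a q)
  have "\<bar>x ^ j * exp (- x\<^sup>2 / 2)\<bar> \<le> 1 + 2 ^ j * fact j" for x :: real
  proof -
    have "(x\<^sup>2 / 2) ^ j \<le> fact j * exp (x\<^sup>2 / 2)" by (rule power_le_fact_exp) simp
    then have "(x ^ j)\<^sup>2 \<le> 2 ^ j * fact j * exp (x\<^sup>2 / 2)"
      by (simp add: power_divide power_mult[symmetric] mult.commute field_simps)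
    moreover have "1 \<le> exp (x\<^sup>2 / 2)" by simp
    moreover have "\<bar>x ^ j\<bar> \<le> 1 + (x ^ j)\<^sup>2"
    proof (cases "\<bar>x ^ j\<bar> \<le> 1")
      case False
      then have "\<bar>x ^ j\<bar> * 1 \<le> \<bar>x ^ j\<bar> * \<bar>x ^ j\<bar>" by (intro mult_left_mono) auto
      then show ?thesis by (simp add: power2_eq_square flip: abs_mult)
    qed (simp add: add_increasing2)
    ultimately have "\<bar>x ^ j\<bar> \<le> (1 + 2 ^ j * fact j) * exp (x\<^sup>2 / 2)"
      unfolding distrib_right mult_1 by linarith
    then show ?thesis by (simp add: abs_mult exp_minus field_simps)
  qed
  then have "bounded (range (\<lambda>x::real. x ^ j * exp (- x\<^sup>2 / 2)))"
    unfolding bounded_iff by fastforce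
  then have 1: "bounded (range (\<lambda>x::real. a * (x ^ j * exp (- x\<^sup>2 / 2))))"
    using bounded_scaling[of "range (\<lambda>x::real. x ^ j * exp (- x\<^sup>2 / 2))" a]
    by (simp add: image_image)
  have "(\<lambda>x. x ^ j * (poly (pCons a q) x * exp (- x\<^sup>2 / 2)))
      = (\<lambda>x. a * (x ^ j * exp (- x\<^sup>2 / 2)) + x ^ Suc j * (poly q x * exp (- x\<^sup>2 / 2)))"
    by (simp add: fun_eq_iff algebra_simps)
  then show ?case using bounded_plus_comp[OF 1 pCons(2)[of "Suc j"]] by (simp only:)
qed simp

text \<open>Every derivative is a polynomial times the Gaussian; differentiation sends the
  polynomial q to q' - x q.\<close>

lemma schwartz_gaussian: "schwartz (\<lambda>x. exp (- x\<^sup>2 / 2))"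
proof -
  have d: "((\<lambda>x. poly q x * exp (- x\<^sup>2 / 2)) has_real_derivative
      poly (pderiv q - [:0, 1:] * q) x * exp (- x\<^sup>2 / 2)) (at x)" for q x
    by (auto intro!: derivative_eq_intros poly_DERIV simp: algebra_simps)
  have "\<exists>q. (deriv ^^ n) (\<lambda>x. exp (- x\<^sup>2 / 2)) = (\<lambda>x::real. poly q x * exp (- x\<^sup>2 / 2))" for n
  proof (induction n)
    case 0
    show ?case by (rule exI[of _ 1]) simp
  next
    case (Suc n)
    then obtain q where "(deriv ^^ n) (\<lambda>x. exp (- x\<^sup>2 / 2)) = (\<lambda>x::real. poly q x * exp (- x\<^sup>2 / 2))" ..
    then show ?case
      by (intro exI[of _ "pderiv q - [:0, 1:] * q"]) (simp only: funpow.simps comp_apply DERIV_imp_deriv[OF d])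
  qed
  then obtain q where q: "\<And>n. (deriv ^^ n) (\<lambda>x. exp (- x\<^sup>2 / 2)) = (\<lambda>x::real. poly (q n) x * exp (- x\<^sup>2 / 2))"
    by metis
  show ?thesis
    unfolding schwartz_def q
    by (intro conjI allI bounded_power_poly_gaussian) (use d real_differentiable_def in blast)
qed

lemma fourier_gaussian: "fourier (\<lambda>x. exp (- x\<^sup>2 / 2)) \<xi> = of_real (sqrt (2 * pi) * exp (- \<xi>\<^sup>2 / 2))"
proof -
  have "of_real (exp (- \<xi>\<^sup>2 / 2)) = (CLINT x|std_normal_distribution. iexp (\<xi> * x))"
    using fun_cong[OF char_std_normal_distribution, of \<xi>] by (simp only: char_def)
  also have "\<dots> = (CLBINT x. std_normal_density x *\<^sub>R iexp (\<xi> * x))"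
    by (subst integral_density) auto
  also have "\<dots> = (CLBINT x. of_real (1 / sqrt (2 * pi)) * (iexp (\<xi> * x) * complex_of_real (exp (- x\<^sup>2 / 2))))"
    by (simp add: std_normal_density_def scaleR_conv_of_real mult_ac)
  also have "\<dots> = of_real (1 / sqrt (2 * pi)) * fourier (\<lambda>x. exp (- x\<^sup>2 / 2)) \<xi>"
    unfolding fourier_def by (rule integral_mult_right_zero)
  finally show ?thesis by (simp add: field_simps)
qed

text \<open>A solution merely asserts that some symbol exists; this forces that symbol to be the one
  computed for \<open>riesz\<close>.\<close>

lemma has_fourier_symbol_unique:
  assumes "has_fourier_symbol A \<sigma>" "has_fourier_symbol A \<tau>"
  shows "\<sigma> = \<tau>"
proof
  fix \<xi>
  have "\<sigma> \<xi> * fourier (\<lambda>x. exp (- x\<^sup>2 / 2)) \<xi> = \<tau> \<xi> * fourier (\<lambda>x. exp (- x\<^sup>2 / 2)) \<xi>"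
    using assms schwartz_gaussian unfolding has_fourier_symbol_def by metis
  moreover have "fourier (\<lambda>x. exp (- x\<^sup>2 / 2)) \<xi> \<noteq> 0" unfolding fourier_gaussian by simp
  ultimately show "\<sigma> \<xi> = \<tau> \<xi>" by (metis mult_right_cancel)
qed

text \<open>Multiplication by the integrating factor e^{ct} gives a constant on t > 0. Its value is
  found from the right limit at 0, since nothing is assumed about \<phi> at 0 itself.\<close>

lemma exponential_ode_unique:
  fixes \<phi> :: "real \<Rightarrow> complex" and c t :: real
  assumes d: "\<And>t. t > 0 \<Longrightarrow> (\<phi> has_vector_derivative - of_real c * \<phi> t) (at t)"
    and lim: "(\<phi> \<longlongrightarrow> 1) (at_right 0)" and t: "t > 0"
  shows "\<phi> t = of_real (exp (- c * t))"
proof -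
  let ?\<psi> = "\<lambda>t. complex_of_real (exp (c * t)) * \<phi> t"
  have z: "(?\<psi> has_vector_derivative 0) (at s within {0<..})" if "s \<in> {0<..}" for s
  proof -
    from that have s: "s > 0" by simp
    have "((\<lambda>t. complex_of_real (exp (c * t))) has_vector_derivative of_real (c * exp (c * s))) (at s)"
      by (rule has_vector_derivative_of_real)
        (auto intro!: derivative_eq_intros simp: has_real_derivative_iff_has_vector_derivative[symmetric])
    from has_vector_derivative_mult[OF this d[OF s]]
    have "(?\<psi> has_vector_derivative 0) (at s)" by (simp add: algebra_simps)
    then show ?thesis by (rule has_vector_derivative_at_within)
  qed
  obtain a where "\<And>s. s \<in> {0<..} \<Longrightarrow> ?\<psi> s = a"
    using has_vector_derivative_zero_constant[OF convex_real_interval(3) z] by blast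
  then have a: "\<And>s. s > 0 \<Longrightarrow> ?\<psi> s = a" by simp
  have "((\<lambda>t. exp (c * t)) \<longlongrightarrow> exp (c * 0)) (at_right 0)" by (intro tendsto_intros)
  then have "(?\<psi> \<longlongrightarrow> of_real (exp (c * 0)) * 1) (at_right 0)" by (intro tendsto_mult tendsto_of_real lim)
  moreover have "(?\<psi> \<longlongrightarrow> a) (at_right 0)"
    by (rule tendsto_eventually) (use a in \<open>auto simp: eventually_at_filter\<close>)
  ultimately have "a = 1" using tendsto_unique[of "at_right (0::real)"] by fastforce
  then have "of_real (exp (c * t)) * \<phi> t = 1" using a[OF t] by simp
  then show ?thesis by (simp add: exp_minus field_simps)
qed

text \<open>The transform at 0 is the total mass, so both functions have the same mass c. If c = 0
  both vanish almost everywhere; otherwise dividing by c gives probability densities and Levy's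
  uniqueness theorem applies.\<close>

lemma fourier_unique_nonneg:
  fixes P N :: "real \<Rightarrow> real"
  assumes P: "integrable lborel P" "\<And>x. P x \<ge> 0" and N: "integrable lborel N" "\<And>x. N x \<ge> 0"
    and eq: "\<And>\<xi>. fourier P \<xi> = fourier N \<xi>"
  shows "AE x in lborel. P x = N x"
proof -
  have f0: "fourier F 0 = of_real (LBINT x. F x)" for F by (simp add: fourier_def)
  define c where "c = (LBINT x. P x)"
  have cN: "c = (LBINT x. N x)" using eq[of 0] by (simp only: f0 c_def of_real_eq_iff)
  have c: "c \<ge> 0" unfolding c_def by (rule integral_nonneg_AE) (simp add: P)
  show ?thesis
  proof (cases "c = 0")
    case True
    then have "(LBINT x. P x) = 0" "(LBINT x. N x) = 0" using cN c_def by auto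
    then have "AE x in lborel. P x = 0" "AE x in lborel. N x = 0"
      using integral_nonneg_eq_0_iff_AE[OF P(1)] integral_nonneg_eq_0_iff_AE[OF N(1)] P(2) N(2) by auto
    then show ?thesis by eventually_elim simp
  next
    case False
    with c have c: "c > 0" by simp
    have *: "real_distribution (density lborel (\<lambda>x. ennreal (F x / c)))"
      "char (density lborel (\<lambda>x. ennreal (F x / c))) \<xi> = fourier F \<xi> / of_real c"
      if F: "integrable lborel F" "\<And>x. F x \<ge> 0" and cF: "c = (LBINT x. F x)" for F \<xi>
    proof -
      have [measurable]: "F \<in> borel_measurable borel" using F by auto
      have "(\<integral>\<^sup>+x. ennreal (F x / c) \<partial>lborel) = ennreal (LBINT x. F x / c)"
        using F c by (intro nn_integral_eq_integral) auto
      also have "\<dots> = 1" using c by (simp add: cF[symmetric])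
      finally have "prob_space (density lborel (\<lambda>x. ennreal (F x / c)))"
        by (intro prob_spaceI) (simp add: emeasure_density)
      then show "real_distribution (density lborel (\<lambda>x. ennreal (F x / c)))"
        by (simp add: real_distribution_def real_distribution_axioms_def)
      have "char (density lborel (\<lambda>x. ennreal (F x / c))) \<xi> = (CLBINT x. (F x / c) *\<^sub>R iexp (\<xi> * x))"
        unfolding char_def using F c by (subst integral_density) auto
      also have "\<dots> = (CLBINT x. iexp (\<xi> * x) * complex_of_real (F x) / of_real c)"
        by (simp add: scaleR_conv_of_real mult_ac)
      finally show "char (density lborel (\<lambda>x. ennreal (F x / c))) \<xi> = fourier F \<xi> / of_real c"
        by (simp add: fourier_def)
    qed
    have "density lborel (\<lambda>x. ennreal (P x / c)) = density lborel (\<lambda>x. ennreal (N x / c))"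
      by (rule Levy_uniqueness[OF *(1)[OF P c_def] *(1)[OF N cN]])
        (simp add: fun_eq_iff *(2)[OF P c_def] *(2)[OF N cN] eq)
    then have "AE x in lborel. ennreal (P x / c) = ennreal (N x / c)"
      using P N by (subst (asm) sigma_finite_measure.density_unique_iff[OF sigma_finite_lborel]) auto
    then show ?thesis
      by eventually_elim (use P N c in simp)
  qed
qed

text \<open>Moving the negative parts across the equation f = g gives two nonnegative functions
  \<open>?P\<close> and \<open>?N\<close> with \<open>?P\<close> - \<open>?N\<close> = f -
  g.\<close>

lemma fourier_unique:
  fixes f g :: "real \<Rightarrow> real"
  assumes f: "integrable lborel f" and g: "integrable lborel g"
    and eq: "\<And>\<xi>. fourier f \<xi> = fourier g \<xi>"
  shows "AE x in lborel. f x = g x"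
proof -
  let ?P = "\<lambda>x. max 0 (f x) + max 0 (- g x)" and ?N = "\<lambda>x. max 0 (- f x) + max 0 (g x)"
  have i: "integrable lborel ?P" "integrable lborel ?N" using f g by (auto intro!: integrable_max)
  have "fourier ?P \<xi> = fourier ?N \<xi>" for \<xi>
  proof -
    have "fourier ?P \<xi> + fourier g \<xi> = fourier (\<lambda>x. ?P x + g x) \<xi>"
      by (rule fourier_add[OF i(1) g, symmetric])
    also have "(\<lambda>x. ?P x + g x) = (\<lambda>x. ?N x + f x)" by (auto simp: max_def)
    also have "fourier \<dots> \<xi> = fourier ?N \<xi> + fourier f \<xi>" by (rule fourier_add[OF i(2) f])
    finally show ?thesis by (simp add: eq)
  qed
  then have "AE x in lborel. ?P x = ?N x" by (intro fourier_unique_nonneg i) auto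
  then show ?thesis by eventually_elim (auto simp: max_def split: if_splits)
qed

section \<open>Fourier inversion\<close>

lemma integrable_fourier_product:
  fixes f :: "real \<Rightarrow> real" and \<phi> :: "real \<Rightarrow> real"
  assumes f: "integrable lborel f" and \<phi>: "integrable lborel \<phi>"
  shows "integrable (lborel \<Otimes>\<^sub>M lborel) (\<lambda>(\<xi>, y). iexp (\<xi> * (y - x)) * complex_of_real (f y * \<phi> \<xi>))"
proof (rule lborel_pair.Fubini_integrable)
  have [measurable]: "f \<in> borel_measurable borel" "\<phi> \<in> borel_measurable borel" using f \<phi> by auto
  show "(\<lambda>(\<xi>, y). iexp (\<xi> * (y - x)) * complex_of_real (f y * \<phi> \<xi>)) \<in> borel_measurable (lborel \<Otimes>\<^sub>M lborel)"
    by measurable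
  have "(\<lambda>\<xi>. LBINT y. norm (case (\<xi>, y) of (\<xi>, y) \<Rightarrow> iexp (\<xi> * (y - x)) * complex_of_real (f y * \<phi> \<xi>)))
      = (\<lambda>\<xi>. (LBINT y. \<bar>f y\<bar>) * \<bar>\<phi> \<xi>\<bar>)"
    by (simp add: norm_mult abs_mult)
  then show "integrable lborel (\<lambda>\<xi>. LBINT y. norm (case (\<xi>, y) of (\<xi>, y) \<Rightarrow> iexp (\<xi> * (y - x)) * complex_of_real (f y * \<phi> \<xi>)))"
    using \<phi> by simp
  have "integrable lborel (\<lambda>y. iexp (\<xi> * (y - x)) * complex_of_real (f y * \<phi> \<xi>))" for \<xi>
    by (rule Bochner_Integration.integrable_bound[of _ "\<lambda>y. f y * \<phi> \<xi>"]) (use f in \<open>auto simp: norm_mult\<close>)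
  then show "AE \<xi> in lborel. integrable lborel (\<lambda>y. case (\<xi>, y) of (\<xi>, y) \<Rightarrow> iexp (\<xi> * (y - x)) * complex_of_real (f y * \<phi> \<xi>))"
    by simp
qed

lemma integrable_gaussian: "integrable lborel (\<lambda>x::real. exp (- x\<^sup>2 / 2))"
  by (rule schwartz_integrable[OF schwartz_gaussian])

lemma integral_gaussian: "(LBINT x::real. exp (- x\<^sup>2 / 2)) = sqrt (2 * pi)"
proof -
  have "complex_of_real (LBINT x::real. exp (- x\<^sup>2 / 2)) = of_real (sqrt (2 * pi))"
    using fourier_gaussian[of 0] by (simp add: fourier_def)
  then show ?thesis by (simp only: of_real_eq_iff)
qed

text \<open>The Gaussian factor makes the double integral absolutely convergent, and its own
  transform is a Gaussian that concentrates at y = x as c grows.\<close>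

lemma fourier_inversion_gaussian:
  fixes f :: "real \<Rightarrow> real"
  assumes f: "integrable lborel f" and c: "c > 0"
  shows "(CLBINT \<xi>. iexp (- (\<xi> * x)) * fourier f \<xi> * of_real (exp (- (\<xi> / c)\<^sup>2 / 2)))
    = of_real (LBINT y. f y * (c * sqrt (2 * pi) * exp (- (c * (y - x))\<^sup>2 / 2)))"
proof -
  have \<phi>: "integrable lborel (\<lambda>\<xi>. exp (- (\<xi> / c)\<^sup>2 / 2))"
    using lborel_integrable_real_affine[OF integrable_gaussian, of "1 / c" 0] c by simp
  have inner: "(CLBINT \<xi>. iexp (\<xi> * w) * of_real (exp (- (\<xi> / c)\<^sup>2 / 2)))
      = of_real (c * sqrt (2 * pi) * exp (- (c * w)\<^sup>2 / 2))" for w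
  proof -
    have "(CLBINT \<xi>. iexp (\<xi> * w) * of_real (exp (- (\<xi> / c)\<^sup>2 / 2)))
        = \<bar>c\<bar> *\<^sub>R (CLBINT \<xi>. iexp ((0 + c * \<xi>) * w) * of_real (exp (- ((0 + c * \<xi>) / c)\<^sup>2 / 2)))"
      by (rule lborel_integral_real_affine) (use c in simp)
    also have "(CLBINT \<xi>. iexp ((0 + c * \<xi>) * w) * of_real (exp (- ((0 + c * \<xi>) / c)\<^sup>2 / 2)))
        = fourier (\<lambda>x. exp (- x\<^sup>2 / 2)) (c * w)"
      using c by (simp add: fourier_def mult_ac)
    finally show ?thesis using c by (simp only: fourier_gaussian) (simp add: scaleR_conv_of_real)
  qed
  have "(CLBINT \<xi>. iexp (- (\<xi> * x)) * fourier f \<xi> * of_real (exp (- (\<xi> / c)\<^sup>2 / 2)))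
      = (CLBINT \<xi>. CLBINT y. iexp (\<xi> * (y - x)) * complex_of_real (f y * exp (- (\<xi> / c)\<^sup>2 / 2)))"
  proof (rule Bochner_Integration.integral_cong)
    fix \<xi> :: real
    have "iexp (- (\<xi> * x)) * fourier f \<xi> * of_real (exp (- (\<xi> / c)\<^sup>2 / 2))
      = (iexp (- (\<xi> * x)) * of_real (exp (- (\<xi> / c)\<^sup>2 / 2))) * fourier f \<xi>" by simp
    also have "\<dots> = (CLBINT y. (iexp (- (\<xi> * x)) * of_real (exp (- (\<xi> / c)\<^sup>2 / 2))) * (iexp (\<xi> * y) * complex_of_real (f y)))"
      unfolding fourier_def by (rule integral_mult_right_zero[symmetric])
    also have "\<dots> = (CLBINT y. iexp (\<xi> * (y - x)) * complex_of_real (f y * exp (- (\<xi> / c)\<^sup>2 / 2)))"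
    proof (rule Bochner_Integration.integral_cong)
      fix y :: real
      have "iexp (\<xi> * (y - x)) = iexp (- (\<xi> * x)) * iexp (\<xi> * y)"
        by (simp add: exp_add[symmetric] algebra_simps)
      then show "(iexp (- (\<xi> * x)) * of_real (exp (- (\<xi> / c)\<^sup>2 / 2))) * (iexp (\<xi> * y) * complex_of_real (f y))
        = iexp (\<xi> * (y - x)) * complex_of_real (f y * exp (- (\<xi> / c)\<^sup>2 / 2))"
        by (simp only: of_real_mult mult_ac)
    qed simp
    finally show "iexp (- (\<xi> * x)) * fourier f \<xi> * of_real (exp (- (\<xi> / c)\<^sup>2 / 2))
      = (CLBINT y. iexp (\<xi> * (y - x)) * complex_of_real (f y * exp (- (\<xi> / c)\<^sup>2 / 2)))" .
  qed simp
  also have "\<dots> = (CLBINT y. CLBINT \<xi>. iexp (\<xi> * (y - x)) * complex_of_real (f y * exp (- (\<xi> / c)\<^sup>2 / 2)))"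
    by (rule lborel_pair.Fubini_integral[OF integrable_fourier_product[OF f \<phi>], symmetric])
  also have "\<dots> = (CLBINT y. of_real (f y * (c * sqrt (2 * pi) * exp (- (c * (y - x))\<^sup>2 / 2))))"
  proof (rule Bochner_Integration.integral_cong)
    fix y :: real
    have "(CLBINT \<xi>. iexp (\<xi> * (y - x)) * complex_of_real (f y * exp (- (\<xi> / c)\<^sup>2 / 2)))
       = (CLBINT \<xi>. of_real (f y) * (iexp (\<xi> * (y - x)) * of_real (exp (- (\<xi> / c)\<^sup>2 / 2))))"
      by (simp only: of_real_mult mult_ac)
    also have "\<dots> = of_real (f y * (c * sqrt (2 * pi) * exp (- (c * (y - x))\<^sup>2 / 2)))"
      unfolding integral_mult_right_zero inner by (simp only: of_real_mult)
    finally show "(CLBINT \<xi>. iexp (\<xi> * (y - x)) * complex_of_real (f y * exp (- (\<xi> / c)\<^sup>2 / 2)))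
       = of_real (f y * (c * sqrt (2 * pi) * exp (- (c * (y - x))\<^sup>2 / 2)))" .
  qed simp
  finally show ?thesis by (simp only: integral_complex_of_real)
qed

text \<open>\<open>f\<close> may be unbounded away from \<open>x\<close>, so the region far from \<open>x\<close> is estimated by the supremum of
  the Gaussian there, and only the region near \<open>x\<close> by dominated convergence.\<close>

lemma gaussian_approximate_identity:
  fixes f :: "real \<Rightarrow> real"
  assumes f: "integrable lborel f" and cont: "isCont f x"
  shows "(\<lambda>n. LBINT y. f y * (real (Suc n) * sqrt (2 * pi) * exp (- (real (Suc n) * (y - x))\<^sup>2 / 2)))
           \<longlonglongrightarrow> 2 * pi * f x"
proof -
  have [measurable]: "f \<in> borel_measurable borel" using f by auto
  \<comment> \<open>\<open>G n\<close> has integral 2 pi for every n, which is the factor in the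
    limit.\<close>
  define G where "G n w = real (Suc n) * sqrt (2 * pi) * exp (- (real (Suc n) * w)\<^sup>2 / 2)" for n and w :: real
  have [measurable]: "G n \<in> borel_measurable borel" for n unfolding G_def by measurable
  have G0: "0 \<le> G n w" for n w unfolding G_def by simp
  have Gle: "G n w \<le> real (Suc n) * sqrt (2 * pi)" for n w
    unfolding G_def by (rule mult_left_le) auto
  from cont obtain \<delta> where \<delta>: "\<delta> > 0" "\<And>y. \<bar>y - x\<bar> < \<delta> \<Longrightarrow> \<bar>f y - f x\<bar> < 1"
    unfolding continuous_at_eps_delta dist_real_def by (metis zero_less_one)
  let ?I = "indicator {y. \<bar>y - x\<bar> < \<delta>} :: real \<Rightarrow> real"
  have int: "integrable lborel (\<lambda>y. f y * G n (y - x))" for n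
    by (rule Bochner_Integration.integrable_bound[of _ "\<lambda>y. f y * (real (Suc n) * sqrt (2 * pi))"])
      (use f G0 Gle in \<open>auto simp: abs_mult simp del: of_nat_Suc intro!: mult_left_mono\<close>)
  have int1: "integrable lborel (\<lambda>y. ?I y * (f y * G n (y - x)))" for n
    by (rule Bochner_Integration.integrable_bound[OF int[of n]]) (auto simp: indicator_def)
  have int2: "integrable lborel (\<lambda>y. (1 - ?I y) * (f y * G n (y - x)))" for n
    by (rule Bochner_Integration.integrable_bound[OF int[of n]]) (auto simp: indicator_def)
  have "(\<lambda>n. LBINT y. ?I y * (f y * G n (y - x))) \<longlonglongrightarrow> 2 * pi * f x"
  proof -
    \<comment> \<open>Rescaling by n + 1 around x turns the concentrating kernel into a fixed
      Gaussian, so that a majorant independent of n exists.\<close>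
    have eq: "(LBINT y. ?I y * (f y * G n (y - x)))
       = (LBINT w. sqrt (2 * pi) * (?I (x + w / real (Suc n)) * f (x + w / real (Suc n)) * exp (- w\<^sup>2 / 2)))" for n
    proof -
      have "(LBINT y. ?I y * (f y * G n (y - x))) = \<bar>1 / real (Suc n)\<bar> *\<^sub>R
         (LBINT w. ?I (x + 1 / real (Suc n) * w) * (f (x + 1 / real (Suc n) * w) * G n (x + 1 / real (Suc n) * w - x)))"
        by (rule lborel_integral_real_affine) simp
      also have "\<dots> = (LBINT w. (1 / real (Suc n)) *
         (?I (x + 1 / real (Suc n) * w) * (f (x + 1 / real (Suc n) * w) * G n (x + 1 / real (Suc n) * w - x))))"
        by (subst integral_mult_right_zero) simp
      also have "\<dots> = (LBINT w. sqrt (2 * pi) * (?I (x + w / real (Suc n)) * f (x + w / real (Suc n)) * exp (- w\<^sup>2 / 2)))"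
        unfolding G_def by (intro Bochner_Integration.integral_cong) (simp_all add: mult_ac del: of_nat_Suc)
      finally show ?thesis .
    qed
    have "(\<lambda>n. LBINT w. sqrt (2 * pi) * (?I (x + w / real (Suc n)) * f (x + w / real (Suc n)) * exp (- w\<^sup>2 / 2)))
        \<longlonglongrightarrow> (LBINT w. sqrt (2 * pi) * (1 * f x * exp (- w\<^sup>2 / 2)))"
    proof (rule integral_dominated_convergence[where w="\<lambda>w. sqrt (2 * pi) * ((\<bar>f x\<bar> + 1) * exp (- w\<^sup>2 / 2))"])
      show "integrable lborel (\<lambda>w. sqrt (2 * pi) * ((\<bar>f x\<bar> + 1) * exp (- w\<^sup>2 / 2)))"
        by (intro integrable_mult_right integrable_gaussian)
      show "AE w in lborel. (\<lambda>n. sqrt (2 * pi) * (?I (x + w / real (Suc n)) * f (x + w / real (Suc n)) * exp (- w\<^sup>2 / 2)))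
          \<longlonglongrightarrow> sqrt (2 * pi) * (1 * f x * exp (- w\<^sup>2 / 2))"
      proof (rule AE_I2)
        fix w :: real
        have l: "(\<lambda>n. w / real (Suc n)) \<longlonglongrightarrow> 0" by real_asymp
        then have y: "(\<lambda>n. x + w / real (Suc n)) \<longlonglongrightarrow> x" using tendsto_add[OF tendsto_const l, of x] by simp
        have "\<forall>\<^sub>F n in sequentially. \<bar>w / real (Suc n)\<bar> < \<delta>"
          using tendsto_rabs[OF l] \<delta>(1) by (intro order_tendstoD) simp_all
        then have "\<forall>\<^sub>F n in sequentially. ?I (x + w / real (Suc n)) = 1"
          by eventually_elim (simp add: indicator_def)
        then have "(\<lambda>n. ?I (x + w / real (Suc n))) \<longlonglongrightarrow> 1" by (rule tendsto_eventually)
        then show "(\<lambda>n. sqrt (2 * pi) * (?I (x + w / real (Suc n)) * f (x + w / real (Suc n)) * exp (- w\<^sup>2 / 2)))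
          \<longlonglongrightarrow> sqrt (2 * pi) * (1 * f x * exp (- w\<^sup>2 / 2))"
          by (intro tendsto_mult tendsto_const isCont_tendsto_compose[OF cont y])
      qed
      show "AE w in lborel. norm (sqrt (2 * pi) * (?I (x + w / real (Suc n)) * f (x + w / real (Suc n)) * exp (- w\<^sup>2 / 2)))
          \<le> sqrt (2 * pi) * ((\<bar>f x\<bar> + 1) * exp (- w\<^sup>2 / 2))" for n
      proof (rule AE_I2)
        fix w :: real
        have "\<bar>?I y * f y\<bar> \<le> \<bar>f x\<bar> + 1" for y
          using \<delta>(2)[of y] by (auto simp: indicator_def)
        then show "norm (sqrt (2 * pi) * (?I (x + w / real (Suc n)) * f (x + w / real (Suc n)) * exp (- w\<^sup>2 / 2)))
          \<le> sqrt (2 * pi) * ((\<bar>f x\<bar> + 1) * exp (- w\<^sup>2 / 2))"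
          unfolding real_norm_def abs_mult[of "sqrt (2 * pi)"] abs_mult[of _ "exp (- w\<^sup>2 / 2)"]
          by (intro mult_mono mult_nonneg_nonneg) auto
      qed
    qed measurable
    also have "(LBINT w. sqrt (2 * pi) * (1 * f x * exp (- w\<^sup>2 / 2))) = sqrt (2 * pi) * (f x * sqrt (2 * pi))"
      by (simp only: integral_mult_right_zero integral_gaussian mult_1)
    also have "\<dots> = 2 * pi * f x"
    proof -
      have "sqrt (2 * pi) * sqrt (2 * pi) = 2 * pi" by (rule real_sqrt_mult_self[THEN trans]) simp
      then show ?thesis by (metis mult.assoc mult.commute)
    qed
    finally show ?thesis unfolding eq .
  qed
  moreover have "(\<lambda>n. LBINT y. (1 - ?I y) * (f y * G n (y - x))) \<longlonglongrightarrow> 0"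
  proof (rule Lim_null_comparison)
    show "\<forall>\<^sub>F n in sequentially. norm (LBINT y. (1 - ?I y) * (f y * G n (y - x))) \<le> G n \<delta> * (LBINT y. \<bar>f y\<bar>)"
    proof (intro always_eventually allI)
      fix n
      have "norm (LBINT y. (1 - ?I y) * (f y * G n (y - x))) \<le> (LBINT y. G n \<delta> * \<bar>f y\<bar>)"
      proof (rule Bochner_Integration.integral_norm_bound[THEN order_trans], rule integral_mono)
        show "integrable lborel (\<lambda>y. norm ((1 - ?I y) * (f y * G n (y - x))))" using int2 by (rule integrable_norm)
        show "integrable lborel (\<lambda>y. G n \<delta> * \<bar>f y\<bar>)" using f by simp
        fix y
        have "G n (y - x) \<le> G n \<delta>" if "\<bar>y - x\<bar> \<ge> \<delta>"
        proof -
          have "(real (Suc n) * \<delta>)\<^sup>2 \<le> (real (Suc n) * (y - x))\<^sup>2"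
            using that \<delta>(1) unfolding power_mult_distrib
            by (intro mult_left_mono) (auto simp: abs_le_square_iff[symmetric])
          then show ?thesis unfolding G_def by (intro mult_left_mono) auto
        qed
        then show "norm ((1 - ?I y) * (f y * G n (y - x))) \<le> G n \<delta> * \<bar>f y\<bar>"
          using G0[of n "y - x"] G0[of n \<delta>]
          by (auto simp: indicator_def abs_mult mult.commute[of "G n \<delta>"] intro!: mult_left_mono)
      qed
      then show "norm (LBINT y. (1 - ?I y) * (f y * G n (y - x))) \<le> G n \<delta> * (LBINT y. \<bar>f y\<bar>)" by simp
    qed
    have "(\<lambda>n. G n \<delta>) \<longlonglongrightarrow> 0" unfolding G_def using \<delta>(1) by real_asymp
    then show "(\<lambda>n. G n \<delta> * (LBINT y. \<bar>f y\<bar>)) \<longlonglongrightarrow> 0" by (rule tendsto_mult_left_zero)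
  qed
  ultimately have "(\<lambda>n. (LBINT y. ?I y * (f y * G n (y - x))) + (LBINT y. (1 - ?I y) * (f y * G n (y - x))))
      \<longlonglongrightarrow> 2 * pi * f x + 0" by (rule tendsto_add)
  moreover have "(LBINT y. ?I y * (f y * G n (y - x))) + (LBINT y. (1 - ?I y) * (f y * G n (y - x)))
      = (LBINT y. f y * G n (y - x))" for n
    by (subst Bochner_Integration.integral_add[OF int1 int2, symmetric]) (simp add: algebra_simps)
  ultimately show ?thesis by (simp add: G_def)
qed

text \<open>Let c = n + 1 tend to infinity in the Gaussian-damped formula: one side is dominated by
  |\<open>fourier f\<close>|, the other is an approximate identity. Continuity at x alone gives the
  formula at that x.\<close>

lemma fourier_inversion:
  fixes f :: "real \<Rightarrow> real"
  assumes f: "integrable lborel f" and cont: "isCont f x" and F: "integrable lborel (fourier f)"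
  shows "of_real (2 * pi * f x) = (CLBINT \<xi>. iexp (- (\<xi> * x)) * fourier f \<xi>)"
proof -
  have [measurable]: "fourier f \<in> borel_measurable borel" using F by auto
  have "(\<lambda>n. CLBINT \<xi>. iexp (- (\<xi> * x)) * fourier f \<xi> * of_real (exp (- (\<xi> / real (Suc n))\<^sup>2 / 2)))
      \<longlonglongrightarrow> (CLBINT \<xi>. iexp (- (\<xi> * x)) * fourier f \<xi> * of_real (exp (- 0\<^sup>2 / 2)))"
  proof (rule integral_dominated_convergence[where w="\<lambda>\<xi>. norm (fourier f \<xi>)"])
    show "integrable lborel (\<lambda>\<xi>. norm (fourier f \<xi>))" using F by simp
    show "AE \<xi> in lborel. (\<lambda>n. iexp (- (\<xi> * x)) * fourier f \<xi> * of_real (exp (- (\<xi> / real (Suc n))\<^sup>2 / 2)))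
        \<longlonglongrightarrow> iexp (- (\<xi> * x)) * fourier f \<xi> * of_real (exp (- 0\<^sup>2 / 2))"
    proof (rule AE_I2)
      fix \<xi> :: real
      have "(\<lambda>n. \<xi> / real (Suc n)) \<longlonglongrightarrow> 0" by real_asymp
      then show "(\<lambda>n. iexp (- (\<xi> * x)) * fourier f \<xi> * of_real (exp (- (\<xi> / real (Suc n))\<^sup>2 / 2)))
        \<longlonglongrightarrow> iexp (- (\<xi> * x)) * fourier f \<xi> * of_real (exp (- 0\<^sup>2 / 2))"
        by (intro tendsto_intros) simp_all
    qed
    show "AE \<xi> in lborel. norm (iexp (- (\<xi> * x)) * fourier f \<xi> * of_real (exp (- (\<xi> / real (Suc n))\<^sup>2 / 2)))
        \<le> norm (fourier f \<xi>)" for n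
      by (rule AE_I2) (simp add: norm_mult mult_left_le)
  qed measurable
  moreover have "(\<lambda>n. complex_of_real (LBINT y. f y * (real (Suc n) * sqrt (2 * pi) * exp (- (real (Suc n) * (y - x))\<^sup>2 / 2))))
      \<longlonglongrightarrow> of_real (2 * pi * f x)"
    by (rule tendsto_of_real[OF gaussian_approximate_identity[OF f cont]])
  moreover have "(CLBINT \<xi>. iexp (- (\<xi> * x)) * fourier f \<xi> * of_real (exp (- (\<xi> / real (Suc n))\<^sup>2 / 2)))
     = of_real (LBINT y. f y * (real (Suc n) * sqrt (2 * pi) * exp (- (real (Suc n) * (y - x))\<^sup>2 / 2)))" for n
    by (rule fourier_inversion_gaussian[OF f]) simp
  ultimately have "(CLBINT \<xi>. iexp (- (\<xi> * x)) * fourier f \<xi> * of_real (exp (- 0\<^sup>2 / 2))) = of_real (2 * pi * f x)"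
    by (intro LIMSEQ_unique) (simp_all only:)
  then show ?thesis by simp
qed

section \<open>The stable kernel\<close>

text \<open>The inverse transform of e^{-t|\<xi>|^\<gamma>}, real because the multiplier is even.
  For \<gamma> \<le> 2 it is the symmetric stable density, for \<gamma> = 2k the fundamental
  solution of the equation of order 2k.\<close>

definition stable_kernel :: "real \<Rightarrow> real \<Rightarrow> real \<Rightarrow> real" where
  "stable_kernel \<gamma> t x = (LBINT \<xi>. cos (\<xi> * x) * exp (- t * \<bar>\<xi>\<bar> powr \<gamma>)) / (2 * pi)"

lemma integrable_exp_neg_powr:
  fixes \<gamma> t :: real
  assumes \<gamma>: "\<gamma> > 0" and t: "t > 0"
  shows "integrable lborel (\<lambda>\<xi>. exp (- t * \<bar>\<xi>\<bar> powr \<gamma>))"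
proof -
  \<comment> \<open>With \<gamma> n at least 2, \<xi>^2 is at most the n-th power of
    |\<xi>|^\<gamma> for |\<xi>| > 1, and the n-th term of the exponential series controls that
    power.\<close>
  obtain n :: nat where n: "2 / \<gamma> < real n" using reals_Archimedean2 by blast
  then have n2: "2 \<le> \<gamma> * real n" using \<gamma> by (simp add: field_simps)
  \<comment> \<open>The summand 2 covers |\<xi>| \<le> 1, the other one the rest.\<close>
  define C where "C = 2 * fact n / t ^ n + 2"
  have C: "C \<ge> 2" using t by (simp add: C_def)
  have "exp (- t * \<bar>\<xi>\<bar> powr \<gamma>) \<le> C * (1 / (1 + \<xi>\<^sup>2))" for \<xi>
  proof -
    have pos: "0 < 1 + \<xi>\<^sup>2" by (simp add: add_pos_nonneg)
    have "exp (- t * \<bar>\<xi>\<bar> powr \<gamma>) * (1 + \<xi>\<^sup>2) \<le> C"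
    proof (cases "\<bar>\<xi>\<bar> \<le> 1")
      case True
      then have "1 + \<xi>\<^sup>2 \<le> 2" by (simp add: abs_square_le_1)
      moreover have "exp (- t * \<bar>\<xi>\<bar> powr \<gamma>) \<le> 1" using t by simp
      ultimately have "exp (- t * \<bar>\<xi>\<bar> powr \<gamma>) * (1 + \<xi>\<^sup>2) \<le> 1 * 2"
        using pos by (intro mult_mono) auto
      then show ?thesis using C by simp
    next
      case False
      have "\<xi>\<^sup>2 = \<bar>\<xi>\<bar> powr 2" using False by (simp add: powr_numeral)
      also have "\<dots> \<le> \<bar>\<xi>\<bar> powr (\<gamma> * real n)" using False n2 by (intro powr_mono) auto
      also have "\<dots> = (\<bar>\<xi>\<bar> powr \<gamma>) ^ n" using False by (simp add: powr_powr[symmetric] powr_realpow)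
      finally have 1: "\<xi>\<^sup>2 \<le> (\<bar>\<xi>\<bar> powr \<gamma>) ^ n" .
      have "t ^ n * (\<bar>\<xi>\<bar> powr \<gamma>) ^ n \<le> fact n * exp (t * \<bar>\<xi>\<bar> powr \<gamma>)"
        using power_le_fact_exp[of "t * \<bar>\<xi>\<bar> powr \<gamma>" n] t by (simp add: power_mult_distrib)
      then have "(\<bar>\<xi>\<bar> powr \<gamma>) ^ n * exp (- t * \<bar>\<xi>\<bar> powr \<gamma>) \<le> fact n / t ^ n"
        using t by (simp add: exp_minus field_simps)
      moreover have "\<xi>\<^sup>2 * exp (- t * \<bar>\<xi>\<bar> powr \<gamma>) \<le> (\<bar>\<xi>\<bar> powr \<gamma>) ^ n * exp (- t * \<bar>\<xi>\<bar> powr \<gamma>)"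
        using 1 by (intro mult_right_mono) auto
      moreover have "exp (- t * \<bar>\<xi>\<bar> powr \<gamma>) * (1 + \<xi>\<^sup>2) \<le> 2 * (\<xi>\<^sup>2 * exp (- t * \<bar>\<xi>\<bar> powr \<gamma>))"
      proof -
        have "1\<^sup>2 \<le> \<bar>\<xi>\<bar>\<^sup>2" using False by (intro power_mono) auto
        then have "exp (- t * \<bar>\<xi>\<bar> powr \<gamma>) * (1 + \<xi>\<^sup>2) \<le> exp (- t * \<bar>\<xi>\<bar> powr \<gamma>) * (2 * \<xi>\<^sup>2)"
          by (intro mult_left_mono) auto
        then show ?thesis by (simp only: mult_ac)
      qed
      ultimately have "exp (- t * \<bar>\<xi>\<bar> powr \<gamma>) * (1 + \<xi>\<^sup>2) \<le> 2 * (fact n / t ^ n)"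
        by linarith
      then show ?thesis by (simp add: C_def)
    qed
    then show ?thesis using pos by (simp add: pos_le_divide_eq)
  qed
  then show ?thesis
    by (intro Bochner_Integration.integrable_bound[OF integrable_mult_right[OF integrable_inverse_one_plus_square, of C]])
      (use C in \<open>auto simp: abs_mult\<close>)
qed

lemma integrable_stable_kernel_integrand:
  fixes \<gamma> t x :: real
  assumes "\<gamma> > 0" "t > 0"
  shows "integrable lborel (\<lambda>\<xi>. cos (\<xi> * x) * exp (- t * \<bar>\<xi>\<bar> powr \<gamma>))"
  by (rule Bochner_Integration.integrable_bound[OF integrable_exp_neg_powr[OF assms]])
    (auto simp: abs_mult intro!: mult_left_le_one_le)

section \<open>Sine representation and scaling of the stable kernel\<close>

lemma integral_even:
  fixes f :: "real \<Rightarrow> real"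
  assumes f: "integrable lborel f" and even: "\<And>x. f (- x) = f x"
  shows "(LBINT x. f x) = 2 * (LINT x:{0<..}|lborel. f x)"
proof -
  have i: "integrable lborel (\<lambda>x. indicator {0<..} x * f x)"
    by (rule Bochner_Integration.integrable_bound[OF f]) (use f in \<open>auto simp: indicator_def\<close>)
  then have i': "integrable lborel (\<lambda>x. indicator {0<..} (- x) * f (- x))"
    using lborel_integrable_real_affine[OF i, of "-1" 0] by simp
  have "(LBINT x. f x) = (LBINT x. indicator {0<..} x * f x + indicator {0<..} (- x) * f (- x))"
  proof (rule integral_cong_AE)
    have "AE x::real in lborel. x \<noteq> 0" by (rule AE_lborel_singleton)
    then show "AE x in lborel. f x = indicator {0<..} x * f x + indicator {0<..} (- x) * f (- x)"
      by eventually_elim (auto simp: indicator_def even)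
  qed (use f i i' in auto)
  also have "\<dots> = (LBINT x. indicator {0<..} x * f x) + (LBINT x. indicator {0<..} (- x) * f (- x))"
    by (rule Bochner_Integration.integral_add[OF i i'])
  also have "(LBINT x. indicator {0<..} (- x) * f (- x)) = (LBINT x. indicator {0<..} x * f x)"
    using lborel_integral_real_affine[of "-1" "\<lambda>x. indicator {0<..} x * f x" 0] by simp
  finally show ?thesis by (simp add: set_lebesgue_integral_def)
qed

text \<open>The variable G^\<gamma>(1/t) has the tail probability e^{-t y^\<gamma>}, so its density
  is minus the derivative of the factor in the cosine integral. Integrating by parts turns x cos(xy)
  into sin(xy); the boundary terms vanish through sin 0 = 0 and the decay of the
  exponential.\<close>

lemma stable_kernel_eq_sin:
  assumes \<gamma>: "\<gamma> > 0" and t: "t > 0" and x: "x \<noteq> 0"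
  shows "stable_kernel \<gamma> t x = 1 / (pi * x) * (LBINT y. g_density \<gamma> y (1 / t) * sin (x * y))"
proof -
  let ?e = "\<lambda>y::real. exp (- t * y powr \<gamma>)"
  let ?g = "\<lambda>y. \<gamma> * (y powr (\<gamma> - 1) / (1 / t)) * exp (- (y powr \<gamma>) / (1 / t))"
  have l: "(?e \<longlongrightarrow> ?e 0) (at_right 0)"
    using \<gamma> by (intro tendsto_intros) (auto simp: eventually_at_filter)
  have u: "(?e \<longlongrightarrow> 0) at_top" using \<gamma> t by real_asymp
  have de: "DERIV ?e y :> - ?g y" if "y > 0" for y
    using that t by (auto intro!: derivative_eq_intros simp: field_simps)
  \<comment> \<open>\<open>?g\<close> is nonnegative and has the bounded primitive
    -\<open>?e\<close>, so no estimate near 0 is needed even where the power is singular.\<close>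
  have g: "set_integrable lborel {0<..} ?g"
  proof (rule set_integrable_FTC_halfline_nonneg[where F="\<lambda>y. - ?e y"])
    show "DERIV (\<lambda>y. - ?e y) y :> ?g y" if "y > 0" for y
      using DERIV_minus[OF de[OF that]] by simp
    show "isCont ?g y" if "y > 0" for y using that t by (intro continuous_intros) auto
    show "0 \<le> ?g y" for y using \<gamma> t by simp
    show "((\<lambda>y. - ?e y) \<longlongrightarrow> - ?e 0) (at_right 0)" by (rule tendsto_minus[OF l])
    show "((\<lambda>y. - ?e y) \<longlongrightarrow> - 0) at_top" by (rule tendsto_minus[OF u])
  qed
  have A: "set_integrable lborel {0<..} (\<lambda>y. ?g y * sin (x * y))"
    unfolding set_integrable_def
    by (rule Bochner_Integration.integrable_bound[OF g[unfolded set_integrable_def]])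
      (use \<gamma> t in \<open>auto simp: abs_mult indicator_def intro!: mult_left_le\<close>)
  have B: "set_integrable lborel {0<..} (\<lambda>y. cos (y * x) * exp (- t * \<bar>y\<bar> powr \<gamma>))"
    unfolding set_integrable_def
    by (rule Bochner_Integration.integrable_bound[OF integrable_stable_kernel_integrand[OF \<gamma> t, of x]])
      (auto simp: indicator_def)
  have B': "set_integrable lborel {0<..} (\<lambda>y. x * (cos (y * x) * exp (- t * \<bar>y\<bar> powr \<gamma>)))"
    by (rule set_integrable_mult_right[OF B])
  have "(LINT y:{0<..}|lborel. x * (cos (y * x) * exp (- t * \<bar>y\<bar> powr \<gamma>)) - ?g y * sin (x * y)) = 0 - sin (x * 0) * ?e 0"
  proof (rule integral_FTC_halfline[where F="\<lambda>y. sin (x * y) * ?e y"])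
    fix y :: real assume y: "y > 0"
    have "DERIV (\<lambda>y. sin (x * y) * ?e y) y :> (cos (x * y) * x) * ?e y + (- ?g y) * sin (x * y)"
      by (intro DERIV_mult de y) (auto intro!: derivative_eq_intros)
    then show "((\<lambda>y. sin (x * y) * ?e y) has_vector_derivative
        x * (cos (y * x) * exp (- t * \<bar>y\<bar> powr \<gamma>)) - ?g y * sin (x * y)) (at y)"
      using y by (simp add: has_real_derivative_iff_has_vector_derivative mult_ac)
    have c1: "isCont (\<lambda>y. x * (cos (y * x) * exp (- t * \<bar>y\<bar> powr \<gamma>))) y"
      using y by (intro continuous_intros) simp
    have c2: "isCont ?g y" using y t by (intro continuous_intros) simp_all
    have c3: "isCont (\<lambda>y. sin (x * y)) y" by (intro continuous_intros)
    show "isCont (\<lambda>y. x * (cos (y * x) * exp (- t * \<bar>y\<bar> powr \<gamma>)) - ?g y * sin (x * y)) y"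
      by (rule isCont_diff[OF c1 isCont_mult[OF c2 c3]])
  next
    show "set_integrable lborel {0<..} (\<lambda>y. x * (cos (y * x) * exp (- t * \<bar>y\<bar> powr \<gamma>)) - ?g y * sin (x * y))"
      by (rule set_integral_diff(1)[OF B' A])
    have "((\<lambda>y. sin (x * y)) \<longlongrightarrow> sin (x * 0)) (at_right 0)" by (intro tendsto_intros)
    then show "((\<lambda>y. sin (x * y) * ?e y) \<longlongrightarrow> sin (x * 0) * ?e 0) (at_right 0)" by (rule tendsto_mult[OF _ l])
    show "((\<lambda>y. sin (x * y) * ?e y) \<longlongrightarrow> 0) at_top"
      by (rule Lim_null_comparison[OF _ u]) (auto simp: abs_mult intro!: mult_left_le_one_le)
  qed
  then have C: "x * (LINT y:{0<..}|lborel. cos (y * x) * exp (- t * \<bar>y\<bar> powr \<gamma>))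
      = (LINT y:{0<..}|lborel. ?g y * sin (x * y))"
    unfolding set_integral_diff(2)[OF B' A] set_integral_mult_right by simp
  have 1: "(LBINT y. g_density \<gamma> y (1 / t) * sin (x * y)) = (LINT y:{0<..}|lborel. ?g y * sin (x * y))"
    unfolding set_lebesgue_integral_def
    by (rule Bochner_Integration.integral_cong) (auto simp: g_density_def)
  have 2: "stable_kernel \<gamma> t x = (LINT y:{0<..}|lborel. cos (y * x) * exp (- t * \<bar>y\<bar> powr \<gamma>)) / pi"
    unfolding stable_kernel_def
    by (subst integral_even[OF integrable_stable_kernel_integrand[OF \<gamma> t]]) simp_all
  show ?thesis unfolding 1 2 C[symmetric] using x by simp
qed

text \<open>The factor c = s^{-1/\<gamma>} solves s c^\<gamma> = 1.\<close>

lemma stable_kernel_scale: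
  assumes \<gamma>: "\<gamma> > 0" and s: "s > 0"
  shows "stable_kernel \<gamma> s x = s powr (- 1 / \<gamma>) * stable_kernel \<gamma> 1 (s powr (- 1 / \<gamma>) * x)"
proof -
  define c where "c = s powr (- 1 / \<gamma>)"
  have c: "c > 0" using s by (simp add: c_def)
  have "s * c powr \<gamma> = 1" using s \<gamma> unfolding c_def powr_powr by (simp add: powr_minus_divide)
  then have sc: "s * \<bar>0 + c * \<xi>\<bar> powr \<gamma> = \<bar>\<xi>\<bar> powr \<gamma>" for \<xi>
    using c by (simp add: abs_mult powr_mult mult.assoc[symmetric])
  have "(LBINT \<xi>. cos (\<xi> * x) * exp (- s * \<bar>\<xi>\<bar> powr \<gamma>))
      = \<bar>c\<bar> *\<^sub>R (LBINT \<xi>. cos ((0 + c * \<xi>) * x) * exp (- s * \<bar>0 + c * \<xi>\<bar> powr \<gamma>))"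
    by (rule lborel_integral_real_affine) (use c in simp)
  also have "\<dots> = c * (LBINT \<xi>. cos (\<xi> * (c * x)) * exp (- 1 * \<bar>\<xi>\<bar> powr \<gamma>))"
    using c unfolding mult_minus_left sc by (simp add: mult_ac)
  finally show ?thesis by (simp add: stable_kernel_def c_def)
qed

lemma stable_kernel_measurable:
  "(\<lambda>(x, s). stable_kernel \<gamma> s x) \<in> borel_measurable (borel \<Otimes>\<^sub>M borel)"
  unfolding stable_kernel_def by measurable

lemma even_power_powr:
  fixes \<xi> :: real
  assumes "k \<ge> 1"
  shows "\<xi> ^ (2 * k) = \<bar>\<xi>\<bar> powr (2 * real k)"
proof -
  have "\<bar>\<xi>\<bar> powr (2 * real k) = \<bar>\<xi>\<bar> powr (real (2 * k))" by simp
  also have "\<dots> = \<bar>\<xi>\<bar> ^ (2 * k)" using assms by (intro powr_realpow') auto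
  also have "\<dots> = \<xi> ^ (2 * k)" by (rule power_even_abs) simp
  finally show ?thesis ..
qed

text \<open>The case j = 0 of the regularity clause makes u(.,s) continuous, and its prescribed
  transform is integrable, so inversion holds at every x rather than almost everywhere.\<close>

lemma pseudoprocess_density_eq_stable_kernel:
  assumes u: "pseudoprocess_density k u" and k: "k \<ge> 1" and s: "s > 0"
  shows "u x s = stable_kernel (2 * real k) s x"
proof -
  let ?E = "\<lambda>\<xi>::real. exp (- s * \<bar>\<xi>\<bar> powr (2 * real k))"
  have E: "exp (- s * \<xi> ^ (2 * k)) = ?E \<xi>" for \<xi>
    by (simp only: even_power_powr[OF k])
  have ui: "integrable lborel (\<lambda>x. u x s)" and uf: "fourier (\<lambda>x. u x s) \<xi> = of_real (?E \<xi>)" for \<xi>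
    using u s unfolding pseudoprocess_density_def E[symmetric] by blast+
  have "(\<lambda>y. u y s) differentiable (at x)"
  proof -
    have "\<forall>j<2 * k. (deriv ^^ j) (\<lambda>y. u y s) differentiable (at x)"
      using u s unfolding pseudoprocess_density_def by blast
    then have "(deriv ^^ 0) (\<lambda>y. u y s) differentiable (at x)" using k by (meson mult_pos_pos less_le_trans zero_less_numeral zero_less_one)
    then show ?thesis by simp
  qed
  then have uc: "isCont (\<lambda>y. u y s) x" by (rule differentiable_imp_continuous_within)
  have Ei: "integrable lborel ?E" using k s by (intro integrable_exp_neg_powr) auto
  have "fourier (\<lambda>x. u x s) = (\<lambda>\<xi>. of_real (?E \<xi>))" using uf by (rule ext)
  then have Fi: "integrable lborel (fourier (\<lambda>x. u x s))" using Ei by (simp only: integrable_of_real)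
  have "of_real (2 * pi * u x s) = (CLBINT \<xi>. iexp (- (\<xi> * x)) * complex_of_real (?E \<xi>))"
    using fourier_inversion[OF ui uc Fi] by (simp only: uf)
  then have "2 * pi * u x s = Re (CLBINT \<xi>. iexp (- (\<xi> * x)) * complex_of_real (?E \<xi>))"
    by (metis Re_complex_of_real)
  also have "\<dots> = (LBINT \<xi>. Re (iexp (- (\<xi> * x)) * complex_of_real (?E \<xi>)))"
    by (rule integral_Re[symmetric])
      (rule Bochner_Integration.integrable_bound[OF Ei], auto simp: norm_mult)
  also have "\<dots> = (LBINT \<xi>. cos (\<xi> * x) * ?E \<xi>)"
    by (simp add: Re_exp)
  finally show ?thesis by (simp add: stable_kernel_def field_simps)
qed

section \<open>Subordination\<close>

text \<open>Measurability with respect to F makes \<phi>(Y(c(s))(\<omega>)) a function of the pair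
  (s, \<omega>) on borel times F. The joint law of X and the identity into F is a product, so Fubini
  evaluates the expectation by first freezing s.\<close>

lemma independent_family_expectation:
  fixes Y :: "real \<Rightarrow> 'a \<Rightarrow> real" and X :: "'a \<Rightarrow> real" and \<phi> :: "real \<Rightarrow> real" and c :: "real \<Rightarrow> real"
  assumes M: "prob_space M" and X: "X \<in> borel_measurable M"
    and indep: "independent_family M Y X"
    and \<phi> [measurable]: "\<phi> \<in> borel_measurable borel" and bound: "\<And>y. \<bar>\<phi> y\<bar> \<le> B"
    and c [measurable]: "c \<in> borel_measurable borel"
  shows "(\<integral>\<omega>. \<phi> (Y (c (X \<omega>)) \<omega>) \<partial>M) = (\<integral>s. (\<integral>\<omega>. \<phi> (Y (c s) \<omega>) \<partial>M) \<partial>distr M borel X)"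
    and "(\<lambda>s. \<integral>\<omega>. \<phi> (Y (c s) \<omega>) \<partial>M) \<in> borel_measurable borel"
proof -
  interpret prob_space M by fact
  obtain F where F: "subalgebra M F"
    and Y [measurable]: "(\<lambda>(\<tau>, \<omega>). Y \<tau> \<omega>) \<in> borel_measurable (borel \<Otimes>\<^sub>M F)"
    and ind: "indep_set (sets F) {X -` A \<inter> space M | A. A \<in> sets borel}"
    using indep unfolding independent_family_def by blast
  have spF: "space F = space M" using F by (auto simp: subalgebra_def)
  have idF: "(\<lambda>\<omega>. \<omega>) \<in> measurable M F"
    using measurable_from_subalg[OF F measurable_ident] by (simp add: id_def)
  interpret PX: prob_space "distr M borel X" by (rule prob_space_distr[OF X])
  interpret PF: prob_space "distr M F (\<lambda>\<omega>. \<omega>)" by (rule prob_space_distr[OF idF])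
  have Xid: "(\<lambda>\<omega>. (X \<omega>, \<omega>)) \<in> measurable M (borel \<Otimes>\<^sub>M F)" using X idF by (rule measurable_Pair)
  \<comment> \<open>Independence is the product formula on rectangles, and a product of sigma-finite
    measures is determined by them.\<close>
  have D: "distr M borel X \<Otimes>\<^sub>M distr M F (\<lambda>\<omega>. \<omega>) = distr M (borel \<Otimes>\<^sub>M F) (\<lambda>\<omega>. (X \<omega>, \<omega>))"
  proof (rule pair_measure_eqI)
    fix A B assume "A \<in> sets (distr M borel X)" "B \<in> sets (distr M F (\<lambda>\<omega>. \<omega>))"
    then have A: "A \<in> sets borel" and B: "B \<in> sets F" by simp_all
    have BM: "B \<inter> space M = B" using sets.sets_into_space[OF B] spF by auto
    have "emeasure (distr M borel X) A = ennreal (prob (X -` A \<inter> space M))"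
      using A X by (simp add: emeasure_distr emeasure_eq_measure)
    moreover have "emeasure (distr M F (\<lambda>\<omega>. \<omega>)) B = ennreal (prob B)"
      using B idF BM by (simp add: emeasure_distr emeasure_eq_measure)
    moreover have "emeasure (distr M (borel \<Otimes>\<^sub>M F) (\<lambda>\<omega>. (X \<omega>, \<omega>))) (A \<times> B) = ennreal (prob (B \<inter> (X -` A \<inter> space M)))"
    proof -
      have "(\<lambda>\<omega>. (X \<omega>, \<omega>)) -` (A \<times> B) \<inter> space M = B \<inter> (X -` A \<inter> space M)" by auto
      then show ?thesis using A B Xid by (subst emeasure_distr) (auto simp: emeasure_eq_measure)
    qed
    moreover have "prob (B \<inter> (X -` A \<inter> space M)) = prob B * prob (X -` A \<inter> space M)"
      using A by (intro indep_setD[OF ind B]) blast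
    ultimately show "emeasure (distr M borel X) A * emeasure (distr M F (\<lambda>\<omega>. \<omega>)) B
        = emeasure (distr M (borel \<Otimes>\<^sub>M F) (\<lambda>\<omega>. (X \<omega>, \<omega>))) (A \<times> B)"
      by (simp add: ennreal_mult[symmetric] mult.commute)
  qed (simp_all add: PX.sigma_finite_measure_axioms PF.sigma_finite_measure_axioms cong: sets_pair_measure_cong)
  interpret PP: pair_prob_space "distr M borel X" "distr M F (\<lambda>\<omega>. \<omega>)" ..
  let ?\<psi> = "\<lambda>(s, \<omega>). \<phi> (Y (c s) \<omega>)"
  have \<psi> [measurable]: "?\<psi> \<in> borel_measurable (borel \<Otimes>\<^sub>M F)"
  proof -
    have "(\<lambda>p. (\<lambda>(\<tau>, \<omega>). Y \<tau> \<omega>) (c (fst p), snd p)) \<in> borel_measurable (borel \<Otimes>\<^sub>M F)"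
      by measurable
    then show ?thesis by (simp add: split_beta')
  qed
  have inner: "(\<integral>\<omega>. \<phi> (Y (c s) \<omega>) \<partial>distr M F (\<lambda>\<omega>. \<omega>)) = (\<integral>\<omega>. \<phi> (Y (c s) \<omega>) \<partial>M)" for s
  proof (rule integral_distr[OF idF])
    show "(\<lambda>\<omega>. \<phi> (Y (c s) \<omega>)) \<in> borel_measurable F"
      using measurable_compose[OF measurable_Pair1' \<psi>, of s] by simp
  qed
  have "(\<integral>\<omega>. \<phi> (Y (c (X \<omega>)) \<omega>) \<partial>M) = (\<integral>p. ?\<psi> p \<partial>distr M (borel \<Otimes>\<^sub>M F) (\<lambda>\<omega>. (X \<omega>, \<omega>)))"
    by (subst integral_distr[OF Xid \<psi>]) simp
  also have "\<dots> = (\<integral>p. ?\<psi> p \<partial>(distr M borel X \<Otimes>\<^sub>M distr M F (\<lambda>\<omega>. \<omega>)))" by (simp only: D)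
  also have "\<dots> = (\<integral>s. (\<integral>\<omega>. \<phi> (Y (c s) \<omega>) \<partial>distr M F (\<lambda>\<omega>. \<omega>)) \<partial>distr M borel X)"
  proof (rule PP.integral_fst'[symmetric, of ?\<psi>, simplified])
    show "integrable (distr M borel X \<Otimes>\<^sub>M distr M F (\<lambda>\<omega>. \<omega>)) ?\<psi>"
      by (rule PP.P.integrable_const_bound[of _ B]) (use bound \<psi> in auto)
  qed
  finally show "(\<integral>\<omega>. \<phi> (Y (c (X \<omega>)) \<omega>) \<partial>M) = (\<integral>s. (\<integral>\<omega>. \<phi> (Y (c s) \<omega>) \<partial>M) \<partial>distr M borel X)"
    by (simp only: inner)
  have "(\<lambda>s. \<integral>\<omega>. \<phi> (Y (c s) \<omega>) \<partial>distr M F (\<lambda>\<omega>. \<omega>)) \<in> borel_measurable borel"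
    by (rule PF.borel_measurable_lebesgue_integral) (use \<psi> in simp)
  then show "(\<lambda>s. \<integral>\<omega>. \<phi> (Y (c s) \<omega>) \<partial>M) \<in> borel_measurable borel" by (simp only: inner)
qed


text \<open>Both facts are transferred from u, which avoids estimating the oscillating cosine
  integral for large x.\<close>

lemma pseudoprocess_stable_kernel:
  assumes u: "pseudoprocess_density k u" and k: "k \<ge> 1" and s: "s > 0"
  shows "integrable lborel (stable_kernel (2 * real k) s)"
    and "fourier (stable_kernel (2 * real k) s) \<xi> = of_real (exp (- s * \<xi> ^ (2 * k)))"
proof -
  have "(\<lambda>x. u x s) = stable_kernel (2 * real k) s"
    by (rule ext) (rule pseudoprocess_density_eq_stable_kernel[OF u k s])
  then show "integrable lborel (stable_kernel (2 * real k) s)"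
    and "fourier (stable_kernel (2 * real k) s) \<xi> = of_real (exp (- s * \<xi> ^ (2 * k)))"
    using u s unfolding pseudoprocess_density_def by metis+
qed

text \<open>For a signed kernel the L^1 norm need not be 1. That it does not depend on s makes the
  double integral over s and x converge for every integrable weight in s.\<close>

lemma integral_abs_stable_kernel:
  assumes \<gamma>: "\<gamma> > 0" and s: "s > 0"
  shows "(LBINT x. \<bar>stable_kernel \<gamma> s x\<bar>) = (LBINT x. \<bar>stable_kernel \<gamma> 1 x\<bar>)"
proof -
  define c where "c = s powr (- 1 / \<gamma>)"
  have c: "c > 0" using s by (simp add: c_def)
  have "(LBINT x. \<bar>stable_kernel \<gamma> 1 x\<bar>) = \<bar>c\<bar> *\<^sub>R (LBINT x. \<bar>stable_kernel \<gamma> 1 (0 + c * x)\<bar>)"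
    by (rule lborel_integral_real_affine) (use c in simp)
  also have "\<dots> = (LBINT x. c * \<bar>stable_kernel \<gamma> 1 (c * x)\<bar>)"
    using c by (simp only: integral_mult_right_zero) simp
  also have "\<dots> = (LBINT x. \<bar>stable_kernel \<gamma> s x\<bar>)"
    using c unfolding stable_kernel_scale[OF \<gamma> s] c_def[symmetric] by (simp add: abs_mult)
  finally show ?thesis ..
qed

section \<open>Averaging kernels over a law with Laplace transform e^{-t \<mu>^\<beta>}\<close>

context
  fixes k :: nat and \<beta> t :: real and u :: "real \<Rightarrow> real \<Rightarrow> real" and f :: "real \<Rightarrow> real"
  assumes k: "k \<ge> 1" and \<beta>: "0 < \<beta>" and t: "0 < t" and u: "pseudoprocess_density k u"
    and f: "integrable lborel f" "\<And>s. 0 \<le> f s" "\<And>s. s < 0 \<Longrightarrow> f s = 0"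
    and laplace: "\<And>\<mu>. 0 \<le> \<mu> \<Longrightarrow> (LBINT s. f s * exp (- \<mu> * s)) = exp (- t * \<mu> powr \<beta>)"
begin

text \<open>The kernel facts hold for s > 0 only, while f may be nonzero at s = 0; that point is a
  null set.\<close>

lemma subordination_restrict:
  fixes g :: "real \<Rightarrow> 'b::{banach, second_countable_topology}"
  assumes [measurable]: "g \<in> borel_measurable borel"
  shows "(\<integral>s. (indicator {0<..} s * f s) *\<^sub>R g s \<partial>lborel) = (\<integral>s. f s *\<^sub>R g s \<partial>lborel)"
proof -
  have [measurable]: "f \<in> borel_measurable borel" using f(1) by auto
  show ?thesis
  proof (rule integral_cong_AE)
    have "AE s::real in lborel. s \<noteq> 0" by (rule AE_lborel_singleton)
    then show "AE s in lborel. (indicator {0<..} s * f s) *\<^sub>R g s = f s *\<^sub>R g s"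
    proof eventually_elim
      case (elim s)
      then show ?case using f(3)[of s] by (cases "s > 0") auto
    qed
  qed measurable
qed

lemma subordination_laplace:
  "(LBINT s. f s * exp (- s * \<xi> ^ (2 * k))) = exp (- t * \<bar>\<xi>\<bar> powr (2 * real k * \<beta>))"
proof -
  have "(LBINT s. f s * exp (- s * \<xi> ^ (2 * k))) = exp (- t * (\<xi> ^ (2 * k)) powr \<beta>)"
    using laplace[OF zero_le_even_power[of "2 * k" \<xi>]] by (simp add: mult.commute)
  then show ?thesis by (simp add: even_power_powr[OF k] powr_powr)
qed

text \<open>Fubini in (s, x), justified by the common L^1 norm \<open>N\<close> of the kernels; the
  transform in x then leaves the Laplace transform of f at \<mu> = \<xi>^{2k}.\<close>

lemma fourier_subordination:
  defines "v \<equiv> \<lambda>x. LBINT s. f s * stable_kernel (2 * real k) s x"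
  shows "integrable lborel v"
    and "fourier v \<xi> = of_real (exp (- t * \<bar>\<xi>\<bar> powr (2 * real k * \<beta>)))"
proof -
  have [measurable]: "f \<in> borel_measurable borel" using f(1) by auto
  let ?K = "stable_kernel (2 * real k)"
  have k2: "2 * real k > 0" using k by simp
  note K [measurable] = stable_kernel_measurable[of "2 * real k"]
  define N where "N = (LBINT x. \<bar>?K 1 x\<bar>)"
  define \<psi> where "\<psi> s x = indicator {0<..} s * f s * ?K s x" for s x
  have [measurable]: "case_prod \<psi> \<in> borel_measurable (lborel \<Otimes>\<^sub>M lborel)"
  proof -
    have "(\<lambda>p. indicator {0<..} (fst p) * f (fst p) * (\<lambda>(x, s). ?K s x) (snd p, fst p))
        \<in> borel_measurable (borel \<Otimes>\<^sub>M borel)" by measurable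
    then show ?thesis by (simp add: \<psi>_def split_beta')
  qed
  have \<psi>: "integrable (lborel \<Otimes>\<^sub>M lborel) (case_prod \<psi>)"
  proof (rule lborel_pair.Fubini_integrable)
    show "AE s in lborel. integrable lborel (\<lambda>x. case_prod \<psi> (s, x))"
    proof (rule AE_I2)
      fix s :: real
      show "integrable lborel (\<lambda>x. case_prod \<psi> (s, x))"
        using pseudoprocess_stable_kernel(1)[OF u k, of s] by (cases "s > 0") (simp_all add: \<psi>_def)
    qed
    have "(LBINT x. norm (case_prod \<psi> (s, x))) = indicator {0<..} s * f s * N" for s
    proof (cases "s > 0")
      case True
      have "(LBINT x. norm (case_prod \<psi> (s, x))) = (LBINT x. f s * \<bar>?K s x\<bar>)"
        using True f(2)[of s] by (simp add: \<psi>_def abs_mult)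
      also have "\<dots> = f s * N"
        by (simp only: integral_mult_right_zero integral_abs_stable_kernel[OF k2 True] N_def)
      finally show ?thesis using True by simp
    qed (simp add: \<psi>_def)
    moreover have "integrable lborel (\<lambda>s. indicator {0<..} s * f s * N)"
      by (rule integrable_mult_left, rule Bochner_Integration.integrable_bound[OF f(1)]) (auto simp: indicator_def)
    ultimately show "integrable lborel (\<lambda>s. LBINT x. norm (case_prod \<psi> (s, x)))" by simp
  qed measurable
  have Ks [measurable]: "(\<lambda>s. ?K s x) \<in> borel_measurable borel" for x
    using measurable_compose[OF measurable_Pair1' K, of x] by simp
  have v: "v x = (LBINT s. \<psi> s x)" for x
    using subordination_restrict[OF Ks[of x]] by (simp add: v_def \<psi>_def)
  show "integrable lborel v"
    using lborel_pair.integrable_snd[OF \<psi>] by (simp add: v[abs_def])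
  have \<psi>c: "integrable (lborel \<Otimes>\<^sub>M lborel) (\<lambda>(s, x). iexp (\<xi> * x) * complex_of_real (\<psi> s x))"
    by (rule Bochner_Integration.integrable_bound[OF \<psi>]) (auto simp: norm_mult)
  have "fourier v \<xi> = (CLBINT x. CLBINT s. iexp (\<xi> * x) * complex_of_real (\<psi> s x))"
    by (simp add: fourier_def v)
  also have "\<dots> = (CLBINT s. CLBINT x. iexp (\<xi> * x) * complex_of_real (\<psi> s x))"
    by (rule lborel_pair.Fubini_integral[OF \<psi>c])
  also have "\<dots> = (CLBINT s. of_real ((indicator {0<..} s * f s) *\<^sub>R exp (- s * \<xi> ^ (2 * k))))"
  proof (rule Bochner_Integration.integral_cong)
    fix s :: real
    have "(CLBINT x. iexp (\<xi> * x) * complex_of_real (\<psi> s x)) = fourier (\<lambda>x. (indicator {0<..} s * f s) * ?K s x) \<xi>"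
      by (simp only: fourier_def \<psi>_def)
    also have "\<dots> = of_real (indicator {0<..} s * f s) * fourier (?K s) \<xi>"
      by (rule fourier_cmult)
    also have "\<dots> = of_real ((indicator {0<..} s * f s) *\<^sub>R exp (- s * \<xi> ^ (2 * k)))"
      using pseudoprocess_stable_kernel(2)[OF u k, of s \<xi>] by (cases "s > 0") simp_all
    finally show "(CLBINT x. iexp (\<xi> * x) * complex_of_real (\<psi> s x))
        = of_real ((indicator {0<..} s * f s) *\<^sub>R exp (- s * \<xi> ^ (2 * k)))" .
  qed simp
  also have "\<dots> = of_real (LBINT s. f s *\<^sub>R exp (- s * \<xi> ^ (2 * k)))"
    unfolding integral_complex_of_real by (subst subordination_restrict) simp_all
  finally show "fourier v \<xi> = of_real (exp (- t * \<bar>\<xi>\<bar> powr (2 * real k * \<beta>)))"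
    by (simp only: real_scaleR_def subordination_laplace)
qed

text \<open>Equality of transforms would give this only almost everywhere. Applying Fubini in
  (\<xi>, s) to the cosine integral gives it at every x; integrating the absolute value over s
  leaves |cos(\<xi>x)| e^{-t|\<xi>|^{2k\<beta>}}, which is integrable.\<close>

lemma stable_kernel_subordination:
  "(LBINT s. f s * stable_kernel (2 * real k) s x) = stable_kernel (2 * real k * \<beta>) t x"
proof -
  have [measurable]: "f \<in> borel_measurable borel" using f(1) by auto
  define \<theta> where "\<theta> \<xi> s = f s * (cos (\<xi> * x) * exp (- s * \<bar>\<xi>\<bar> powr (2 * real k)))" for \<xi> s
  have [measurable]: "case_prod \<theta> \<in> borel_measurable (lborel \<Otimes>\<^sub>M lborel)"
    unfolding \<theta>_def by measurable
  have i: "integrable lborel (\<lambda>s. f s * exp (- s * \<bar>\<xi>\<bar> powr (2 * real k)))" for \<xi>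
  proof (rule Bochner_Integration.integrable_bound[OF f(1)])
    show "AE s in lborel. norm (f s * exp (- s * \<bar>\<xi>\<bar> powr (2 * real k))) \<le> norm (f s)"
    proof (rule AE_I2)
      fix s
      show "norm (f s * exp (- s * \<bar>\<xi>\<bar> powr (2 * real k))) \<le> norm (f s)"
        using f(2)[of s] f(3)[of s] by (cases "s < 0") (auto simp: abs_mult intro!: mult_left_le)
    qed
  qed measurable
  have L: "(LBINT s. f s * exp (- s * \<bar>\<xi>\<bar> powr (2 * real k))) = exp (- t * \<bar>\<xi>\<bar> powr (2 * real k * \<beta>))" for \<xi>
    using subordination_laplace[of \<xi>] by (simp add: even_power_powr[OF k])
  have \<theta>: "integrable (lborel \<Otimes>\<^sub>M lborel) (case_prod \<theta>)"
  proof (rule lborel_pair.Fubini_integrable)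
    have "integrable lborel (\<theta> \<xi>)" for \<xi>
      using integrable_mult_right[OF i[of \<xi>], of "cos (\<xi> * x)"] by (simp add: \<theta>_def[abs_def] mult_ac)
    then show "AE \<xi> in lborel. integrable lborel (\<lambda>s. case_prod \<theta> (\<xi>, s))" by simp
    have "(LBINT s. norm (case_prod \<theta> (\<xi>, s))) = \<bar>cos (\<xi> * x)\<bar> * exp (- t * \<bar>\<xi>\<bar> powr (2 * real k * \<beta>))" for \<xi>
    proof -
      have "(LBINT s. norm (case_prod \<theta> (\<xi>, s))) = (LBINT s. \<bar>cos (\<xi> * x)\<bar> * (f s * exp (- s * \<bar>\<xi>\<bar> powr (2 * real k))))"
        using f(2) by (intro Bochner_Integration.integral_cong) (simp_all add: \<theta>_def abs_mult mult_ac)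
      then show ?thesis by (simp only: integral_mult_right_zero L)
    qed
    moreover have "integrable lborel (\<lambda>\<xi>. \<bar>cos (\<xi> * x)\<bar> * exp (- t * \<bar>\<xi>\<bar> powr (2 * real k * \<beta>)))"
      by (rule Bochner_Integration.integrable_bound[OF integrable_exp_neg_powr[of "2 * real k * \<beta>" t]])
        (use k \<beta> t in \<open>auto simp: abs_mult intro!: mult_left_le_one_le\<close>)
    ultimately show "integrable lborel (\<lambda>\<xi>. LBINT s. norm (case_prod \<theta> (\<xi>, s)))" by simp
  qed measurable
  have "(LBINT s. f s * stable_kernel (2 * real k) s x) = (LBINT s. (LBINT \<xi>. \<theta> \<xi> s) / (2 * pi))"
    unfolding \<theta>_def integral_mult_right_zero stable_kernel_def by simp
  also have "\<dots> = (LBINT s. LBINT \<xi>. \<theta> \<xi> s) / (2 * pi)" by (rule integral_divide_zero)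
  also have "(LBINT s. LBINT \<xi>. \<theta> \<xi> s) = (LBINT \<xi>. LBINT s. \<theta> \<xi> s)"
    by (rule lborel_pair.Fubini_integral[OF \<theta>])
  also have "\<dots> = (LBINT \<xi>. cos (\<xi> * x) * exp (- t * \<bar>\<xi>\<bar> powr (2 * real k * \<beta>)))"
  proof (rule Bochner_Integration.integral_cong)
    fix \<xi>
    have "(LBINT s. \<theta> \<xi> s) = (LBINT s. cos (\<xi> * x) * (f s * exp (- s * \<bar>\<xi>\<bar> powr (2 * real k))))"
      unfolding \<theta>_def by (simp only: mult_ac)
    then show "(LBINT s. \<theta> \<xi> s) = cos (\<xi> * x) * exp (- t * \<bar>\<xi>\<bar> powr (2 * real k * \<beta>))"
      by (simp only: integral_mult_right_zero L)
  qed simp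
  finally show ?thesis by (simp only: stable_kernel_def)
qed

end

text \<open>Cutting h off to the half-line turns integrals against the law of H(t) into integrals
  over the line. The Laplace transform is taken from the definition of the subordinator and
  rewritten in terms of f.\<close>

lemma halfline_density_facts:
  assumes M: "prob_space M" and H: "stable_subordinator M \<beta> H" and t: "t > 0"
    and h: "has_halfline_density M (H t) (\<lambda>s. h s t)"
  defines "f \<equiv> \<lambda>s. h s t * indicator {0..} s"
  shows "integrable lborel f" and "\<And>s. 0 \<le> f s" and "\<And>s. s < 0 \<Longrightarrow> f s = 0"
    and "\<And>\<mu>. 0 \<le> \<mu> \<Longrightarrow> (LBINT s. f s * exp (- \<mu> * s)) = exp (- t * \<mu> powr \<beta>)"
    and "\<And>g. g \<in> borel_measurable borel \<Longrightarrow> (\<integral>s. g s \<partial>distr M borel (H t)) = (LBINT s. f s * g s)"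
proof -
  interpret prob_space M by fact
  have D: "distributed M lborel (H t) (\<lambda>s. ennreal (f s))"
    using h unfolding has_halfline_density_def f_def by blast
  show f0: "0 \<le> f s" for s
    using h unfolding has_halfline_density_def f_def by (simp add: indicator_def)
  show "f s = 0" if "s < 0" for s using that by (simp add: f_def)
  have Hm: "H t \<in> borel_measurable M" using H t unfolding stable_subordinator_def by simp
  have I: "(LBINT s. f s * g s) = (\<integral>\<omega>. g (H t \<omega>) \<partial>M)" if "g \<in> borel_measurable borel" for g :: "real \<Rightarrow> real"
    by (rule distributed_integral[OF D]) (use that f0 in auto)
  have "integrable lborel (\<lambda>s. f s * 1)"
    by (subst distributed_integrable[OF D]) (use f0 in auto)
  then show "integrable lborel f" by simp
  show "(LBINT s. f s * exp (- \<mu> * s)) = exp (- t * \<mu> powr \<beta>)" if "0 \<le> \<mu>" for \<mu>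
    using H t that by (subst I) (auto simp: stable_subordinator_def)
  show "(\<integral>s. g s \<partial>distr M borel (H t)) = (LBINT s. f s * g s)" if "g \<in> borel_measurable borel" for g :: "real \<Rightarrow> real"
    using I[OF that] integral_distr[OF Hm that] by simp
qed

section \<open>Expectations of sines and the theorem\<close>

lemma g_density_nonneg: "\<gamma> > 0 \<Longrightarrow> t > 0 \<Longrightarrow> 0 \<le> g_density \<gamma> x t"
  by (simp add: g_density_def)

lemma expectation_sin_eq_stable_kernel:
  assumes G: "distributed M lborel X (\<lambda>x. ennreal (g_density \<gamma> x (1 / t)))"
    and \<gamma>: "\<gamma> > 0" and t: "t > 0" and x: "x \<noteq> 0"
  shows "(\<integral>\<omega>. sin (x * X \<omega>) \<partial>M) = pi * x * stable_kernel \<gamma> t x"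
proof -
  have "(LBINT y. g_density \<gamma> y (1 / t) * sin (x * y)) = (\<integral>\<omega>. sin (x * X \<omega>) \<partial>M)"
    by (rule distributed_integral[OF G]) (use \<gamma> t in \<open>auto intro!: g_density_nonneg\<close>)
  then show ?thesis using stable_kernel_eq_sin[OF \<gamma> t x] x by simp
qed

theorem theorem4p1:
  fixes k :: nat and \<beta> :: real
    and M :: "'a measure"
    and H :: "real \<Rightarrow> 'a \<Rightarrow> real" and G :: "real \<Rightarrow> real \<Rightarrow> 'a \<Rightarrow> real"
    and u h :: "real \<Rightarrow> real \<Rightarrow> real"
  assumes "k \<ge> 1" and "0 < \<beta>" and "\<beta> < 1" and "2 * real k * \<beta> \<notin> \<nat>"
    and "prob_space M"
    and "pseudoprocess_density k u"
    and "stable_subordinator M \<beta> H"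
    and "\<And>t. t > 0 \<Longrightarrow> has_halfline_density M (H t) (\<lambda>s. h s t)"
    and "\<And>\<gamma> t. \<gamma> > 0 \<Longrightarrow> t > 0 \<Longrightarrow>
           distributed M lborel (G \<gamma> t) (\<lambda>x. ennreal (g_density \<gamma> x t))"
    and "\<And>t. t > 0 \<Longrightarrow> independent_family M (G (2 * real k)) (H t)"
  shows "\<exists>v. fourier_solution (riesz (2 * real k * \<beta>)) v \<and>
           (\<forall>w. fourier_solution (riesz (2 * real k * \<beta>)) w \<longrightarrow>
              (\<forall>t>0. AE x in lborel. w x t = v x t)) \<and>
           (\<forall>t>0. \<forall>x. x \<noteq> 0 \<longrightarrow>
              v x t = 1 / (pi * x) * (\<integral>\<omega>. sin (x * G (2 * real k) (1 / H t \<omega>) \<omega>) \<partial>M) \<and>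
              v x t = 1 / (pi * x) * (\<integral>\<omega>. sin (x * G (2 * real k * \<beta>) (1 / t) \<omega>) \<partial>M)) \<and>
           (\<forall>t>0. \<forall>x. v x t = subordinated_density u h x t)"
proof -
  define \<gamma> where "\<gamma> = 2 * real k * \<beta>"
  \<comment> \<open>With this witness the agreement with the law of the pseudoprocess is the
    definition; the work lies in the equation and the two expectations.\<close>
  define v where "v = subordinated_density u h"
  define F where "F t s = h s t * indicator {0..} s" for t s
  have k2: "2 * real k > 0" using \<open>k \<ge> 1\<close> by simp
  have \<gamma>: "\<gamma> > 0" "\<gamma> \<notin> \<nat>" using assms(1-4) by (simp_all add: \<gamma>_def)
  note facts = halfline_density_facts[OF \<open>prob_space M\<close> \<open>stable_subordinator M \<beta> H\<close>, where h=h]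
  have K_measurable [measurable]: "(\<lambda>s. stable_kernel (2 * real k) s x) \<in> borel_measurable borel" for x
    using measurable_compose[OF measurable_Pair1' stable_kernel_measurable, of x] by simp
  have v_sub: "v x t = (LBINT s. F t s * stable_kernel (2 * real k) s x)" if t: "t > 0" for x t
  proof -
    note facts = facts[OF t assms(8)[OF t], folded F_def]
    have [measurable]: "F t \<in> borel_measurable borel" using facts(1) by auto
    have "v x t = (LBINT s. indicator {0..} s *\<^sub>R (u x s * h s t))"
      by (simp add: v_def subordinated_density_def set_lebesgue_integral_def)
    \<comment> \<open>Nothing is known about \<open>u x 0\<close>.\<close>
    also have "\<dots> = (LBINT s. F t s * (if s = 0 then u x 0 else stable_kernel (2 * real k) s x))"
      by (rule Bochner_Integration.integral_cong)
        (auto simp: F_def indicator_def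
          pseudoprocess_density_eq_stable_kernel[OF \<open>pseudoprocess_density k u\<close> \<open>k \<ge> 1\<close>])
    also have "\<dots> = (LBINT s. F t s * stable_kernel (2 * real k) s x)"
    proof (rule integral_cong_AE)
      have "AE s::real in lborel. s \<noteq> 0" by (rule AE_lborel_singleton)
      then show "AE s in lborel. F t s * (if s = 0 then u x 0 else stable_kernel (2 * real k) s x)
          = F t s * stable_kernel (2 * real k) s x"
        by eventually_elim simp
    qed measurable
    finally show ?thesis .
  qed
  have v_ker: "v x t = stable_kernel \<gamma> t x" if t: "t > 0" for x t
    using stable_kernel_subordination[OF \<open>k \<ge> 1\<close> \<open>0 < \<beta>\<close> t \<open>pseudoprocess_density k u\<close>
        facts(1-4)[OF t assms(8)[OF t], folded F_def]]
    by (simp add: v_sub[OF t] \<gamma>_def)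
  have v_int: "integrable lborel (\<lambda>x. v x t)"
    and v_fou: "fourier (\<lambda>x. v x t) \<xi> = of_real (exp (- t * \<bar>\<xi>\<bar> powr \<gamma>))" if t: "t > 0" for t \<xi>
    using fourier_subordination[OF \<open>k \<ge> 1\<close> \<open>0 < \<beta>\<close> t \<open>pseudoprocess_density k u\<close>
        facts(1-4)[OF t assms(8)[OF t], folded F_def]]
    by (simp_all add: v_sub[OF t] \<gamma>_def)
  note sym = has_fourier_symbol_riesz[OF \<gamma>]
  have "fourier_solution (riesz \<gamma>) v"
    unfolding fourier_solution_def
  proof (intro conjI exI allI impI)
    show "integrable lborel (\<lambda>x. v x t)" if "t > 0" for t by (rule v_int[OF that])
    show "has_fourier_symbol (riesz \<gamma>) (\<lambda>\<xi>. - of_real (\<bar>\<xi>\<bar> powr \<gamma>))" by (rule sym)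
    fix \<xi> :: real
    let ?e = "\<lambda>r. complex_of_real (exp (- r * \<bar>\<xi>\<bar> powr \<gamma>))"
    show "((\<lambda>r. fourier (\<lambda>x. v x r) \<xi>) has_vector_derivative
        - of_real (\<bar>\<xi>\<bar> powr \<gamma>) * fourier (\<lambda>x. v x t) \<xi>) (at t)" if t: "t > 0" for t
    \<comment> \<open>The formula for the transform is known only for positive times, so the
      derivative is transferred on the open half-line.\<close>
    proof (rule has_vector_derivative_transform_within_open[where f="?e" and S="{0<..}"])
      have "((\<lambda>r. exp (- r * \<bar>\<xi>\<bar> powr \<gamma>)) has_real_derivative
          (- (\<bar>\<xi>\<bar> powr \<gamma>) * exp (- t * \<bar>\<xi>\<bar> powr \<gamma>))) (at t)"
        by (auto intro!: derivative_eq_intros)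
      from has_vector_derivative_of_real[OF this]
      show "(?e has_vector_derivative - of_real (\<bar>\<xi>\<bar> powr \<gamma>) * fourier (\<lambda>x. v x t) \<xi>) (at t)"
        by (simp add: v_fou[OF t])
    qed (use t v_fou in auto)
    have "((\<lambda>r. exp (- r * \<bar>\<xi>\<bar> powr \<gamma>)) \<longlongrightarrow> exp (- 0 * \<bar>\<xi>\<bar> powr \<gamma>)) (at_right 0)"
      by (intro tendsto_intros)
    from tendsto_of_real[OF this, where 'a=complex]
    have "(?e \<longlongrightarrow> 1) (at_right 0)" by simp
    then show "((\<lambda>r. fourier (\<lambda>x. v x r) \<xi>) \<longlongrightarrow> 1) (at_right 0)"
      by (rule Lim_transform_eventually) (simp add: eventually_at_filter v_fou)
  qed
  moreover have "AE x in lborel. w x t = v x t" if w: "fourier_solution (riesz \<gamma>) w" and t: "t > 0" for w t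
  proof -
    obtain \<sigma> where \<sigma>: "has_fourier_symbol (riesz \<gamma>) \<sigma>"
      and ode: "\<And>\<xi> t. t > 0 \<Longrightarrow> ((\<lambda>r. fourier (\<lambda>x. w x r) \<xi>) has_vector_derivative
          \<sigma> \<xi> * fourier (\<lambda>x. w x t) \<xi>) (at t)"
      and lim: "\<And>\<xi>. ((\<lambda>r. fourier (\<lambda>x. w x r) \<xi>) \<longlongrightarrow> 1) (at_right 0)"
      and wi: "integrable lborel (\<lambda>x. w x t)"
      using w t unfolding fourier_solution_def by blast
    have "\<sigma> = (\<lambda>\<xi>. - of_real (\<bar>\<xi>\<bar> powr \<gamma>))" by (rule has_fourier_symbol_unique[OF \<sigma> sym])
    note ode' = ode[unfolded this]
    have "fourier (\<lambda>x. w x t) \<xi> = of_real (exp (- (\<bar>\<xi>\<bar> powr \<gamma>) * t))" for \<xi>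
      by (rule exponential_ode_unique[where \<phi>="\<lambda>r. fourier (\<lambda>x. w x r) \<xi>", OF ode' lim t])
    then show ?thesis
      by (intro fourier_unique wi v_int[OF t]) (simp add: v_fou[OF t] mult.commute)
  qed
  moreover have "v x t = 1 / (pi * x) * (\<integral>\<omega>. sin (x * G (2 * real k) (1 / H t \<omega>) \<omega>) \<partial>M)"
    and "v x t = 1 / (pi * x) * (\<integral>\<omega>. sin (x * G \<gamma> (1 / t) \<omega>) \<partial>M)" if t: "t > 0" and x: "x \<noteq> 0" for x t
  proof -
    note facts = facts[OF t assms(8)[OF t], folded F_def]
    have Hm: "H t \<in> borel_measurable M" using \<open>stable_subordinator M \<beta> H\<close> t unfolding stable_subordinator_def by simp
    show "v x t = 1 / (pi * x) * (\<integral>\<omega>. sin (x * G \<gamma> (1 / t) \<omega>) \<partial>M)"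
      using expectation_sin_eq_stable_kernel[OF assms(9)[of \<gamma> "1 / t"] \<gamma>(1) t x] \<gamma> t x v_ker[OF t] by simp
    \<comment> \<open>\<open>R\<close> is the expectation with the parameter frozen at s. It equals
      pi x times the kernel for s > 0 only; for s < 0 the weight \<open>F t\<close> vanishes and s =
      0 is a null set.\<close>
    define R where "R s = (\<integral>\<omega>. sin (x * G (2 * real k) (1 / s) \<omega>) \<partial>M)" for s
    have sin: "(\<lambda>y. sin (x * y)) \<in> borel_measurable borel" "\<And>y. \<bar>sin (x * y)\<bar> \<le> 1"
      and inv: "(\<lambda>s::real. 1 / s) \<in> borel_measurable borel" by simp_all
    note E = independent_family_expectation[OF \<open>prob_space M\<close> Hm assms(10)[OF t] sin inv, folded R_def]
    have "(\<integral>\<omega>. sin (x * G (2 * real k) (1 / H t \<omega>) \<omega>) \<partial>M) = (LBINT s. F t s * R s)"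
      unfolding E(1) by (rule facts(5)[OF E(2)])
    also have "\<dots> = (LBINT s. pi * x * (F t s * stable_kernel (2 * real k) s x))"
    proof (rule integral_cong_AE)
      have "AE s::real in lborel. s \<noteq> 0" by (rule AE_lborel_singleton)
      then show "AE s in lborel. F t s * R s = pi * x * (F t s * stable_kernel (2 * real k) s x)"
      proof eventually_elim
        case (elim s)
        show ?case
        proof (cases "s > 0")
          case True
          then have "R s = pi * x * stable_kernel (2 * real k) s x"
            unfolding R_def by (intro expectation_sin_eq_stable_kernel assms(9) k2 x) simp_all
          then show ?thesis by simp
        next
          case False
          with elim show ?thesis using facts(3)[of s] by simp
        qed
      qed
      have [measurable]: "F t \<in> borel_measurable borel" "R \<in> borel_measurable borel"
        using facts(1) E(2) by auto
      show "(\<lambda>s. F t s * R s) \<in> borel_measurable lborel"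
        "(\<lambda>s. pi * x * (F t s * stable_kernel (2 * real k) s x)) \<in> borel_measurable lborel" by measurable
    qed
    also have "\<dots> = pi * x * v x t" by (simp only: integral_mult_right_zero v_sub[OF t])
    finally show "v x t = 1 / (pi * x) * (\<integral>\<omega>. sin (x * G (2 * real k) (1 / H t \<omega>) \<omega>) \<partial>M)" using x by simp
  qed
  ultimately show ?thesis
    unfolding \<gamma>_def[symmetric] by (intro exI[of _ v]) (simp add: v_def)
qed

end
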